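(* Let $g\colon(L^2,\langle\cdot,\cdot\rangle)\to\mathbb{R}^{p+2}_+$, $p\ge1$, be a substantial $(n-2)$-singular minimal surface with density vector $e$, where $L^2$ is an oriented two-dimensional Riemannian manifold. Then, for any simply connected complex chart $(U,z)$ of $(L^2,\langle\cdot,\cdot\rangle)$, there exists a non-holomorphic map $G=\sum_{i=1}^pG_ie_i\colon U\to\mathbb{C}^p$, with $G_p\neq0$, where $\{e_1,\dots,e_{p-1},e_p=e\}$ is an orthonormal basis of $\mathbb{C}^p$, that satisfies $$G_{\bar z z}=-\frac{n}{n-2}\frac{\|G_{\bar z}\|^2}{\|F(G)\|^2}G_pF(G)+\frac{\|G_{\bar z}\|^2}{\|F(G)\|^2}\langle G,G\rangle\bar G_pF(G)+\frac{\langle G_{\bar z},\overline{F(G)}\rangle}{\|F(G)\|^2}(F(G))_z\qquad(1)$$ and $$G_{\bar z}\wedge F(G)=0,\qquad(2)$$ where $F(G)\neq0$ and $F\colon\mathbb{C}^p\to\mathbb{C}^p$ is given by $$F(w)=\Big(\frac{1+|\langle w,w\rangle|^2}{2}+\|w\|^2\Big)e_p-w_p\big(\langle\bar w,\bar w\rangle w+\bar w\big),\qquad w=(w_1,\dots,w_p)\in\mathbb{C}^p.$$ Moreover, the immersion is given by $$g=\mathrm{Re}\Big(\int\frac{\langle\bar G_z,F(G)\rangle}{\|F(G)\|^2}(1-\langle G,G\rangle)h\,dz,\ \mathsf{i}\int\frac{\langle\bar G_z,F(G)\rangle}{\|F(G)\|^2}(1+\langle G,G\rangle)h\,dz,\ 2\int\frac{\langle\bar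 G_z,F(G)\rangle}{\|F(G)\|^2}G_1h\,dz,\dots,2\int\frac{\langle\bar G_z,F(G)\rangle}{\|F(G)\|^2}G_{p-1}h\,dz,\ (n-2)h\Big),\qquad(3)$$ where $$h=\frac{1}{n-2}\Big(\frac n2\Big)^{\frac2n}\exp\Big(\frac{2}{n-2}\mathrm{Re}\int\frac{\langle\bar G_z,F(G)\rangle}{\|F(G)\|^2}G_p\,dz\Big).$$ Conversely, consider a non-holomorphic map $G=(G_1,\dots,G_p)\colon U\to\mathbb{C}^p$ such that $G_p\neq0$ and $F(G)\neq0$ on a simply connected open subset $U\subset\mathbb{C}$, that satisfies (1) and (2). Then the surface $g\colon L^2\to\mathbb{R}^{p+2}$, $p\ge1$, parametrized by (3) is an $(n-2)$-singular minimal surface with density vector $e=(0,\dots,0,1)$.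
   Context: **$a$-singular minimal surface.** Let $e\in\mathbb{R}^{p+2}$ be a unit vector and $\mathbb{R}^{p+2}_+=\{x\in\mathbb{R}^{p+2}:\langle x,e\rangle>0\}$. An isometric immersion $g\colon L^2\to\mathbb{R}^{p+2}$ of a two-dimensional Riemannian manifold is an $a$-singular minimal surface ($a\in\mathbb{R}$) with density vector $e$ if $g(L)\subset\mathbb{R}^{p+2}_+$ and its mean curvature vector field $\mathcal{H}_g$ (half the trace of the second fundamental form) satisfies $2\mathcal{H}_g=\frac{a}{\phi}e^\perp$, where $\phi=\langle g,e\rangle$ and $e^\perp$ is the orthogonal projection of $e$ onto the normal bundle of $g$. Here $a=n-2$, where $n\ge3$ is an integer. The immersion is substantial if its codimension cannot be reduced. **Notation.** A complex chart $(U,z)$ has complex coordinate $z=x+\mathsf{i}y$ in which the metric is a positive multiple of $dx^2+dy^2$. Subscripts $z,\bar z$ denote the Wirtinger derivatives $\partial_z=\frac12(\partial_x-\mathsf{i}\partial_y)$ and $\partial_{\bar z}=\frac12(\partial_x+\mathsf{i}\partial_y)$. On $\mathbb{C}^p$, $\langle\cdot,\cdot\rangle$ is the complex bilinear form $\langle z,w\rangle=\sum_iz_iw_i$, and $\|z\|^2=\langle z,\bar z\rangle$. $\bar G_z$ means $(\bar G)_z=\overline{G_{\bar z}}$. The coordinates of $g$ are taken with respect to an orthonormal basis of $\mathbb{R}^{p+2}$ whose last vector is $e$. Integrals are indefinite integrals.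
   Formalization: G is given on the points of U where d<g,e> is nonzero, e is not tangent and <g_z,b1-i b2> is nonzero (b1,b2 first basis vectors); elsewhere no such G exists. Conversely g is singular minimal where G_zbar is nonzero, as g_z=0 elsewhere. Re of the integral of psi dz means a real u with u_z=psi. *)

theory Defs
  imports "HOL-Analysis.Analysis"
begin

section \<open>Smooth maps and oriented surfaces\<close>

text \<open>\<open>Ck_on k S f\<close>: on the open set \<open>S\<close> of a finite-dimensional space, \<open>f\<close> is of class \<open>C\<^sup>k\<close>.\<close>

primrec Ck_on :: "nat \<Rightarrow> 'a::real_normed_vector set \<Rightarrow> ('a \<Rightarrow> 'b::real_normed_vector) \<Rightarrow> bool" where
  "Ck_on 0 S f \<longleftrightarrow> continuous_on S f"
| "Ck_on (Suc k) S f \<longleftrightarrow> (\<forall>x\<in>S. f differentiable (at x)) \<and>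
     (\<forall>v. Ck_on k S (\<lambda>x. frechet_derivative f (at x) v))"

definition smooth_on :: "'a::real_normed_vector set \<Rightarrow> ('a \<Rightarrow> 'b::real_normed_vector) \<Rightarrow> bool" where
  "smooth_on S f \<longleftrightarrow> (\<forall>k. Ck_on k S f)"

text \<open>A chart \<open>(U, x)\<close> takes values in \<open>\<complex> = \<real>\<^sup>2\<close>; only the values of \<open>x\<close> on \<open>U\<close> matter.\<close>

type_synonym 'a chart = "'a set \<times> ('a \<Rightarrow> complex)"

definition is_chart :: "'a::topological_space chart \<Rightarrow> bool" where
  "is_chart = (\<lambda>(U, x). open U \<and> open (x ` U) \<and> homeomorphism U (x ` U) x (inv_into U x))"

text \<open>The determinant of a real-linear map \<open>D\<close> of \<open>\<complex> = \<real>\<^sup>2\<close> is \<open>Im (cnj (D 1) * D \<i>)\<close>.\<close>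

definition oriented_compatible :: "'a::topological_space chart \<Rightarrow> 'a chart \<Rightarrow> bool" where
  "oriented_compatible = (\<lambda>(U, x) (V, y).
     let \<tau> = y \<circ> inv_into U x in
       smooth_on (x ` (U \<inter> V)) \<tau> \<and>
       (\<forall>w\<in>x ` (U \<inter> V).
          Im (cnj (frechet_derivative \<tau> (at w) 1) * frechet_derivative \<tau> (at w) \<i>) > 0))"

text \<open>An oriented smooth surface, whose points are all elements of the type \<open>'a\<close>, is given by
  its maximal oriented atlas.\<close>

definition oriented_surface ::
    "'a::{t2_space,second_countable_topology} chart set \<Rightarrow> bool" where
  "oriented_surface A \<longleftrightarrow>
     (\<forall>c\<in>A. is_chart c) \<and> (\<Union>c\<in>A. fst c) = UNIV \<and>
     (\<forall>c\<in>A. \<forall>d\<in>A. oriented_compatible c d) \<and>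
     (\<forall>c. is_chart c \<and> (\<forall>d\<in>A. oriented_compatible c d \<and> oriented_compatible d c) \<longrightarrow> c \<in> A)"

section \<open>Singular minimal surfaces\<close>

text \<open>In what follows \<open>f\<close> is a surface in the Euclidean space \<open>'e\<close> expressed in a chart,
  i.e. parametrized by a subset of \<open>\<complex> = \<real>\<^sup>2\<close>, with \<open>\<partial>\<^sub>x\<close> and \<open>\<partial>\<^sub>y\<close> the derivatives in the directions
  \<open>1\<close> and \<open>\<i>\<close>. Its metric is the induced one, so that \<open>f\<close> is an isometric immersion.\<close>

definition dir_deriv :: "complex \<Rightarrow> (complex \<Rightarrow> 'b::real_normed_vector) \<Rightarrow> complex \<Rightarrow> 'b" where
  "dir_deriv v f w = frechet_derivative f (at w) v"

definition immersion_on :: "complex set \<Rightarrow> (complex \<Rightarrow> 'e::euclidean_space) \<Rightarrow> bool" where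
  "immersion_on \<Omega> f \<longleftrightarrow> smooth_on \<Omega> f \<and> (\<forall>w\<in>\<Omega>. inj (frechet_derivative f (at w)))"

definition tangent_plane :: "(complex \<Rightarrow> 'e::euclidean_space) \<Rightarrow> complex \<Rightarrow> 'e set" where
  "tangent_plane f w = range (frechet_derivative f (at w))"

definition normal_part :: "(complex \<Rightarrow> 'e::euclidean_space) \<Rightarrow> complex \<Rightarrow> 'e \<Rightarrow> 'e" where
  "normal_part f w v =
     (THE \<nu>. v - \<nu> \<in> tangent_plane f w \<and> (\<forall>t\<in>tangent_plane f w. \<nu> \<bullet> t = 0))"

definition first_form ::
    "(complex \<Rightarrow> 'e::euclidean_space) \<Rightarrow> complex \<Rightarrow> complex \<Rightarrow> complex \<Rightarrow> real" where
  "first_form f w u v = dir_deriv u f w \<bullet> dir_deriv v f w"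

definition second_form ::
    "(complex \<Rightarrow> 'e::euclidean_space) \<Rightarrow> complex \<Rightarrow> complex \<Rightarrow> complex \<Rightarrow> 'e" where
  "second_form f w u v = normal_part f w (dir_deriv u (dir_deriv v f) w)"

text \<open>Half the trace of the second fundamental form with respect to the first one.\<close>

definition mean_curvature :: "(complex \<Rightarrow> 'e::euclidean_space) \<Rightarrow> complex \<Rightarrow> 'e" where
  "mean_curvature f w =
     (let g11 = first_form f w 1 1; g12 = first_form f w 1 \<i>; g22 = first_form f w \<i> \<i> in
       (1 / (2 * (g11 * g22 - g12\<^sup>2))) *\<^sub>R
         (g22 *\<^sub>R second_form f w 1 1 - (2 * g12) *\<^sub>R second_form f w 1 \<i>
          + g11 *\<^sub>R second_form f w \<i> \<i>))"

definition singular_minimal_on ::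
    "real \<Rightarrow> 'e::euclidean_space \<Rightarrow> complex set \<Rightarrow> (complex \<Rightarrow> 'e) \<Rightarrow> bool" where
  "singular_minimal_on a e \<Omega> f \<longleftrightarrow> immersion_on \<Omega> f \<and>
     (\<forall>w\<in>\<Omega>. f w \<bullet> e > 0 \<and>
       2 *\<^sub>R mean_curvature f w = (a / (f w \<bullet> e)) *\<^sub>R normal_part f w e)"

definition in_chart :: "('a \<Rightarrow> 'e) \<Rightarrow> 'a chart \<Rightarrow> complex \<Rightarrow> 'e" where
  "in_chart g c = g \<circ> inv_into (fst c) (snd c)"

definition singular_minimal_surface ::
    "real \<Rightarrow> 'e::euclidean_space \<Rightarrow> 'a chart set \<Rightarrow> ('a \<Rightarrow> 'e) \<Rightarrow> bool" where
  "singular_minimal_surface a e A g \<longleftrightarrow>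
     (\<forall>c\<in>A. singular_minimal_on a e (snd c ` fst c) (in_chart g c))"

text \<open>The codimension cannot be reduced: the image lies in no proper affine subspace.\<close>

definition substantial :: "('a \<Rightarrow> 'e::euclidean_space) \<Rightarrow> bool" where
  "substantial g \<longleftrightarrow> affine hull (range g) = UNIV"

text \<open>Complex charts: the metric induced by \<open>g\<close> is a positive multiple of \<open>dx\<^sup>2 + dy\<^sup>2\<close>.\<close>

definition complex_chart ::
    "'a::topological_space chart set \<Rightarrow> ('a \<Rightarrow> 'e::euclidean_space) \<Rightarrow> 'a chart \<Rightarrow> bool" where
  "complex_chart A g c \<longleftrightarrow> c \<in> A \<and>
     (\<forall>w\<in>snd c ` fst c. \<exists>\<rho>>0.
        first_form (in_chart g c) w 1 1 = \<rho> \<and> first_form (in_chart g c) w \<i> \<i> = \<rho> \<and>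
        first_form (in_chart g c) w 1 \<i> = 0)"

section \<open>Wirtinger calculus and the map F\<close>

definition d_z :: "(complex \<Rightarrow> complex) \<Rightarrow> complex \<Rightarrow> complex" where
  "d_z f w = (dir_deriv 1 f w - \<i> * dir_deriv \<i> f w) / 2"

definition d_zbar :: "(complex \<Rightarrow> complex) \<Rightarrow> complex \<Rightarrow> complex" where
  "d_zbar f w = (dir_deriv 1 f w + \<i> * dir_deriv \<i> f w) / 2"

definition D_z :: "(complex \<Rightarrow> complex^'p) \<Rightarrow> complex \<Rightarrow> complex^'p" where
  "D_z G w = (\<chi> i. d_z (\<lambda>u. G u $ i) w)"

definition D_zbar :: "(complex \<Rightarrow> complex^'p) \<Rightarrow> complex \<Rightarrow> complex^'p" where
  "D_zbar G w = (\<chi> i. d_zbar (\<lambda>u. G u $ i) w)"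

definition bil :: "complex^'p \<Rightarrow> complex^'p \<Rightarrow> complex" where
  "bil v w = (\<Sum>i\<in>UNIV. v $ i * w $ i)"

definition cnj_vec :: "complex^'p \<Rightarrow> complex^'p" where
  "cnj_vec v = (\<chi> i. cnj (v $ i))"

definition wedge_zero :: "complex^'p \<Rightarrow> complex^'p \<Rightarrow> bool" where
  "wedge_zero v w \<longleftrightarrow> (\<forall>i j. v $ i * w $ j - v $ j * w $ i = 0)"

text \<open>The components of \<open>\<complex>\<^sup>p\<close> are indexed by the finite type \<open>'p\<close>, \<open>p = CARD('p) \<ge> 1\<close>; the index
  called \<open>k\<close> throughout plays the role of the last one, so that \<open>axis k 1\<close> is \<open>e\<^sub>p\<close>.\<close>

definition F_map :: "'p::finite \<Rightarrow> complex^'p \<Rightarrow> complex^'p" where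
  "F_map k w =
     of_real ((1 + (cmod (bil w w))\<^sup>2) / 2 + (norm w)\<^sup>2) *s axis k 1
     - (w $ k) *s (bil (cnj_vec w) (cnj_vec w) *s w + cnj_vec w)"

definition eq1 :: "nat \<Rightarrow> 'p::finite \<Rightarrow> (complex \<Rightarrow> complex^'p) \<Rightarrow> complex \<Rightarrow> bool" where
  "eq1 n k G w \<longleftrightarrow>
     (let V = D_zbar G w; F = F_map k (G w);
          r = complex_of_real ((norm V)\<^sup>2 / (norm F)\<^sup>2) in
       D_z (D_zbar G) w =
         (- (of_nat n / (of_nat n - 2)) * r * (G w $ k)) *s F
         + (r * bil (G w) (G w) * cnj (G w $ k)) *s F
         + (bil V (cnj_vec F) / of_real ((norm F)\<^sup>2)) *s D_z (\<lambda>u. F_map k (G u)) w)"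

definition eq2 :: "'p::finite \<Rightarrow> (complex \<Rightarrow> complex^'p) \<Rightarrow> complex \<Rightarrow> bool" where
  "eq2 k G w \<longleftrightarrow> wedge_zero (D_zbar G w) (F_map k (G w))"

definition solution_on ::
    "nat \<Rightarrow> 'p::finite \<Rightarrow> complex set \<Rightarrow> (complex \<Rightarrow> complex^'p) \<Rightarrow> bool" where
  "solution_on n k \<Omega> G \<longleftrightarrow> smooth_on \<Omega> G \<and>
     (\<forall>w\<in>\<Omega>. G w $ k \<noteq> 0 \<and> F_map k (G w) \<noteq> 0 \<and> eq1 n k G w \<and> eq2 k G w)"

section \<open>The representation formula\<close>

definition orthonormal_basis ::
    "'e::euclidean_space \<Rightarrow> 'e \<Rightarrow> ('p::finite \<Rightarrow> 'e) \<Rightarrow> bool" where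
  "orthonormal_basis b1 b2 b \<longleftrightarrow> DIM('e) = CARD('p) + 2 \<and>
     norm b1 = 1 \<and> norm b2 = 1 \<and> b1 \<bullet> b2 = 0 \<and>
     (\<forall>i. b1 \<bullet> b i = 0 \<and> b2 \<bullet> b i = 0) \<and>
     (\<forall>i j. b i \<bullet> b j = (if i = j then 1 else 0))"

text \<open>\<open>u = Re \<integral> \<psi> dz\<close>. As \<open>\<psi>\<close> is in general not holomorphic, the indefinite integral is the one with
  respect to \<open>\<partial>\<^sub>z\<close>: a real function \<open>u\<close> with \<open>u\<^sub>z = \<psi>\<close>, equivalently \<open>du = 2 Re (\<psi> dz)\<close>. With
  \<open>\<partial>\<^sub>z = (\<partial>\<^sub>x - \<i> \<partial>\<^sub>y) / 2\<close> this normalization is forced: reading \<open>Re \<integral> \<psi> dz\<close> as the real part of a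
  line integral (\<open>u\<^sub>z = \<psi> / 2\<close>) makes the representation formula below wrong, as one sees
  on the cylinders over the one-dimensional solutions.\<close>

definition Re_integral :: "complex set \<Rightarrow> (complex \<Rightarrow> complex) \<Rightarrow> (complex \<Rightarrow> real) \<Rightarrow> bool" where
  "Re_integral \<Omega> \<psi> u \<longleftrightarrow>
     (\<forall>w\<in>\<Omega>. u differentiable (at w) \<and> d_z (\<lambda>v. complex_of_real (u v)) w = \<psi> w)"

definition weight :: "'p::finite \<Rightarrow> (complex \<Rightarrow> complex^'p) \<Rightarrow> complex \<Rightarrow> complex" where
  "weight k G w =
     bil (D_z (\<lambda>u. cnj_vec (G u)) w) (F_map k (G w)) / of_real ((norm (F_map k (G w)))\<^sup>2)"

definition represented_on ::
    "nat \<Rightarrow> 'p::finite \<Rightarrow> 'e::euclidean_space \<Rightarrow> 'e \<Rightarrow> ('p \<Rightarrow> 'e) \<Rightarrow>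
     complex set \<Rightarrow> (complex \<Rightarrow> complex^'p) \<Rightarrow> (complex \<Rightarrow> 'e) \<Rightarrow> bool" where
  "represented_on n k b1 b2 b \<Omega> G f \<longleftrightarrow>
     (\<exists>q h. Re_integral \<Omega> (\<lambda>w. weight k G w * (G w $ k)) q \<and>
       h = (\<lambda>w. 1 / (real n - 2) * (real n / 2) powr (2 / real n)
                 * exp (2 / (real n - 2) * q w)) \<and>
       Re_integral \<Omega> (\<lambda>w. weight k G w * (1 - bil (G w) (G w)) * of_real (h w))
         (\<lambda>w. f w \<bullet> b1) \<and>
       Re_integral \<Omega> (\<lambda>w. \<i> * (weight k G w * (1 + bil (G w) (G w)) * of_real (h w)))
         (\<lambda>w. f w \<bullet> b2) \<and>
       (\<forall>i. i \<noteq> k \<longrightarrow>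
         Re_integral \<Omega> (\<lambda>w. 2 * (weight k G w * (G w $ i) * of_real (h w)))
           (\<lambda>w. f w \<bullet> b i)) \<and>
       (\<forall>w\<in>\<Omega>. f w \<bullet> b k = (real n - 2) * h w))"

text \<open>For a surface \<open>f\<close> given by the formula, \<open>f\<^sub>z\<close> is a nonzero multiple of
  \<open>(1 - \<langle>G,G\<rangle>, \<i> (1 + \<langle>G,G\<rangle>), 2 G)\<close>, so that \<open>f\<close> determines \<open>G\<close>. At a given point, the three
  conditions below say, respectively, that the value of \<open>G\<close> so determined is finite, that
  \<open>G\<^sub>p \<noteq> 0\<close>, and that \<open>F(G) \<noteq> 0\<close>. They are thus necessary for the representation.\<close>

definition regular_points ::
    "'e::euclidean_space \<Rightarrow> 'e \<Rightarrow> 'e \<Rightarrow> complex set \<Rightarrow> (complex \<Rightarrow> 'e) \<Rightarrow> complex set" where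
  "regular_points b1 b2 e \<Omega> f =
     {w \<in> \<Omega>. d_z (\<lambda>v. of_real (f v \<bullet> b1)) w - \<i> * d_z (\<lambda>v. of_real (f v \<bullet> b2)) w \<noteq> 0 \<and>
              d_z (\<lambda>v. of_real (f v \<bullet> e)) w \<noteq> 0 \<and> normal_part f w e \<noteq> 0}"

end

theory Submission
  imports Defs "HOL-Complex_Analysis.Riemann_Mapping"
begin

text \<open>
  Let \<open>\<partial>\<close> denote the Wirtinger derivative with respect to the conjugate variable.
  In a conformal chart \<open>f\<close>, write the null vector as \<open>f\<^sub>z = m (1 - Q, \<i> (1 + Q), 2 G)\<close> with
  \<open>Q = \<langle>G, G\<rangle>\<close>, and let \<open>\<phi> = \<langle>f, e\<rangle> = (n - 2) h\<close>. The singular minimal surface equation is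
  \<open>\<partial> f\<^sub>z = (1 / 2h) (|f\<^sub>z|\<^sup>2 e - \<phi>\<^sub>z conj f\<^sub>z - conj \<phi>\<^sub>z f\<^sub>z)\<close>, and in terms of \<open>G\<close> and \<open>m\<close> it says exactly
  \<open>m \<partial> G = (|m|\<^sup>2 / h) F(G)\<close> and \<open>\<partial> m = (|m|\<^sup>2 / h) (G\<^sub>p conj Q - conj G\<^sub>p)\<close>. So \<open>\<omega> = m / h\<close> is the
  weight of the representation formula and \<open>\<partial> G = conj \<omega> F(G)\<close>, which is (2). Since
  \<open>h\<^sub>z = 2 \<omega> G\<^sub>p h / (n - 2)\<close>, the equation for \<open>m\<close> becomes
  \<open>\<partial> \<omega> = |\<omega>|\<^sup>2 (G\<^sub>p conj Q - n / (n - 2) conj G\<^sub>p)\<close>, which is (1) after differentiating (2).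
  Conversely the derivatives \<open>\<partial>\<close> of all integrands are real, so that the integrals exist by the Poincare
  lemma, which the Riemann mapping theorem reduces to convex domains.
\<close>

section \<open>Calculus of smooth maps\<close>

text \<open>The domains are dictated by degeneracies. From the surface to \<open>G\<close>, the
  factor \<open>m\<close> may vanish (then \<open>G\<close> is infinite),
  \<open>\<phi>\<^sub>z\<close> may vanish (then \<open>G\<^sub>p = 0\<close>), or \<open>e\<close>
  may be tangent (which \<open>F(G) = 0\<close> forces when \<open>G\<^sub>p\<close> is nonzero).
  Removing these points leaves \<open>regular_points\<close>, which is dense as soon as no open
  piece of the surface lies in a hyperplane. From \<open>G\<close> to the surface,
  \<open>|f\<^sub>z|^2\<close> is a positive multiple of \<open>|m|^2\<close> with
  \<open>m = \<omega> h\<close>, so \<open>f\<close> is an immersion exactly where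
  \<open>\<omega>\<close> is nonzero, that is, where \<open>G\<close> is not holomorphic to first
  order. Reality of the conjugate derivatives matters because the 1-form
  \<open>2 Re (\<psi> dz)\<close> is closed exactly when the conjugate derivative of
  \<open>\<psi>\<close> is real. The identity \<open>2 <G, F(G)> = G\<^sub>p (1 - |Q|^2)\<close>
  makes the equations for \<open>G\<close> and \<open>m\<close> imply those for the first two
  coordinates as well. The coefficient \<open>n / (n - 2)\<close> is \<open>1 + 2 / (n - 2)\<close>,
  where \<open>2 / (n - 2)\<close> is the contribution of the logarithmic derivative of
  \<open>h\<close>. The constant in front of the exponential is absorbed by the additive freedom in
  the exponent.\<close>

lemma frechet_derivative_eq:
  "(f has_derivative D) (at x) \<Longrightarrow> frechet_derivative f (at x) = D"
  using frechet_derivative_at by metis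

lemma frechet_derivative_cong_open:
  assumes "open S" "x \<in> S" "\<And>y. y \<in> S \<Longrightarrow> f y = g y"
  shows "frechet_derivative f (at x) = frechet_derivative g (at x)"
proof -
  have "(f has_derivative D) (at x) \<longleftrightarrow> (g has_derivative D) (at x)" for D
    using has_derivative_transform_within_open[of _ D x UNIV S] assms by metis
  then show ?thesis unfolding frechet_derivative_def by simp
qed

lemma differentiable_cong_open:
  assumes "open S" "x \<in> S" "\<And>y. y \<in> S \<Longrightarrow> f y = g y"
  shows "f differentiable (at x) \<longleftrightarrow> g differentiable (at x)"
proof -
  have "(f has_derivative D) (at x) \<longleftrightarrow> (g has_derivative D) (at x)" for D
    using has_derivative_transform_within_open[of _ D x UNIV S] assms by metis
  then show ?thesis unfolding differentiable_def by simp
qed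

lemma Ck_on_cong:
  assumes "open S" "\<And>y. y \<in> S \<Longrightarrow> f y = g y"
  shows "Ck_on k S f \<longleftrightarrow> Ck_on k S g"
  using assms(2)
proof (induction k arbitrary: f g)
  case 0
  then show ?case by (simp cong: continuous_on_cong)
next
  case (Suc k)
  have "Ck_on k S (\<lambda>x. frechet_derivative f (at x) v) = Ck_on k S (\<lambda>x. frechet_derivative g (at x) v)" for v
    by (rule Suc.IH) (use frechet_derivative_cong_open[OF assms(1)] Suc.prems in metis)
  moreover have "f differentiable (at x) \<longleftrightarrow> g differentiable (at x)" if "x \<in> S" for x
    using differentiable_cong_open[OF assms(1) that] Suc.prems by metis
  ultimately show ?case by simp
qed

lemma Ck_on_SucD: "Ck_on (Suc k) S f \<Longrightarrow> Ck_on k S f"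
proof (induction k arbitrary: f)
  case 0
  then show ?case
    by (auto simp: continuous_on_eq_continuous_within
        intro!: differentiable_imp_continuous_within intro: differentiable_at_withinI)
qed auto

lemma Ck_on_const: "Ck_on k S (\<lambda>x. c)"
  by (induction k arbitrary: c) simp_all

lemma Ck_on_linear:
  assumes "bounded_linear L" "open S" "Ck_on k S f"
  shows "Ck_on k S (\<lambda>x. L (f x))"
  using assms(3)
proof (induction k arbitrary: f)
  case 0
  then show ?case using bounded_linear.continuous_on[OF assms(1)] by simp
next
  case (Suc k)
  have d: "((\<lambda>x. L (f x)) has_derivative (\<lambda>v. L (frechet_derivative f (at x) v))) (at x)" if "x \<in> S" for x
    using bounded_linear.has_derivative[OF assms(1)] Suc.prems that frechet_derivative_works
    by (metis Ck_on.simps(2))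
  have "Ck_on k S (\<lambda>x. frechet_derivative (\<lambda>x. L (f x)) (at x) v)" for v
    using Suc.IH[of "\<lambda>x. frechet_derivative f (at x) v"] Suc.prems
    by (subst Ck_on_cong[OF assms(2), where g="\<lambda>x. L (frechet_derivative f (at x) v)"])
      (auto simp: frechet_derivative_eq[OF d])
  then show ?case using d by (auto simp: differentiable_def)
qed

lemma Ck_on_add:
  assumes "open S" "Ck_on k S f" "Ck_on k S g"
  shows "Ck_on k S (\<lambda>x. f x + g x)"
  using assms(2,3)
proof (induction k arbitrary: f g)
  case 0
  then show ?case by (simp add: continuous_on_add)
next
  case (Suc k)
  have d: "((\<lambda>x. f x + g x) has_derivative
      (\<lambda>v. frechet_derivative f (at x) v + frechet_derivative g (at x) v)) (at x)" if "x \<in> S" for x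
    using Suc.prems that
    by (intro has_derivative_add) (simp_all add: frechet_derivative_works[symmetric])
  have "Ck_on k S (\<lambda>x. frechet_derivative (\<lambda>x. f x + g x) (at x) v)" for v
    using Suc.IH[of "\<lambda>x. frechet_derivative f (at x) v" "\<lambda>x. frechet_derivative g (at x) v"] Suc.prems
    by (subst Ck_on_cong[OF assms(1),
          where g="\<lambda>x. frechet_derivative f (at x) v + frechet_derivative g (at x) v"])
      (auto simp: frechet_derivative_eq[OF d])
  then show ?case using d by (auto simp: differentiable_def)
qed

text \<open>By the Leibniz rule the derivative is a sum of two products of the same kind, so the
  induction runs over all pairs of factors; \<open>Ck_on_SucD\<close> lowers the class of the factor
  that is not differentiated.\<close>

lemma (in bounded_bilinear) Ck_on:
  assumes "open S" "Ck_on k S f" "Ck_on k S g"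
  shows "Ck_on k S (\<lambda>x. prod (f x) (g x))"
  using assms(2,3)
proof (induction k arbitrary: f g)
  case 0
  then show ?case by (simp add: continuous_on)
next
  case (Suc k)
  let ?f = "\<lambda>v x. frechet_derivative f (at x) v" and ?g = "\<lambda>v x. frechet_derivative g (at x) v"
  have d: "((\<lambda>x. prod (f x) (g x)) has_derivative
      (\<lambda>v. prod (f x) (?g v x) + prod (?f v x) (g x))) (at x)" if "x \<in> S" for x
    using Suc.prems that by (intro FDERIV) (simp_all add: frechet_derivative_works[symmetric])
  have "Ck_on k S (\<lambda>x. frechet_derivative (\<lambda>x. prod (f x) (g x)) (at x) v)" for v
  proof -
    have "Ck_on k S (\<lambda>x. prod (f x) (?g v x) + prod (?f v x) (g x))"
      using Suc.prems by (intro Ck_on_add assms Suc.IH) (auto intro: Ck_on_SucD)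
    then show ?thesis
      by (subst Ck_on_cong[OF assms(1),
            where g="\<lambda>x. prod (f x) (?g v x) + prod (?f v x) (g x)"])
        (auto simp: frechet_derivative_eq[OF d])
  qed
  then show ?case using d by (auto simp: differentiable_def)
qed

text \<open>Here \<open>f\<close> stays fixed in the induction: the derivative of
  \<open>1 / f\<close> is a product of the derivative of \<open>f\<close> with two copies of
  \<open>1 / f\<close>, already known to be of class C^k.\<close>

lemma Ck_on_inverse:
  fixes f :: "'a::real_normed_vector \<Rightarrow> 'b::real_normed_div_algebra"
  assumes "open S" "Ck_on k S f" "\<And>x. x \<in> S \<Longrightarrow> f x \<noteq> 0"
  shows "Ck_on k S (\<lambda>x. inverse (f x))"
  using assms(2)
proof (induction k)
  case 0
  then show ?case using assms(3) by (simp add: continuous_on_inverse)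
next
  case (Suc k)
  let ?f = "\<lambda>v x. frechet_derivative f (at x) v"
  have d: "((\<lambda>x. inverse (f x)) has_derivative
      (\<lambda>v. - (inverse (f x) * ?f v x * inverse (f x)))) (at x)" if "x \<in> S" for x
    using Deriv.has_derivative_inverse[of f, OF assms(3)[OF that]] Suc.prems that frechet_derivative_works
    by (metis Ck_on.simps(2))
  have "Ck_on k S (\<lambda>x. frechet_derivative (\<lambda>x. inverse (f x)) (at x) v)" for v
  proof -
    have "Ck_on k S (\<lambda>x. - (inverse (f x) * ?f v x * inverse (f x)))"
      using Suc Ck_on_SucD[OF Suc.prems]
      by (intro Ck_on_linear[where L=uminus] bounded_bilinear.Ck_on[OF bounded_bilinear_mult]
          bounded_linear_minus bounded_linear_ident assms) auto
    then show ?thesis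
      by (subst Ck_on_cong[OF assms(1), where g="\<lambda>x. - (inverse (f x) * ?f v x * inverse (f x))"])
        (auto simp: frechet_derivative_eq[OF d])
  qed
  then show ?case using d by (auto simp: differentiable_def)
qed

lemma Ck_on_subset: "Ck_on k S f \<Longrightarrow> T \<subseteq> S \<Longrightarrow> Ck_on k T f"
proof (induction k arbitrary: f)
  case 0
  then show ?case using continuous_on_subset[of S f T] by simp
next
  case (Suc k)
  then have "Ck_on k T (\<lambda>x. frechet_derivative f (at x) v)" for v
    by (intro Suc.IH) simp_all
  then show ?case using Suc.prems by auto
qed

section \<open>Closure properties of smooth maps\<close>

lemma smooth_on_subset: "smooth_on S f \<Longrightarrow> T \<subseteq> S \<Longrightarrow> smooth_on T f"
  using Ck_on_subset[of _ S f T] by (simp add: smooth_on_def)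

lemma smooth_on_cong:
  "open S \<Longrightarrow> (\<And>y. y \<in> S \<Longrightarrow> f y = g y) \<Longrightarrow> smooth_on S f \<longleftrightarrow> smooth_on S g"
  using Ck_on_cong[of S f g] by (simp add: smooth_on_def)

lemma smooth_on_const: "smooth_on S (\<lambda>x. c)"
  by (simp add: smooth_on_def Ck_on_const)

lemma smooth_on_linear:
  "bounded_linear L \<Longrightarrow> open S \<Longrightarrow> smooth_on S f \<Longrightarrow> smooth_on S (\<lambda>x. L (f x))"
  by (simp add: smooth_on_def Ck_on_linear)

lemma smooth_on_add:
  "open S \<Longrightarrow> smooth_on S f \<Longrightarrow> smooth_on S g \<Longrightarrow> smooth_on S (\<lambda>x. f x + g x)"
  by (simp add: smooth_on_def Ck_on_add)

lemma smooth_on_minus: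
  "open S \<Longrightarrow> smooth_on S f \<Longrightarrow> smooth_on S (\<lambda>x. - f x)"
  by (rule smooth_on_linear[OF bounded_linear_minus[OF bounded_linear_ident]])

lemma smooth_on_diff:
  "open S \<Longrightarrow> smooth_on S f \<Longrightarrow> smooth_on S g \<Longrightarrow> smooth_on S (\<lambda>x. f x - g x)"
  using smooth_on_add[of S f "\<lambda>x. - g x"] smooth_on_minus[of S g] by simp

lemma smooth_on_sum:
  assumes "open S" "\<And>i. i \<in> I \<Longrightarrow> smooth_on S (f i)"
  shows "smooth_on S (\<lambda>x. \<Sum>i\<in>I. f i x)"
  using assms(2) by (induction I rule: infinite_finite_induct)
    (auto simp: smooth_on_const intro!: smooth_on_add assms(1))

lemma (in bounded_bilinear) smooth_on:
  "open S \<Longrightarrow> smooth_on S f \<Longrightarrow> smooth_on S g \<Longrightarrow> smooth_on S (\<lambda>x. prod (f x) (g x))"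
  by (simp add: smooth_on_def Ck_on)

lemmas smooth_on_mult = bounded_bilinear.smooth_on[OF bounded_bilinear_mult]
lemmas smooth_on_scaleR = bounded_bilinear.smooth_on[OF bounded_bilinear_scaleR]

lemma smooth_on_divide:
  fixes f g :: "'a::real_normed_vector \<Rightarrow> 'b::real_normed_field"
  shows "open S \<Longrightarrow> smooth_on S f \<Longrightarrow> smooth_on S g \<Longrightarrow> (\<And>x. x \<in> S \<Longrightarrow> g x \<noteq> 0) \<Longrightarrow>
    smooth_on S (\<lambda>x. f x / g x)"
  unfolding divide_inverse by (rule smooth_on_mult) (auto simp: smooth_on_def Ck_on_inverse)

lemma smooth_on_cnj: "open S \<Longrightarrow> smooth_on S f \<Longrightarrow> smooth_on S (\<lambda>x. cnj (f x))"
  by (rule smooth_on_linear[OF bounded_linear_cnj])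

lemma smooth_on_of_real: "open S \<Longrightarrow> smooth_on S f \<Longrightarrow> smooth_on S (\<lambda>x. of_real (f x) :: complex)"
  by (rule smooth_on_linear[OF bounded_linear_of_real])

lemma smooth_on_vec_nth:
  fixes f :: "'a::real_normed_vector \<Rightarrow> complex^'p"
  shows "open S \<Longrightarrow> smooth_on S f \<Longrightarrow> smooth_on S (\<lambda>x. f x $ i)"
  by (rule smooth_on_linear[OF bounded_linear_vec_nth])

lemma smooth_on_dir_deriv: "smooth_on S f \<Longrightarrow> smooth_on S (dir_deriv v f)"
proof (unfold smooth_on_def, intro allI)
  fix k
  assume "\<forall>k. Ck_on k S f"
  then have "Ck_on (Suc k) S f" by blast
  then show "Ck_on k S (dir_deriv v f)" by (simp add: dir_deriv_def[abs_def])
qed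

lemma smooth_on_differentiable: "smooth_on S f \<Longrightarrow> w \<in> S \<Longrightarrow> f differentiable (at w)"
  unfolding smooth_on_def by (drule spec[of _ "Suc 0"]) simp

lemma smooth_on_continuous_on: "smooth_on S f \<Longrightarrow> continuous_on S f"
  unfolding smooth_on_def by (drule spec[of _ 0]) simp

lemma smooth_on_vec_lambda:
  assumes S: "open S" and f: "\<And>i. smooth_on S (\<lambda>x. f x i :: complex)"
  shows "smooth_on S (\<lambda>x. (\<chi> i. f x i) :: complex^'p)"
proof -
  have "bounded_linear (\<lambda>c::complex. axis i c :: complex^'p)" for i :: 'p
    by (simp add: linear_linear linearI vec_eq_iff axis_def)
  then have "smooth_on S (\<lambda>x. \<Sum>i\<in>UNIV. (axis i (f x i) :: complex^'p))"
    by (intro smooth_on_sum S smooth_on_linear[OF _ S f])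
  moreover have "(\<Sum>i\<in>UNIV. (axis i (f x i) :: complex^'p)) = (\<chi> i. f x i)" for x
    by (simp add: vec_eq_iff axis_def)
  ultimately show ?thesis by simp
qed

text \<open>A bootstrap principle for maps that solve a differential equation: regularity of
  \<open>f\<close> at level k may be used to obtain that of its derivative at the same level, which
  lifts \<open>f\<close> to the next level. It serves for \<open>h\<close>, whose derivative
  contains \<open>h\<close> itself, and for primitives.\<close>

lemma smooth_onI_dir_deriv:
  assumes "open S" "\<And>x. x \<in> S \<Longrightarrow> (f has_derivative f' x) (at x)"
    "\<And>v k. Ck_on k S f \<Longrightarrow> Ck_on k S (\<lambda>x. f' x v)"
  shows "smooth_on S f"
proof -
  have "Ck_on k S f" for k
  proof (induction k)
    case 0
    show ?case using assms(2)
      by (auto simp: continuous_on_eq_continuous_at[OF assms(1)] intro: has_derivative_continuous)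
  next
    case (Suc k)
    have "Ck_on k S (\<lambda>x. frechet_derivative f (at x) v) = Ck_on k S (\<lambda>x. f' x v)" for v
      by (rule Ck_on_cong[OF assms(1)]) (simp add: frechet_derivative_eq[OF assms(2)])
    then show ?case using assms(2,3) Suc by (auto simp: differentiable_def)
  qed
  then show ?thesis by (simp add: smooth_on_def)
qed

section \<open>Wirtinger derivatives\<close>

text \<open>The identity \<open>df = a dz + b d(conj z)\<close>, carrying both derivatives and
  differentiability at once. The rules below compute the pair \<open>(a, b)\<close> without
  returning to partial derivatives.\<close>

definition has_wirtinger :: "(complex \<Rightarrow> complex) \<Rightarrow> complex \<Rightarrow> complex \<Rightarrow> complex \<Rightarrow> bool" where
  "has_wirtinger f a b w \<longleftrightarrow> (f has_derivative (\<lambda>v. a * v + b * cnj v)) (at w)"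

lemma has_wirtinger_imp:
  assumes "has_wirtinger f a b w"
  shows "d_z f w = a" "d_zbar f w = b" "f differentiable (at w)"
proof -
  have "frechet_derivative f (at w) = (\<lambda>v. a * v + b * cnj v)"
    using assms frechet_derivative_eq unfolding has_wirtinger_def by blast
  then show "d_z f w = a" "d_zbar f w = b"
    unfolding d_z_def d_zbar_def dir_deriv_def by (simp_all add: algebra_simps)
  show "f differentiable (at w)"
    using assms unfolding has_wirtinger_def differentiable_def by blast
qed

lemma linear_complex_eq:
  fixes D :: "complex \<Rightarrow> 'b::real_normed_vector"
  assumes "linear D"
  shows "D v = Re v *\<^sub>R D 1 + Im v *\<^sub>R D \<i>"
proof -
  have "v = Re v *\<^sub>R 1 + Im v *\<^sub>R \<i>"
    by (simp add: complex_eq_iff)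
  then have "D v = D (Re v *\<^sub>R 1 + Im v *\<^sub>R \<i>)"
    by simp
  also have "\<dots> = Re v *\<^sub>R D 1 + Im v *\<^sub>R D \<i>"
    using assms by (simp only: linear_add linear_cmul)
  finally show ?thesis .
qed

lemma has_derivative_dir_deriv:
  assumes "f differentiable (at w)"
  shows "(f has_derivative (\<lambda>v. dir_deriv v f w)) (at w)"
  unfolding dir_deriv_def using assms frechet_derivative_works by blast

lemma dir_deriv_eq:
  assumes "f differentiable (at w)"
  shows "dir_deriv v f w = Re v *\<^sub>R dir_deriv 1 f w + Im v *\<^sub>R dir_deriv \<i> f w"
  using linear_complex_eq[OF has_derivative_linear[OF has_derivative_dir_deriv[OF assms]]] .

lemma has_wirtinger_works:
  assumes "f differentiable (at w)"
  shows "has_wirtinger f (d_z f w) (d_zbar f w) w"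
proof -
  have "dir_deriv v f w = d_z f w * v + d_zbar f w * cnj v" for v
    by (subst dir_deriv_eq[OF assms], cases v)
      (simp add: d_z_def d_zbar_def complex_eq_iff field_simps)
  then show ?thesis
    using has_derivative_dir_deriv[OF assms] by (simp add: has_wirtinger_def)
qed

lemma has_wirtinger_const: "has_wirtinger (\<lambda>_. c) 0 0 w"
  by (simp add: has_wirtinger_def)

lemma has_wirtinger_add:
  "has_wirtinger f a b w \<Longrightarrow> has_wirtinger g c d w \<Longrightarrow>
    has_wirtinger (\<lambda>x. f x + g x) (a + c) (b + d) w"
  unfolding has_wirtinger_def by (auto intro!: derivative_eq_intros simp: algebra_simps)

lemma has_wirtinger_minus:
  "has_wirtinger f a b w \<Longrightarrow> has_wirtinger (\<lambda>x. - f x) (- a) (- b) w"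
  unfolding has_wirtinger_def by (auto intro!: derivative_eq_intros simp: algebra_simps)

lemma has_wirtinger_diff:
  "has_wirtinger f a b w \<Longrightarrow> has_wirtinger g c d w \<Longrightarrow>
    has_wirtinger (\<lambda>x. f x - g x) (a - c) (b - d) w"
  unfolding has_wirtinger_def by (auto intro!: derivative_eq_intros simp: algebra_simps)

lemma has_wirtinger_mult:
  "has_wirtinger f a b w \<Longrightarrow> has_wirtinger g c d w \<Longrightarrow>
    has_wirtinger (\<lambda>x. f x * g x) (a * g w + f w * c) (b * g w + f w * d) w"
  unfolding has_wirtinger_def by (auto intro!: derivative_eq_intros simp: algebra_simps)

lemma has_wirtinger_sum:
  assumes "\<And>i. i \<in> I \<Longrightarrow> has_wirtinger (f i) (a i) (b i) w"
  shows "has_wirtinger (\<lambda>x. \<Sum>i\<in>I. f i x) (\<Sum>i\<in>I. a i) (\<Sum>i\<in>I. b i) w"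
  using assms by (induction I rule: infinite_finite_induct)
    (auto simp: has_wirtinger_const intro!: has_wirtinger_add)

lemma has_wirtinger_cnj:
  assumes "has_wirtinger f a b w"
  shows "has_wirtinger (\<lambda>x. cnj (f x)) (cnj b) (cnj a) w"
  using bounded_linear.has_derivative[OF bounded_linear_cnj, of f] assms
  unfolding has_wirtinger_def by (fastforce simp: algebra_simps)

lemma has_wirtinger_divide:
  assumes "has_wirtinger f a b w" "has_wirtinger g c d w" "g w \<noteq> 0"
  shows "has_wirtinger (\<lambda>x. f x / g x) ((a * g w - f w * c) / (g w)\<^sup>2) ((b * g w - f w * d) / (g w)\<^sup>2) w"
proof -
  have "((\<lambda>x. f x / g x) has_derivative
      (\<lambda>h. ((a * h + b * cnj h) * g w - f w * (c * h + d * cnj h)) / (g w * g w))) (at w)"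
    using has_derivative_divide'[of f _ w UNIV g] assms unfolding has_wirtinger_def by blast
  moreover have "((a * h + b * cnj h) * g w - f w * (c * h + d * cnj h)) / (g w * g w)
      = (a * g w - f w * c) / (g w)\<^sup>2 * h + (b * g w - f w * d) / (g w)\<^sup>2 * cnj h" for h
    using assms(3) by (simp add: field_simps power2_eq_square)
  ultimately show ?thesis by (simp add: has_wirtinger_def)
qed

lemma has_wirtinger_transform:
  "has_wirtinger f a b w \<Longrightarrow> open S \<Longrightarrow> w \<in> S \<Longrightarrow> (\<And>x. x \<in> S \<Longrightarrow> f x = g x) \<Longrightarrow> has_wirtinger g a b w"
  unfolding has_wirtinger_def using has_derivative_transform_within_open[of f _ w UNIV S g] by blast

text \<open>For a real function the two Wirtinger derivatives are conjugate, so
  \<open>du = \<psi> dz + conj (\<psi> dz)\<close>. This is the passage between real differentials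
  and complex calculus used for all coordinate functions.\<close>

lemma has_wirtinger_of_real:
  "(u has_derivative (\<lambda>v. 2 * Re (\<psi> * v))) (at w) \<longleftrightarrow>
    has_wirtinger (\<lambda>x. complex_of_real (u x)) \<psi> (cnj \<psi>) w"
proof
  have e: "complex_of_real (2 * Re (\<psi> * v)) = \<psi> * v + cnj \<psi> * cnj v" for v
    by (simp add: complex_eq_iff)
  show "has_wirtinger (\<lambda>x. complex_of_real (u x)) \<psi> (cnj \<psi>) w"
    if *: "(u has_derivative (\<lambda>v. 2 * Re (\<psi> * v))) (at w)"
  proof -
    have "((\<lambda>x. complex_of_real (u x)) has_derivative (\<lambda>v. complex_of_real (2 * Re (\<psi> * v)))) (at w)"
      by (rule bounded_linear.has_derivative[OF bounded_linear_of_real *])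
    then show ?thesis by (simp only: has_wirtinger_def e)
  qed
  show "(u has_derivative (\<lambda>v. 2 * Re (\<psi> * v))) (at w)"
    if *: "has_wirtinger (\<lambda>x. complex_of_real (u x)) \<psi> (cnj \<psi>) w"
  proof -
    have "((\<lambda>x. Re (complex_of_real (u x))) has_derivative
        (\<lambda>v. Re (complex_of_real (2 * Re (\<psi> * v))))) (at w)"
      using * unfolding has_wirtinger_def e[symmetric]
      by (rule bounded_linear.has_derivative[OF bounded_linear_Re])
    then show ?thesis by (simp only: Re_complex_of_real)
  qed
qed

lemma has_wirtinger_of_real_works:
  fixes u :: "complex \<Rightarrow> real"
  assumes "u differentiable (at w)"
  shows "has_wirtinger (\<lambda>x. complex_of_real (u x))
    (d_z (\<lambda>x. of_real (u x)) w) (cnj (d_z (\<lambda>x. of_real (u x)) w)) w"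
    and "d_z (\<lambda>x. of_real (u x)) w = Complex (dir_deriv 1 u w / 2) (- dir_deriv \<i> u w / 2)"
proof -
  let ?p = "Complex (dir_deriv 1 u w / 2) (- dir_deriv \<i> u w / 2)"
  have *: "(\<lambda>v. dir_deriv v u w) = (\<lambda>v. 2 * Re (?p * v))"
    by (rule ext, subst dir_deriv_eq[OF assms]) simp
  have "(u has_derivative (\<lambda>v. 2 * Re (?p * v))) (at w)"
    by (rule has_derivative_eq_rhs[OF has_derivative_dir_deriv[OF assms] *])
  then have "has_wirtinger (\<lambda>x. complex_of_real (u x)) ?p (cnj ?p) w"
    using has_wirtinger_of_real by blast
  then show "has_wirtinger (\<lambda>x. complex_of_real (u x))
    (d_z (\<lambda>x. of_real (u x)) w) (cnj (d_z (\<lambda>x. of_real (u x)) w)) w"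
    "d_z (\<lambda>x. of_real (u x)) w = ?p"
    using has_wirtinger_imp(1)[of _ ?p] by simp_all
qed

lemma Re_integral_iff:
  "Re_integral \<Omega> \<psi> u \<longleftrightarrow> (\<forall>w\<in>\<Omega>. (u has_derivative (\<lambda>v. 2 * Re (\<psi> w * v))) (at w))"
proof -
  have "u differentiable (at w) \<and> d_z (\<lambda>v. complex_of_real (u v)) w = \<psi> w \<longleftrightarrow>
      (u has_derivative (\<lambda>v. 2 * Re (\<psi> w * v))) (at w)" for w
  proof
    assume "u differentiable (at w) \<and> d_z (\<lambda>v. complex_of_real (u v)) w = \<psi> w"
    then show "(u has_derivative (\<lambda>v. 2 * Re (\<psi> w * v))) (at w)"
      using has_wirtinger_of_real_works(1)[of u w] has_wirtinger_of_real[of u "\<psi> w" w] by simp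
  next
    assume *: "(u has_derivative (\<lambda>v. 2 * Re (\<psi> w * v))) (at w)"
    then have "has_wirtinger (\<lambda>x. complex_of_real (u x)) (\<psi> w) (cnj (\<psi> w)) w"
      using has_wirtinger_of_real[of u "\<psi> w" w] by blast
    then show "u differentiable (at w) \<and> d_z (\<lambda>v. complex_of_real (u v)) w = \<psi> w"
      using has_wirtinger_imp(1) * differentiable_def by blast
  qed
  then show ?thesis by (simp add: Re_integral_def)
qed

lemma smooth_on_d_z: "open S \<Longrightarrow> smooth_on S f \<Longrightarrow> smooth_on S (d_z f)"
  unfolding d_z_def[abs_def]
  by (intro smooth_on_divide smooth_on_diff smooth_on_mult smooth_on_dir_deriv smooth_on_const) auto

lemma smooth_on_d_zbar: "open S \<Longrightarrow> smooth_on S f \<Longrightarrow> smooth_on S (d_zbar f)"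
  unfolding d_zbar_def[abs_def]
  by (intro smooth_on_divide smooth_on_add smooth_on_mult smooth_on_dir_deriv smooth_on_const) auto

text \<open>The mean value theorem is applied along \<open>a\<close> to the difference of
  \<open>u\<close> in direction \<open>b\<close>, and then along \<open>b\<close> to the derivative
  in direction \<open>a\<close>. The left side is symmetric in \<open>a\<close> and
  \<open>b\<close>, from which the symmetry of second derivatives follows.\<close>

lemma second_difference_mean_value:
  fixes u :: "complex \<Rightarrow> real"
  assumes S: "ball w r \<subseteq> S" "smooth_on S u" and s: "0 < s" "2 * s < r"
    and ab: "cmod a = 1" "cmod b = 1"
  shows "\<exists>p\<in>ball w (3 * s). u (w + s *\<^sub>R a + s *\<^sub>R b) - u (w + s *\<^sub>R a) - u (w + s *\<^sub>R b) + u w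
    = s\<^sup>2 * dir_deriv b (dir_deriv a u) p"
proof -
  have dist_add: "dist w (w + z) = cmod z" for z by (simp add: dist_norm)
  have in_ball: "w + x *\<^sub>R a + y *\<^sub>R b \<in> ball w r" if "0 \<le> x" "x \<le> s" "0 \<le> y" "y \<le> s" for x y
  proof -
    have "cmod (x *\<^sub>R a + y *\<^sub>R b) \<le> x + y"
      using norm_triangle_ineq[of "x *\<^sub>R a" "y *\<^sub>R b"] ab that by simp
    then have "dist w (w + (x *\<^sub>R a + y *\<^sub>R b)) < r" using that s unfolding dist_add by linarith
    then show ?thesis by (simp add: add.assoc)
  qed
  have line: "((\<lambda>x. v (c + x *\<^sub>R a)) has_real_derivative dir_deriv a v (c + x *\<^sub>R a)) (at x)"
    if "smooth_on S v" "c + x *\<^sub>R a \<in> S" for v :: "complex \<Rightarrow> real" and a c x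
  proof -
    have d: "(v has_derivative (\<lambda>h. dir_deriv h v (c + x *\<^sub>R a))) (at (c + x *\<^sub>R a))"
      using has_derivative_dir_deriv smooth_on_differentiable that by blast
    have "((\<lambda>x. c + x *\<^sub>R a) has_derivative (\<lambda>t. t *\<^sub>R a)) (at x)"
      by (auto intro!: derivative_eq_intros)
    then have "((\<lambda>x. v (c + x *\<^sub>R a)) has_derivative (\<lambda>t. dir_deriv (t *\<^sub>R a) v (c + x *\<^sub>R a))) (at x)"
      using d by (rule has_derivative_compose[where f="\<lambda>x. c + x *\<^sub>R a"])
    moreover have "(\<lambda>t. dir_deriv (t *\<^sub>R a) v (c + x *\<^sub>R a)) = (*) (dir_deriv a v (c + x *\<^sub>R a))"
    proof
      fix t show "dir_deriv (t *\<^sub>R a) v (c + x *\<^sub>R a) = dir_deriv a v (c + x *\<^sub>R a) * t"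
        using linear_cmul[OF has_derivative_linear[OF d], of t a] by (simp only: real_scaleR_def mult.commute)
    qed
    ultimately show ?thesis unfolding has_field_derivative_def by (rule has_derivative_eq_rhs)
  qed
  let ?g = "\<lambda>x. u (w + s *\<^sub>R b + x *\<^sub>R a) - u (w + x *\<^sub>R a)"
  have "\<exists>\<theta>>0. \<theta> < s \<and> ?g s - ?g 0
      = (s - 0) * (dir_deriv a u (w + s *\<^sub>R b + \<theta> *\<^sub>R a) - dir_deriv a u (w + \<theta> *\<^sub>R a))"
    using S in_ball[where y=s] in_ball[where y=0] s
    by (intro MVT2 DERIV_diff line) (auto simp: subset_eq add_ac)
  then obtain \<theta> where t: "0 < \<theta>" "\<theta> < s" and g: "?g s - ?g 0
      = s * (dir_deriv a u (w + s *\<^sub>R b + \<theta> *\<^sub>R a) - dir_deriv a u (w + \<theta> *\<^sub>R a))"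
    by auto
  let ?k = "\<lambda>y. dir_deriv a u ((w + \<theta> *\<^sub>R a) + y *\<^sub>R b)"
  have "\<exists>\<eta>>0. \<eta> < s \<and> ?k s - ?k 0 = (s - 0) * dir_deriv b (dir_deriv a u) ((w + \<theta> *\<^sub>R a) + \<eta> *\<^sub>R b)"
    using S in_ball[where x=\<theta>] s t
    by (intro MVT2 line smooth_on_dir_deriv) (auto simp: subset_eq)
  then obtain \<eta> where e: "0 < \<eta>" "\<eta> < s"
    and k: "?k s - ?k 0 = s * dir_deriv b (dir_deriv a u) ((w + \<theta> *\<^sub>R a) + \<eta> *\<^sub>R b)"
    by auto
  let ?p = "(w + \<theta> *\<^sub>R a) + \<eta> *\<^sub>R b"
  have "cmod (\<theta> *\<^sub>R a + \<eta> *\<^sub>R b) \<le> \<theta> + \<eta>"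
    using norm_triangle_ineq[of "\<theta> *\<^sub>R a" "\<eta> *\<^sub>R b"] ab t e by simp
  then have "dist w (w + (\<theta> *\<^sub>R a + \<eta> *\<^sub>R b)) < 3 * s" using t e unfolding dist_add by linarith
  then have "?p \<in> ball w (3 * s)" by (simp add: add.assoc)
  moreover have "?g s - ?g 0 = s * (?k s - ?k 0)"
    using g by (simp add: add_ac)
  then have "u (w + s *\<^sub>R a + s *\<^sub>R b) - u (w + s *\<^sub>R a) - u (w + s *\<^sub>R b) + u w
      = s\<^sup>2 * dir_deriv b (dir_deriv a u) ?p"
    using k by (simp add: power2_eq_square add_ac)
  ultimately show ?thesis by blast
qed

lemma dir_deriv_commute:
  fixes u :: "complex \<Rightarrow> real"
  assumes S: "open S" "w \<in> S" "smooth_on S u" and ab: "cmod a = 1" "cmod b = 1"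
  shows "dir_deriv b (dir_deriv a u) w = dir_deriv a (dir_deriv b u) w"
proof (rule ccontr)
  let ?A = "dir_deriv b (dir_deriv a u)" and ?B = "dir_deriv a (dir_deriv b u)"
  assume ne: "?A w \<noteq> ?B w"
  define \<epsilon> where "\<epsilon> = \<bar>?A w - ?B w\<bar> / 2"
  have "0 < \<epsilon>" using ne by (simp add: \<epsilon>_def)
  have "isCont ?A w" "isCont ?B w"
    using S smooth_on_continuous_on smooth_on_dir_deriv continuous_on_eq_continuous_at by metis+
  then obtain d1 d2 where d: "0 < d1" "0 < d2"
    "\<And>p. dist p w < d1 \<Longrightarrow> dist (?A p) (?A w) < \<epsilon>" "\<And>p. dist p w < d2 \<Longrightarrow> dist (?B p) (?B w) < \<epsilon>"
    using \<open>0 < \<epsilon>\<close> unfolding continuous_at_eps_delta by metis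
  obtain r where r: "0 < r" "ball w r \<subseteq> S" using S openE by blast
  \<comment> \<open>\<open>r / 4\<close> keeps the corners of the parallelogram in the ball, since
    \<open>2 * s < r\<close>; the thirds are there because the intermediate points lie only within
    \<open>3 * s\<close> of \<open>w\<close>.\<close>
  define s where "s = min (r / 4) (min (d1 / 3) (d2 / 3))"
  have s: "0 < s" "2 * s < r" "3 * s \<le> d1" "3 * s \<le> d2"
    using d r by (auto simp: s_def)
  obtain p where p: "p \<in> ball w (3 * s)"
    "u (w + s *\<^sub>R a + s *\<^sub>R b) - u (w + s *\<^sub>R a) - u (w + s *\<^sub>R b) + u w = s\<^sup>2 * ?A p"
    using second_difference_mean_value[OF r(2) S(3) s(1,2) ab] by blast
  obtain q where q: "q \<in> ball w (3 * s)"
    "u (w + s *\<^sub>R b + s *\<^sub>R a) - u (w + s *\<^sub>R b) - u (w + s *\<^sub>R a) + u w = s\<^sup>2 * ?B q"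
    using second_difference_mean_value[OF r(2) S(3) s(1,2) ab(2,1)] by blast
  have swap: "w + s *\<^sub>R b + s *\<^sub>R a = w + s *\<^sub>R a + s *\<^sub>R b" by (simp add: add_ac)
  have "s\<^sup>2 * ?A p = s\<^sup>2 * ?B q" using p(2) q(2) unfolding swap by linarith
  then have "?A p = ?B q" using s by simp
  moreover have "dist (?A p) (?A w) < \<epsilon>" "dist (?B q) (?B w) < \<epsilon>"
    using p(1) q(1) s d by (auto simp: dist_commute)
  ultimately show False by (simp add: \<epsilon>_def dist_real_def abs_if split: if_splits)
qed

section \<open>Real primitives on simply connected domains\<close>

text \<open>Poincare lemma by integration along the segments from 0: \<open>u z\<close> is the
  integral over t in [0, 1] of \<open>2 Re (\<psi>(t z) z)\<close>. Differentiating under the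
  integral sign and using closedness, the integrand becomes the t-derivative of
  \<open>2 t \<psi>(t z)\<close>, so that its integral is \<open>2 \<psi>(z)\<close>.\<close>

lemma Re_integral_convex:
  assumes S: "open S" "convex S" "0 \<in> S"
    and \<psi>: "\<And>w. w \<in> S \<Longrightarrow> has_wirtinger \<psi> (a w) (b w) w"
    and cont: "continuous_on S a" "continuous_on S b"
    and real: "\<And>w. w \<in> S \<Longrightarrow> Im (b w) = 0"
  shows "\<exists>u. Re_integral S \<psi> u"
proof -
  have seg: "t *\<^sub>R z \<in> S" if "z \<in> S" "0 \<le> t" "t \<le> 1" for z t
    using S(2,3) that convexD[of S 0 z "1 - t" t] by simp
  have cont\<psi>: "continuous_on S \<psi>"
    using \<psi> S(1) unfolding has_wirtinger_def
    by (auto simp: continuous_on_eq_continuous_at intro: has_derivative_continuous)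
  \<comment> \<open>\<open>c z t\<close> is the derivative of \<open>2 t \<psi>(t z)\<close> in t.
    The conjugates around it below appear because the inner product of \<open>cnj c\<close> and
    \<open>v\<close> is \<open>Re (c * v)\<close>.\<close>
  define c where "c z t = 2 * (t *\<^sub>R (a (t *\<^sub>R z) * z + b (t *\<^sub>R z) * cnj z) + \<psi> (t *\<^sub>R z))" for z and t :: real
  define f where "f z t = 2 * Re (\<psi> (t *\<^sub>R z) * z)" for z and t :: real
  define u where "u z = integral (cbox 0 1) (f z)" for z
  have der_line: "((\<lambda>x. \<psi> (t *\<^sub>R x)) has_derivative
      (\<lambda>v. a (t *\<^sub>R z) * (t *\<^sub>R v) + b (t *\<^sub>R z) * cnj (t *\<^sub>R v))) (at z)"
    if "z \<in> S" "0 \<le> t" "t \<le> 1" for z t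
  proof -
    have "(\<psi> has_derivative (\<lambda>v. a (t *\<^sub>R z) * v + b (t *\<^sub>R z) * cnj v)) (at (t *\<^sub>R z))"
      using \<psi>[OF seg[OF that]] unfolding has_wirtinger_def .
    moreover have "((\<lambda>x. t *\<^sub>R x) has_derivative (\<lambda>v. t *\<^sub>R v)) (at z)"
      by (auto intro!: derivative_eq_intros)
    ultimately show ?thesis
      by (rule has_derivative_compose[where f="\<lambda>x. t *\<^sub>R x", rotated])
  qed
  have fx: "((\<lambda>z. f z t) has_derivative blinfun_apply (blinfun_inner_right (cnj (c z t)))) (at z within S)"
    if "z \<in> S" "t \<in> cbox 0 1" for z t
  proof -
    have t: "0 \<le> t" "t \<le> 1" using that by auto
    have r: "Im (b (t *\<^sub>R z)) = 0" using real seg that t by blast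
    have "((\<lambda>z. f z t) has_derivative (\<lambda>v. 2 * Re (\<psi> (t *\<^sub>R z) * v
        + (a (t *\<^sub>R z) * (t *\<^sub>R v) + b (t *\<^sub>R z) * cnj (t *\<^sub>R v)) * z))) (at z)"
      unfolding f_def
      by (rule has_derivative_mult_right bounded_linear.has_derivative[OF bounded_linear_Re]
          has_derivative_mult der_line[OF that(1) t] has_derivative_ident)+
    \<comment> \<open>Closedness enters here: for real \<open>b\<close> the number
      \<open>Re (b * cnj v * z)\<close> equals \<open>Re (b * cnj z * v)\<close>, which makes the
      expression the real part of a complex multiple of \<open>v\<close>.\<close>
    moreover have "2 * Re (\<psi> (t *\<^sub>R z) * v + (a (t *\<^sub>R z) * (t *\<^sub>R v) + b (t *\<^sub>R z) * cnj (t *\<^sub>R v)) * z)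
        = blinfun_apply (blinfun_inner_right (cnj (c z t))) v" for v
      using r by (simp add: c_def inner_complex_def algebra_simps)
    ultimately show ?thesis by (simp add: has_derivative_at_withinI)
  qed
  have comp: "continuous_on (S \<times> cbox 0 1) (\<lambda>(z, t). k (t *\<^sub>R z))"
    if "continuous_on S k" for k :: "complex \<Rightarrow> complex"
  proof -
    have "continuous_on (S \<times> cbox 0 1) (\<lambda>p. k (snd p *\<^sub>R fst p))"
      by (rule continuous_on_compose2[OF that]) (auto intro!: continuous_intros seg)
    then show ?thesis by (simp add: case_prod_unfold)
  qed
  have cont_c: "continuous_on (S \<times> cbox 0 1) (\<lambda>(z, t). c z t)"
    using comp[OF cont(1)] comp[OF cont(2)] comp[OF cont\<psi>]
    unfolding c_def case_prod_unfold by (intro continuous_intros)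
  have cont_fx: "continuous_on (S \<times> cbox 0 1) (\<lambda>(z, t). blinfun_inner_right (cnj (c z t)))"
    using cont_c unfolding case_prod_unfold
    by (intro bounded_linear.continuous_on[OF bounded_linear_blinfun_inner_right] continuous_intros)
  have integrable: "f z integrable_on cbox 0 1" if "z \<in> S" for z
  proof -
    have "continuous_on (cbox 0 1) (\<lambda>t. \<psi> (t *\<^sub>R z))"
      using that by (intro continuous_on_compose2[OF cont\<psi>]) (auto intro!: continuous_intros seg)
    then show ?thesis unfolding f_def by (intro integrable_continuous continuous_intros)
  qed
  have int: "integral (cbox 0 1) (\<lambda>t. blinfun_inner_right (cnj (c z t))) = blinfun_inner_right (cnj (2 * \<psi> z))"
    if "z \<in> S" for z
  proof -
    let ?\<Phi> = "\<lambda>t. blinfun_inner_right (cnj (2 * (t *\<^sub>R \<psi> (t *\<^sub>R z))))"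
    have "(?\<Phi> has_vector_derivative blinfun_inner_right (cnj (c z t))) (at t within {0..1})"
      if t: "t \<in> {0..1}" for t
    proof -
      have "(\<psi> has_derivative (\<lambda>v. a (t *\<^sub>R z) * v + b (t *\<^sub>R z) * cnj v)) (at (t *\<^sub>R z))"
        using \<psi>[OF seg[OF \<open>z \<in> S\<close>]] t unfolding has_wirtinger_def by simp
      moreover have "((\<lambda>t. t *\<^sub>R z) has_derivative (\<lambda>h. h *\<^sub>R z)) (at t)"
        by (auto intro!: derivative_eq_intros)
      ultimately have "((\<lambda>t. \<psi> (t *\<^sub>R z)) has_derivative
          (\<lambda>h. a (t *\<^sub>R z) * (h *\<^sub>R z) + b (t *\<^sub>R z) * cnj (h *\<^sub>R z))) (at t)"
        by (rule has_derivative_compose[where f="\<lambda>t. t *\<^sub>R z", rotated])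
      moreover have "(\<lambda>h. a (t *\<^sub>R z) * (h *\<^sub>R z) + b (t *\<^sub>R z) * cnj (h *\<^sub>R z))
          = (\<lambda>h. h *\<^sub>R (a (t *\<^sub>R z) * z + b (t *\<^sub>R z) * cnj z))"
        by (simp add: fun_eq_iff algebra_simps scaleR_conv_of_real)
      ultimately have "((\<lambda>t. \<psi> (t *\<^sub>R z)) has_vector_derivative
          (a (t *\<^sub>R z) * z + b (t *\<^sub>R z) * cnj z)) (at t)"
        unfolding has_vector_derivative_def by simp
      then have "((\<lambda>t. t *\<^sub>R \<psi> (t *\<^sub>R z)) has_vector_derivative
          t *\<^sub>R (a (t *\<^sub>R z) * z + b (t *\<^sub>R z) * cnj z) + 1 *\<^sub>R \<psi> (t *\<^sub>R z)) (at t)"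
        by (intro has_vector_derivative_scaleR DERIV_ident)
      then have "((\<lambda>t. blinfun_inner_right (cnj (2 * (t *\<^sub>R \<psi> (t *\<^sub>R z))))) has_vector_derivative
          blinfun_inner_right (cnj (c z t))) (at t)"
        unfolding c_def scaleR_one
        by (rule bounded_linear.has_vector_derivative[OF bounded_linear_blinfun_inner_right
              bounded_linear.has_vector_derivative[OF bounded_linear_cnj
              bounded_linear.has_vector_derivative[OF bounded_linear_mult_right]]])
      then show ?thesis by (rule has_vector_derivative_at_within)
    qed
    then have "((\<lambda>t. blinfun_inner_right (cnj (c z t))) has_integral (?\<Phi> 1 - ?\<Phi> 0)) {0..1}"
      by (intro fundamental_theorem_of_calculus) simp_all
    moreover have "?\<Phi> 0 = 0" by (rule blinfun_eqI) simp
    ultimately show ?thesis by (simp add: integral_unique)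
  qed
  have "(u has_derivative (\<lambda>v. 2 * Re (\<psi> z * v))) (at z)" if "z \<in> S" for z
  proof -
    have "(u has_derivative integral (cbox 0 1) (\<lambda>t. blinfun_inner_right (cnj (c z t)))) (at z within S)"
      unfolding u_def[abs_def]
      by (rule leibniz_rule[OF fx integrable cont_fx that S(2)])
    moreover have "blinfun_apply (blinfun_inner_right (cnj (2 * \<psi> z))) = (\<lambda>v. 2 * Re (\<psi> z * v))"
      by (simp add: fun_eq_iff inner_complex_def algebra_simps)
    ultimately show ?thesis using int[OF that] at_within_open[OF that S(1)] by simp
  qed
  then show ?thesis unfolding Re_integral_iff by blast
qed

lemma has_wirtinger_holomorphic:
  assumes "(f has_field_derivative f') (at w)"
  shows "has_wirtinger f f' 0 w"
  using assms by (simp add: has_wirtinger_def has_field_derivative_def)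

lemma has_wirtinger_compose_holomorphic:
  assumes "has_wirtinger f a b (g w)" "(g has_field_derivative g') (at w)"
  shows "has_wirtinger (\<lambda>x. f (g x)) (a * g') (b * cnj g') w"
proof -
  have "((\<lambda>x. f (g x)) has_derivative (\<lambda>v. a * (g' * v) + b * cnj (g' * v))) (at w)"
    using assms(2)[unfolded has_field_derivative_def] assms(1)[unfolded has_wirtinger_def]
    by (rule has_derivative_compose)
  then show ?thesis by (simp add: has_wirtinger_def mult_ac)
qed

text \<open>The 1-form \<open>2 Re (\<psi> dz)\<close> is pulled back to the disc by the inverse
  Riemann map \<open>g\<close>, where it becomes \<open>2 Re (\<psi>(g) g' dz)\<close>. The
  primitive found there is composed with \<open>f\<close>; the factors \<open>g'\<close> and
  \<open>f'\<close> cancel because \<open>g (f z) = z\<close>. The whole plane is already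
  convex.\<close>

lemma Re_integral_exists:
  assumes U: "open U" "simply_connected U"
    and \<psi>: "smooth_on U \<psi>" and real: "\<And>w. w \<in> U \<Longrightarrow> Im (d_zbar \<psi> w) = 0"
  shows "\<exists>u. Re_integral U \<psi> u"
proof -
  have w: "has_wirtinger \<psi> (d_z \<psi> w) (d_zbar \<psi> w) w" if "w \<in> U" for w
    using has_wirtinger_works smooth_on_differentiable[OF \<psi> that] by blast
  have cont: "continuous_on U \<psi>" "continuous_on U (d_z \<psi>)" "continuous_on U (d_zbar \<psi>)"
    using smooth_on_continuous_on \<psi> smooth_on_d_z[OF U(1) \<psi>] smooth_on_d_zbar[OF U(1) \<psi>] by blast+
  consider "U = {}" | "U = UNIV" | (disc) f g where "f holomorphic_on U" "g holomorphic_on ball 0 1"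
      "\<And>z. z \<in> U \<Longrightarrow> f z \<in> ball 0 1 \<and> g (f z) = z" "\<And>z. z \<in> ball 0 1 \<Longrightarrow> g z \<in> U \<and> f (g z) = z"
    using simply_connected_eq_biholomorphic_to_disc[OF U(1)] U(2) by metis
  then show ?thesis
  proof cases
    case 1
    then show ?thesis by (simp add: Re_integral_def)
  next
    case 2
    then show ?thesis using Re_integral_convex[of U, OF _ _ _ w] cont real by simp
  next
    case disc
    define \<phi> where "\<phi> z = \<psi> (g z) * deriv g z" for z
    have dg: "(g has_field_derivative deriv g z) (at z)" if "z \<in> ball 0 1" for z
      using holomorphic_derivI disc(2) that by blast
    have hol: "deriv g holomorphic_on ball 0 1" "deriv (deriv g) holomorphic_on ball 0 1"
      using disc(2) holomorphic_deriv by blast+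
    have ddg: "(deriv g has_field_derivative deriv (deriv g) z) (at z)" if "z \<in> ball 0 1" for z
      using holomorphic_derivI hol(1) that by blast
    let ?a = "\<lambda>z. (d_z \<psi> (g z) * deriv g z) * deriv g z + \<psi> (g z) * deriv (deriv g) z"
    \<comment> \<open>As \<open>deriv g\<close> is holomorphic, the conjugate derivative is only
      multiplied by the positive number \<open>|g'|^2\<close>, so it remains real.\<close>
    let ?b = "\<lambda>z. (d_zbar \<psi> (g z) * cnj (deriv g z)) * deriv g z + \<psi> (g z) * 0"
    have "has_wirtinger \<phi> (?a z) (?b z) z" if "z \<in> ball 0 1" for z
      unfolding \<phi>_def using disc(4) that
      by (intro has_wirtinger_mult has_wirtinger_compose_holomorphic has_wirtinger_holomorphic w dg ddg) auto
    moreover have g: "continuous_on (ball 0 1) (\<lambda>z. k (g z))" if "continuous_on U k" for k :: "complex \<Rightarrow> complex"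
      using disc(2,4) that
      by (intro continuous_on_compose2[OF that holomorphic_on_imp_continuous_on]) auto
    have "continuous_on (ball 0 1) ?a" "continuous_on (ball 0 1) ?b"
      by (intro continuous_intros g cont holomorphic_on_imp_continuous_on hol)+
    moreover have "Im (?b z) = 0" if "z \<in> ball 0 1" for z
      using real[of "g z"] disc(4)[OF that] by (simp add: algebra_simps)
    ultimately obtain u where u: "Re_integral (ball 0 1) \<phi> u"
      using Re_integral_convex[of "ball 0 1" \<phi> ?a ?b] by auto
    have "((\<lambda>z. u (f z)) has_derivative (\<lambda>v. 2 * Re (\<psi> z * v))) (at z)" if "z \<in> U" for z
    proof -
      have fz: "f z \<in> ball 0 1" "g (f z) = z" using disc(3) that by auto
      have df: "(f has_field_derivative deriv f z) (at z)"
        using holomorphic_derivI disc(1) U(1) that by blast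
      have "((\<lambda>x. g (f x)) has_field_derivative deriv g (f z) * deriv f z) (at z)"
        using DERIV_chain2[OF dg[OF fz(1)] df] .
      moreover have "((\<lambda>x. g (f x)) has_field_derivative 1) (at z)"
        by (rule has_field_derivative_transform_within_open[OF DERIV_ident U(1) that])
          (simp add: disc(3))
      ultimately have 1: "deriv g (f z) * deriv f z = 1" using DERIV_unique by blast
      have "((\<lambda>z. u (f z)) has_derivative (\<lambda>v. 2 * Re (\<phi> (f z) * (deriv f z * v)))) (at z)"
        using df[unfolded has_field_derivative_def] u[unfolded Re_integral_iff, rule_format, OF fz(1)]
        by (rule has_derivative_compose)
      moreover have "\<phi> (f z) * (deriv f z * v) = \<psi> z * v" for v
      proof -
        have "\<phi> (f z) * (deriv f z * v) = \<psi> z * (deriv g (f z) * deriv f z) * v"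
          by (simp add: \<phi>_def fz)
        then show ?thesis by (simp add: 1)
      qed
      ultimately show ?thesis by simp
    qed
    then show ?thesis unfolding Re_integral_iff by blast
  qed
qed

section \<open>Conformal surfaces\<close>

lemma dir_deriv_eqI: "(f has_derivative D) (at w) \<Longrightarrow> dir_deriv v f w = D v"
  unfolding dir_deriv_def by (simp add: frechet_derivative_eq)

lemma dir_deriv_inner:
  fixes f g :: "complex \<Rightarrow> 'e::euclidean_space"
  assumes "f differentiable (at w)" "g differentiable (at w)"
  shows "dir_deriv v (\<lambda>x. f x \<bullet> g x) w = f w \<bullet> dir_deriv v g w + dir_deriv v f w \<bullet> g w"
  using has_derivative_inner[OF has_derivative_dir_deriv[OF assms(1)] has_derivative_dir_deriv[OF assms(2)]]
  by (rule dir_deriv_eqI)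

lemma dir_deriv_inner_left:
  fixes f :: "complex \<Rightarrow> 'e::euclidean_space"
  assumes "f differentiable (at w)"
  shows "dir_deriv v (\<lambda>x. f x \<bullet> a) w = dir_deriv v f w \<bullet> a"
  using has_derivative_inner_left[OF has_derivative_dir_deriv[OF assms]]
  by (rule dir_deriv_eqI)

lemma dir_deriv_cong_open:
  "open S \<Longrightarrow> x \<in> S \<Longrightarrow> (\<And>y. y \<in> S \<Longrightarrow> f y = g y) \<Longrightarrow> dir_deriv v f x = dir_deriv v g x"
  unfolding dir_deriv_def using frechet_derivative_cong_open[of S x f g] by simp

lemma smooth_on_inner_const:
  "open S \<Longrightarrow> smooth_on S f \<Longrightarrow> smooth_on S (\<lambda>x. f x \<bullet> a)"
  by (rule smooth_on_linear[OF bounded_linear_inner_left])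

lemma dir_deriv2_inner_left:
  fixes f :: "complex \<Rightarrow> 'e::euclidean_space"
  assumes "open S" "w \<in> S" "smooth_on S f"
  shows "dir_deriv u (dir_deriv v (\<lambda>x. f x \<bullet> a)) w = dir_deriv u (dir_deriv v f) w \<bullet> a"
proof -
  have "dir_deriv u (dir_deriv v (\<lambda>x. f x \<bullet> a)) w = dir_deriv u (\<lambda>x. dir_deriv v f x \<bullet> a) w"
    using assms by (intro dir_deriv_cong_open dir_deriv_inner_left smooth_on_differentiable)
  also have "\<dots> = dir_deriv u (dir_deriv v f) w \<bullet> a"
    using assms by (intro dir_deriv_inner_left smooth_on_differentiable smooth_on_dir_deriv)
  finally show ?thesis .
qed

lemma dir_deriv_commute_vector:
  fixes f :: "complex \<Rightarrow> 'e::euclidean_space"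
  assumes "open S" "w \<in> S" "smooth_on S f" "cmod a = 1" "cmod b = 1"
  shows "dir_deriv b (dir_deriv a f) w = dir_deriv a (dir_deriv b f) w"
proof (rule vector_eq_rdot[THEN iffD1], rule allI)
  fix c
  show "dir_deriv b (dir_deriv a f) w \<bullet> c = dir_deriv a (dir_deriv b f) w \<bullet> c"
    unfolding dir_deriv2_inner_left[OF assms(1-3), symmetric]
    by (rule dir_deriv_commute[OF assms(1,2) smooth_on_inner_const[OF assms(1,3)] assms(4,5)])
qed

definition laplacian :: "(complex \<Rightarrow> 'e::real_normed_vector) \<Rightarrow> complex \<Rightarrow> 'e" where
  "laplacian f w = dir_deriv 1 (dir_deriv 1 f) w + dir_deriv \<i> (dir_deriv \<i> f) w"

definition conformal_on :: "complex set \<Rightarrow> (complex \<Rightarrow> 'e::euclidean_space) \<Rightarrow> bool" where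
  "conformal_on S f \<longleftrightarrow> (\<forall>w\<in>S. first_form f w 1 1 > 0 \<and>
     first_form f w \<i> \<i> = first_form f w 1 1 \<and> first_form f w 1 \<i> = 0)"

lemma tangent_plane_eq:
  assumes "f differentiable (at w)"
  shows "tangent_plane f w = range (\<lambda>v. Re v *\<^sub>R dir_deriv 1 f w + Im v *\<^sub>R dir_deriv \<i> f w)"
  using dir_deriv_eq[OF assms] unfolding tangent_plane_def dir_deriv_def by metis

text \<open>The coordinate vectors are orthogonal of equal length, so the tangential projection only
  divides by \<open>\<rho>\<close>. For the uniqueness required by \<open>THE\<close>, the
  difference of two candidates is both tangent and normal, hence orthogonal to itself.\<close>

lemma normal_part_conformal:
  fixes f :: "complex \<Rightarrow> 'e::euclidean_space"
  assumes f: "f differentiable (at w)" and c: "conformal_on {w} f"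
  shows "normal_part f w v = v - (1 / first_form f w 1 1) *\<^sub>R
    ((v \<bullet> dir_deriv 1 f w) *\<^sub>R dir_deriv 1 f w + (v \<bullet> dir_deriv \<i> f w) *\<^sub>R dir_deriv \<i> f w)"
    (is "_ = ?n")
proof -
  define X where "X = dir_deriv 1 f w"
  define Y where "Y = dir_deriv \<i> f w"
  define \<rho> where "\<rho> = first_form f w 1 1"
  have \<rho>: "\<rho> > 0" "X \<bullet> X = \<rho>" "Y \<bullet> Y = \<rho>" "X \<bullet> Y = 0" "Y \<bullet> X = 0"
    using c by (auto simp: conformal_on_def first_form_def \<rho>_def X_def Y_def inner_commute)
  have T: "tangent_plane f w = range (\<lambda>v. Re v *\<^sub>R X + Im v *\<^sub>R Y)"
    unfolding X_def Y_def by (rule tangent_plane_eq[OF f])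
  have n: "?n = v - (1 / \<rho>) *\<^sub>R ((v \<bullet> X) *\<^sub>R X + (v \<bullet> Y) *\<^sub>R Y)"
    by (simp add: X_def Y_def \<rho>_def)
  have nX: "?n \<bullet> X = 0" "?n \<bullet> Y = 0"
    unfolding n using \<rho> by (simp_all add: inner_diff_left inner_add_left)
  have tan: "v - ?n \<in> tangent_plane f w"
    unfolding n T
    by (rule range_eqI[where x="Complex ((v \<bullet> X) / \<rho>) ((v \<bullet> Y) / \<rho>)"]) (simp add: scaleR_add_right)
  show ?thesis
    unfolding normal_part_def
  proof (rule the_equality)
    show "v - ?n \<in> tangent_plane f w \<and> (\<forall>t\<in>tangent_plane f w. ?n \<bullet> t = 0)"
      using tan nX unfolding T by (auto simp: inner_add_right)
  next
    fix m
    assume m: "v - m \<in> tangent_plane f w \<and> (\<forall>t\<in>tangent_plane f w. m \<bullet> t = 0)"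
    obtain p q where p: "v - m = Re p *\<^sub>R X + Im p *\<^sub>R Y" and q: "v - ?n = Re q *\<^sub>R X + Im q *\<^sub>R Y"
      using m tan unfolding T by blast
    have "X \<in> tangent_plane f w" "Y \<in> tangent_plane f w"
      unfolding T by (rule range_eqI[where x=1], simp, rule range_eqI[where x=\<i>], simp)
    then have mX: "m \<bullet> X = 0" "m \<bullet> Y = 0" using m by auto
    have d: "m - ?n = (Re q - Re p) *\<^sub>R X + (Im q - Im p) *\<^sub>R Y"
      using p q by (simp add: algebra_simps)
    have "(m - ?n) \<bullet> (m - ?n) = (m - ?n) \<bullet> ((Re q - Re p) *\<^sub>R X + (Im q - Im p) *\<^sub>R Y)"
      by (simp only: d[symmetric])
    also have "\<dots> = 0"
      using mX nX by (simp add: inner_add_right inner_diff_left)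
    finally show "m = ?n" by simp
  qed
qed

text \<open>Differentiate \<open>|X|^2 = |Y|^2\<close> and \<open><X, Y> = 0\<close> along both axes
  and exchange the mixed derivatives: \<open><f_xx, f_x> = <f_xy, f_y> = - <f_yy, f_x>\<close>, and
  likewise for \<open>f_y\<close>.\<close>

lemma conformal_laplacian_normal:
  fixes f :: "complex \<Rightarrow> 'e::euclidean_space"
  assumes S: "open S" "smooth_on S f" and c: "conformal_on S f" and w: "w \<in> S"
  shows "laplacian f w \<bullet> dir_deriv 1 f w = 0" "laplacian f w \<bullet> dir_deriv \<i> f w = 0"
proof -
  let ?X = "dir_deriv 1 f" and ?Y = "dir_deriv \<i> f"
  have sm: "smooth_on S ?X" "smooth_on S ?Y" using smooth_on_dir_deriv S by blast+
  note d = sm[THEN smooth_on_differentiable, OF w]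
  have 1: "?X w \<bullet> dir_deriv v ?X w + dir_deriv v ?X w \<bullet> ?X w
      = ?Y w \<bullet> dir_deriv v ?Y w + dir_deriv v ?Y w \<bullet> ?Y w" for v
    unfolding dir_deriv_inner[OF d(1) d(1), symmetric] dir_deriv_inner[OF d(2) d(2), symmetric]
    using c by (intro dir_deriv_cong_open[OF S(1) w]) (simp add: conformal_on_def first_form_def)
  have 2: "?X w \<bullet> dir_deriv v ?Y w + dir_deriv v ?X w \<bullet> ?Y w = 0" for v
  proof -
    have "dir_deriv v (\<lambda>x. ?X x \<bullet> ?Y x) w = dir_deriv v (\<lambda>x. 0) w"
      using c by (intro dir_deriv_cong_open[OF S(1) w]) (simp add: conformal_on_def first_form_def)
    then show ?thesis unfolding dir_deriv_inner[OF d(1) d(2)]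
      by (simp add: dir_deriv_def)
  qed
  have 3: "dir_deriv \<i> ?X w = dir_deriv 1 ?Y w"
    using dir_deriv_commute_vector[OF S(1) w S(2)] by simp
  show "laplacian f w \<bullet> dir_deriv 1 f w = 0" "laplacian f w \<bullet> dir_deriv \<i> f w = 0"
    using 1[of 1] 1[of \<i>] 2[of 1] 2[of \<i>] 3
    by (simp_all add: laplacian_def inner_add_left inner_add_right inner_commute)
qed

text \<open>In a conformal chart the trace is the sum of the two diagonal values divided by
  \<open>\<rho>\<close>, and the Laplacian needs no projection since it is already normal.\<close>

lemma conformal_mean_curvature:
  fixes f :: "complex \<Rightarrow> 'e::euclidean_space"
  assumes S: "open S" "smooth_on S f" and c: "conformal_on S f" and w: "w \<in> S"
  shows "2 *\<^sub>R mean_curvature f w = (1 / first_form f w 1 1) *\<^sub>R laplacian f w"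
proof -
  define \<rho> where "\<rho> = first_form f w 1 1"
  have \<rho>: "\<rho> > 0" "first_form f w \<i> \<i> = \<rho>" "first_form f w 1 \<i> = 0"
    using c w by (auto simp: conformal_on_def \<rho>_def)
  have cw: "conformal_on {w} f" using c w by (simp add: conformal_on_def)
  note np = normal_part_conformal[OF smooth_on_differentiable[OF S(2) w] cw]
  have "normal_part f w p + normal_part f w q = normal_part f w (p + q)" for p q
    unfolding np by (simp add: inner_add_left algebra_simps)
  then have "second_form f w 1 1 + second_form f w \<i> \<i> = normal_part f w (laplacian f w)"
    by (simp add: second_form_def laplacian_def)
  also have "\<dots> = laplacian f w"
    unfolding np using conformal_laplacian_normal[OF S c w] by simp
  finally have sf: "second_form f w 1 1 + second_form f w \<i> \<i> = laplacian f w" .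
  have "2 *\<^sub>R mean_curvature f w = (2 * (1 / (2 * (\<rho> * \<rho>)) * \<rho>)) *\<^sub>R (second_form f w 1 1 + second_form f w \<i> \<i>)"
    using \<rho> by (simp add: mean_curvature_def Let_def \<rho>_def[symmetric] scaleR_add_right)
  also have "2 * (1 / (2 * (\<rho> * \<rho>)) * \<rho>) = 1 / \<rho>" using \<rho>(1) by simp
  finally show ?thesis by (simp add: sf \<rho>_def)
qed

lemma conformal_imp_immersion:
  fixes f :: "complex \<Rightarrow> 'e::euclidean_space"
  assumes S: "open S" "smooth_on S f" and c: "conformal_on S f"
  shows "immersion_on S f"
proof -
  have "inj (frechet_derivative f (at w))" if w: "w \<in> S" for w
  proof -
    note d = smooth_on_differentiable[OF S(2) w]
    have lin: "linear (frechet_derivative f (at w))"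
      using has_derivative_linear[OF has_derivative_dir_deriv[OF d]] by (simp add: dir_deriv_def)
    have "v = 0" if v: "frechet_derivative f (at w) v = 0" for v
    proof -
      have "Re v *\<^sub>R dir_deriv 1 f w + Im v *\<^sub>R dir_deriv \<i> f w = 0"
        using dir_deriv_eq[OF d, of v] v by (simp add: dir_deriv_def)
      then have "(Re v *\<^sub>R dir_deriv 1 f w + Im v *\<^sub>R dir_deriv \<i> f w) \<bullet> dir_deriv 1 f w = 0"
        "(Re v *\<^sub>R dir_deriv 1 f w + Im v *\<^sub>R dir_deriv \<i> f w) \<bullet> dir_deriv \<i> f w = 0"
        by simp_all
      then show "v = 0"
        using c w by (auto simp: inner_add_left inner_add_right conformal_on_def first_form_def inner_commute complex_eq_iff)
    qed
    then show ?thesis using lin linear_injective_0 by blast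
  qed
  then show ?thesis using S(2) by (simp add: immersion_on_def)
qed

text \<open>Multiplying the curvature equation by the conformal factor clears its denominators and
  leaves a quasilinear system for \<open>f\<close>, which can be read off component by
  component.\<close>

lemma singular_minimal_on_conformal_iff:
  fixes f :: "complex \<Rightarrow> 'e::euclidean_space"
  assumes S: "open S" "smooth_on S f" and c: "conformal_on S f"
  shows "singular_minimal_on a e S f \<longleftrightarrow> (\<forall>w\<in>S. f w \<bullet> e > 0 \<and>
    laplacian f w = (a / (f w \<bullet> e)) *\<^sub>R (first_form f w 1 1 *\<^sub>R e
      - (e \<bullet> dir_deriv 1 f w) *\<^sub>R dir_deriv 1 f w - (e \<bullet> dir_deriv \<i> f w) *\<^sub>R dir_deriv \<i> f w))"
proof -
  have "2 *\<^sub>R mean_curvature f w = (a / (f w \<bullet> e)) *\<^sub>R normal_part f w e \<longleftrightarrow>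
    laplacian f w = (a / (f w \<bullet> e)) *\<^sub>R (first_form f w 1 1 *\<^sub>R e
      - (e \<bullet> dir_deriv 1 f w) *\<^sub>R dir_deriv 1 f w - (e \<bullet> dir_deriv \<i> f w) *\<^sub>R dir_deriv \<i> f w)"
    (is "?l \<longleftrightarrow> ?r")
    if w: "w \<in> S" for w
  proof -
    define \<rho> where "\<rho> = first_form f w 1 1"
    have \<rho>: "\<rho> \<noteq> 0" using c w by (auto simp: conformal_on_def \<rho>_def)
    have cw: "conformal_on {w} f" using c w by (simp add: conformal_on_def)
    let ?N = "\<rho> *\<^sub>R e - (e \<bullet> dir_deriv 1 f w) *\<^sub>R dir_deriv 1 f w - (e \<bullet> dir_deriv \<i> f w) *\<^sub>R dir_deriv \<i> f w"
    have n: "normal_part f w e = (1 / \<rho>) *\<^sub>R ?N"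
      using \<rho> unfolding normal_part_conformal[OF smooth_on_differentiable[OF S(2) w] cw] \<rho>_def
      by (simp add: algebra_simps)
    have "?l \<longleftrightarrow> (1 / \<rho>) *\<^sub>R laplacian f w = (1 / \<rho>) *\<^sub>R ((a / (f w \<bullet> e)) *\<^sub>R ?N)"
      unfolding conformal_mean_curvature[OF S c w] n \<rho>_def[symmetric] by (simp add: mult.commute)
    also have "\<dots> \<longleftrightarrow> ?r"
      using \<rho> by (simp only: scaleR_cancel_left) (simp add: \<rho>_def)
    finally show ?thesis .
  qed
  then show ?thesis
    unfolding singular_minimal_on_def using conformal_imp_immersion[OF assms] by auto
qed

text \<open>The p + 2 vectors are orthogonal and nonzero, hence independent, and span by dimension
  count. The remainder of \<open>x\<close> after subtracting its expansion is orthogonal to a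
  spanning set, hence to itself.\<close>

lemma orthonormal_basis_parseval:
  fixes x y :: "'e::euclidean_space" and b :: "'p::finite \<Rightarrow> 'e"
  assumes "orthonormal_basis b1 b2 b"
  shows "x \<bullet> y = (x \<bullet> b1) * (y \<bullet> b1) + (x \<bullet> b2) * (y \<bullet> b2) + (\<Sum>i\<in>UNIV. (x \<bullet> b i) * (y \<bullet> b i))"
proof -
  note o = assms[unfolded orthonormal_basis_def]
  have o1: "b1 \<bullet> b1 = 1" "b2 \<bullet> b2 = 1" "b1 \<bullet> b2 = 0" "b2 \<bullet> b1 = 0"
    "\<And>i. b1 \<bullet> b i = 0" "\<And>i. b2 \<bullet> b i = 0" "\<And>i. b i \<bullet> b1 = 0" "\<And>i. b i \<bullet> b2 = 0"
    "\<And>i j. b i \<bullet> b j = (if i = j then 1 else 0)"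
    using o by (auto simp: norm_eq_1 inner_commute)
  let ?B = "insert b1 (insert b2 (range b))"
  have ne: "b1 \<noteq> b2" "\<And>i. b1 \<noteq> b i" "\<And>i. b2 \<noteq> b i" using o1 by (metis zero_neq_one)+
  have "inj b" by (rule injI) (metis o1(9) zero_neq_one)
  then have "card ?B = CARD('p) + 2"
    using ne by (auto simp: card_image card_insert_if)
  moreover have "pairwise orthogonal ?B"
    using o1 by (auto simp: pairwise_def orthogonal_def)
  moreover have "0 \<notin> ?B" using o1 by (metis (no_types, lifting) image_iff inner_zero_left insertE zero_neq_one)
  ultimately have "independent ?B" "DIM('e) \<le> card ?B"
    using o pairwise_orthogonal_independent by auto
  then have span: "span ?B = UNIV"
    using card_ge_dim_independent[of ?B UNIV] by auto
  define z where "z = x - ((x \<bullet> b1) *\<^sub>R b1 + (x \<bullet> b2) *\<^sub>R b2 + (\<Sum>i\<in>UNIV. (x \<bullet> b i) *\<^sub>R b i))"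
  have "orthogonal z v" if "v \<in> ?B" for v
    using that by (auto simp: z_def orthogonal_def inner_diff_left inner_add_left inner_sum_left o1 if_distrib cong: if_cong)
  then have "orthogonal z z"
    using orthogonal_to_span[of z ?B] span by auto
  then have "x = (x \<bullet> b1) *\<^sub>R b1 + (x \<bullet> b2) *\<^sub>R b2 + (\<Sum>i\<in>UNIV. (x \<bullet> b i) *\<^sub>R b i)"
    by (simp add: z_def orthogonal_def)
  then have "x \<bullet> y = ((x \<bullet> b1) *\<^sub>R b1 + (x \<bullet> b2) *\<^sub>R b2 + (\<Sum>i\<in>UNIV. (x \<bullet> b i) *\<^sub>R b i)) \<bullet> y"
    by simp
  also have "\<dots> = (x \<bullet> b1) * (y \<bullet> b1) + (x \<bullet> b2) * (y \<bullet> b2) + (\<Sum>i\<in>UNIV. (x \<bullet> b i) * (y \<bullet> b i))"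
    by (simp add: inner_add_right inner_sum_right inner_commute)
  finally show ?thesis .
qed

lemma orthonormal_basis_eqI:
  fixes x y :: "'e::euclidean_space" and b :: "'p::finite \<Rightarrow> 'e"
  assumes "orthonormal_basis b1 b2 b" "x \<bullet> b1 = y \<bullet> b1" "x \<bullet> b2 = y \<bullet> b2" "\<And>i. x \<bullet> b i = y \<bullet> b i"
  shows "x = y"
proof -
  have "(x - y) \<bullet> (x - y) = 0"
    by (subst orthonormal_basis_parseval[OF assms(1)]) (simp add: assms(2-4) inner_diff_left)
  then show ?thesis by simp
qed

section \<open>Complexified components\<close>

text \<open>The component \<open><f\<^sub>z, v>\<close>. Since \<open>d_z\<close> acts on complex
  functions only, the complexified vector \<open>f\<^sub>z\<close> is represented by these
  components throughout.\<close>

definition comp_z :: "(complex \<Rightarrow> 'e::euclidean_space) \<Rightarrow> 'e \<Rightarrow> complex \<Rightarrow> complex" where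
  "comp_z f v = d_z (\<lambda>x. of_real (f x \<bullet> v))"

lemma differentiable_inner_const:
  fixes f :: "complex \<Rightarrow> 'e::euclidean_space"
  shows "f differentiable (at w) \<Longrightarrow> (\<lambda>x. f x \<bullet> v) differentiable (at w)"
  unfolding differentiable_def using has_derivative_inner_left by blast

lemma comp_z_eq:
  assumes "f differentiable (at w)"
  shows "comp_z f v w = Complex ((dir_deriv 1 f w \<bullet> v) / 2) (- (dir_deriv \<i> f w \<bullet> v) / 2)"
  unfolding comp_z_def has_wirtinger_of_real_works(2)[OF differentiable_inner_const[OF assms]]
  by (simp add: dir_deriv_inner_left[OF assms])

lemma smooth_on_comp_z: "open S \<Longrightarrow> smooth_on S f \<Longrightarrow> smooth_on S (comp_z f v)"
  unfolding comp_z_def by (intro smooth_on_d_z smooth_on_of_real smooth_on_inner_const)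

text \<open>The factorization of the Laplacian as four times the product of the Wirtinger operators;
  the imaginary part drops out by symmetry of the mixed derivatives.\<close>

lemma d_zbar_comp_z:
  assumes S: "open S" "smooth_on S f" "w \<in> S"
  shows "d_zbar (comp_z f v) w = of_real ((laplacian f w \<bullet> v) / 4)"
proof -
  let ?X = "dir_deriv 1 f" and ?Y = "dir_deriv \<i> f"
  have sm: "smooth_on S ?X" "smooth_on S ?Y" using smooth_on_dir_deriv S by blast+
  have dX: "(\<lambda>x. ?X x \<bullet> v) differentiable (at w)" "(\<lambda>x. ?Y x \<bullet> v) differentiable (at w)"
    using sm S(3) differentiable_inner_const smooth_on_differentiable by blast+
  have dd: "dir_deriv u (\<lambda>x. ?X x \<bullet> v) w = dir_deriv u ?X w \<bullet> v"
    "dir_deriv u (\<lambda>x. ?Y x \<bullet> v) w = dir_deriv u ?Y w \<bullet> v" for u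
    using dir_deriv_inner_left smooth_on_differentiable sm S(3) by blast+
  let ?x = "d_z (\<lambda>x. of_real (?X x \<bullet> v)) w" and ?y = "d_z (\<lambda>x. of_real (?Y x \<bullet> v)) w"
  have "has_wirtinger (\<lambda>x. 1/2 * (of_real (?X x \<bullet> v) - \<i> * of_real (?Y x \<bullet> v)))
     (0 * (of_real (?X w \<bullet> v) - \<i> * of_real (?Y w \<bullet> v)) + 1/2 * (?x - (0 * of_real (?Y w \<bullet> v) + \<i> * ?y)))
     (0 * (of_real (?X w \<bullet> v) - \<i> * of_real (?Y w \<bullet> v)) + 1/2 * (cnj ?x - (0 * of_real (?Y w \<bullet> v) + \<i> * cnj ?y))) w"
    by (intro has_wirtinger_mult has_wirtinger_diff has_wirtinger_const has_wirtinger_of_real_works(1) dX)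
  then have "has_wirtinger (comp_z f v)
     (0 * (of_real (?X w \<bullet> v) - \<i> * of_real (?Y w \<bullet> v)) + 1/2 * (?x - (0 * of_real (?Y w \<bullet> v) + \<i> * ?y)))
     (0 * (of_real (?X w \<bullet> v) - \<i> * of_real (?Y w \<bullet> v)) + 1/2 * (cnj ?x - (0 * of_real (?Y w \<bullet> v) + \<i> * cnj ?y))) w"
    by (rule has_wirtinger_transform[OF _ S(1,3)])
      (simp add: comp_z_eq smooth_on_differentiable[OF S(2)] complex_eq_iff)
  then have "d_zbar (comp_z f v) w = 1/2 * (cnj ?x - \<i> * cnj ?y)"
    using has_wirtinger_imp(2) by fastforce
  also have "\<dots> = of_real ((laplacian f w \<bullet> v) / 4)"
    unfolding has_wirtinger_of_real_works(2)[OF dX(1)] has_wirtinger_of_real_works(2)[OF dX(2)] dd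
    using dir_deriv_commute_vector[OF S(1,3,2), of 1 \<i>]
    by (simp add: laplacian_def complex_eq_iff inner_add_left)
  finally show ?thesis .
qed

text \<open>These are \<open><f\<^sub>z, f\<^sub>z>\<close> and \<open>|f\<^sub>z|^2\<close> in
  coordinates: the first vanishes exactly when the metric is conformal, and then the second is half
  the conformal factor.\<close>

lemma comp_z_square_sums:
  fixes f :: "complex \<Rightarrow> 'e::euclidean_space" and b :: "'p::finite \<Rightarrow> 'e"
  assumes o: "orthonormal_basis b1 b2 b" and d: "f differentiable (at w)"
  shows "(comp_z f b1 w)\<^sup>2 + (comp_z f b2 w)\<^sup>2 + (\<Sum>i\<in>UNIV. (comp_z f (b i) w)\<^sup>2)
      = Complex ((first_form f w 1 1 - first_form f w \<i> \<i>) / 4) (- first_form f w 1 \<i> / 2)" (is ?a)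
    and "(cmod (comp_z f b1 w))\<^sup>2 + (cmod (comp_z f b2 w))\<^sup>2 + (\<Sum>i\<in>UNIV. (cmod (comp_z f (b i) w))\<^sup>2)
      = (first_form f w 1 1 + first_form f w \<i> \<i>) / 4" (is ?b)
proof -
  let ?X = "dir_deriv 1 f w" and ?Y = "dir_deriv \<i> f w"
  have sq: "(comp_z f v w)\<^sup>2 = Complex (((?X \<bullet> v) * (?X \<bullet> v) - (?Y \<bullet> v) * (?Y \<bullet> v)) / 4) (- ((?X \<bullet> v) * (?Y \<bullet> v)) / 2)"
    for v unfolding comp_z_eq[OF d] by (simp add: complex_eq_iff power2_eq_square field_simps)
  have n: "(cmod (comp_z f v w))\<^sup>2 = ((?X \<bullet> v) * (?X \<bullet> v) + (?Y \<bullet> v) * (?Y \<bullet> v)) / 4" for v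
    unfolding comp_z_eq[OF d] cmod_power2 by (simp add: power2_eq_square field_simps)
  show ?a
    unfolding sq first_form_def orthonormal_basis_parseval[OF o, of ?X ?X]
      orthonormal_basis_parseval[OF o, of ?X ?Y] orthonormal_basis_parseval[OF o, of ?Y ?Y]
    by (simp add: complex_eq_iff sum_subtractf sum_negf sum_divide_distrib[symmetric] field_simps)
  show ?b
    unfolding n first_form_def orthonormal_basis_parseval[OF o, of ?X ?X]
      orthonormal_basis_parseval[OF o, of ?Y ?Y]
    by (simp add: sum.distrib sum_divide_distrib[symmetric] field_simps)
qed

text \<open>The singular minimal surface equation prescribes the conjugate derivative of \<open>x = \<langle>f\<^sub>z, v\<rangle>\<close> as this
  expression, with \<open>c = a / (2\<phi>)\<close>, \<open>P = |f\<^sub>z|\<^sup>2\<close>, \<open>g = \<phi>\<^sub>z\<close>, \<open>\<delta> = \<langle>e, v\<rangle>\<close>, where \<open>\<phi> = \<langle>f, e\<rangle>\<close>.\<close>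

definition pde_rhs :: "real \<Rightarrow> real \<Rightarrow> complex \<Rightarrow> real \<Rightarrow> complex \<Rightarrow> complex" where
  "pde_rhs c P g \<delta> x = of_real c * (of_real (P * \<delta>) - g * cnj x - cnj g * x)"

lemma Im_pde_rhs: "Im (pde_rhs c P g \<delta> x) = 0"
  by (simp add: pde_rhs_def)

text \<open>With \<open>g\<close> and \<open>x\<close> the components along \<open>e\<close> and
  \<open>v\<close>, the sum \<open><X,e><X,v> + <Y,e><Y,v>\<close> equals
  \<open>2 (g conj x + x conj g)\<close>. Together with the quarter from the Laplacian this turns
  \<open>a / H\<close> into \<open>a / (2 H)\<close> and the metric factor into its half
  \<open>|f\<^sub>z|^2\<close>.\<close>

lemma laplacian_component_iff:
  fixes f :: "complex \<Rightarrow> 'e::euclidean_space"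
  assumes S: "open S" "smooth_on S f" "w \<in> S"
  shows "laplacian f w \<bullet> v = ((a / H) *\<^sub>R (first_form f w 1 1 *\<^sub>R e
      - (e \<bullet> dir_deriv 1 f w) *\<^sub>R dir_deriv 1 f w - (e \<bullet> dir_deriv \<i> f w) *\<^sub>R dir_deriv \<i> f w)) \<bullet> v
    \<longleftrightarrow> d_zbar (comp_z f v) w
      = pde_rhs (a / (2 * H)) (first_form f w 1 1 / 2) (comp_z f e w) (e \<bullet> v) (comp_z f v w)"
proof -
  have d: "f differentiable (at w)" using S smooth_on_differentiable by blast
  let ?X = "dir_deriv 1 f w" and ?Y = "dir_deriv \<i> f w" and ?r = "first_form f w 1 1"
  have "pde_rhs (a / (2 * H)) (?r / 2) (comp_z f e w) (e \<bullet> v) (comp_z f v w)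
    = of_real ((a / H) * (?r * (e \<bullet> v) - (?X \<bullet> e) * (?X \<bullet> v) - (?Y \<bullet> e) * (?Y \<bullet> v)) / 4)"
    unfolding pde_rhs_def comp_z_eq[OF d] by (simp add: complex_eq_iff algebra_simps add_divide_distrib diff_divide_distrib)
  moreover have "((a / H) *\<^sub>R (?r *\<^sub>R e - (e \<bullet> ?X) *\<^sub>R ?X - (e \<bullet> ?Y) *\<^sub>R ?Y)) \<bullet> v
    = (a / H) * (?r * (e \<bullet> v) - (?X \<bullet> e) * (?X \<bullet> v) - (?Y \<bullet> e) * (?Y \<bullet> v))"
    by (simp add: inner_diff_left inner_diff_right inner_commute)
  ultimately show ?thesis
    unfolding d_zbar_comp_z[OF S] by (simp only: of_real_eq_iff) simp
qed

text \<open>Twice the coefficient of \<open>e\<^sub>p\<close> in the first summand of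
  \<open>F_map\<close>. Its geometric meaning is \<open>|f\<^sub>z|^2 = 2 |m|^2 S\<close> for
  \<open>f\<^sub>z = m (1 - Q, \<i> (1 + Q), 2 G)\<close>.\<close>

definition S_map :: "complex^'p \<Rightarrow> real" where
  "S_map G = 1 + (cmod (bil G G))\<^sup>2 + 2 * (norm G)\<^sup>2"

lemma S_map_pos: "S_map G > 0"
  unfolding S_map_def by (simp add: add_pos_nonneg)

section \<open>Algebra of the bilinear form, of \<open>F_map\<close> and of null vectors\<close>

lemma norm_vec_sum: "(norm (G :: complex^'p))\<^sup>2 = (\<Sum>i\<in>UNIV. (cmod (G $ i))\<^sup>2)"
  by (simp add: norm_vec_def L2_set_def sum_nonneg)

lemma bil_cnj_self: "bil G (cnj_vec G) = of_real ((norm (G :: complex^'p))\<^sup>2)"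
  by (simp add: bil_def cnj_vec_def norm_vec_sum complex_norm_square del: of_real_power)

lemma F_map_nth:
  "F_map k G $ i = (if i = k then of_real (S_map G / 2) else 0) - G $ k * (cnj (bil G G) * G $ i + cnj (G $ i))"
proof -
  have "bil (cnj_vec G) (cnj_vec G) = cnj (bil G G)"
    by (simp add: bil_def cnj_vec_def)
  then show ?thesis
    by (simp add: F_map_def S_map_def cnj_vec_def axis_def field_simps)
qed

text \<open>The contraction that governs the conjugate derivative of \<open>Q = <G, G>\<close> when
  the conjugate derivative of \<open>G\<close> is a multiple of \<open>F(G)\<close>. It also shows
  that a zero of \<open>F\<close> with \<open>G $ k\<close> nonzero has
  \<open>|Q| = 1\<close>.\<close>

lemma bil_F_map: "2 * bil G (F_map k G) = G $ k * (1 - bil G G * cnj (bil G G))"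
proof -
  let ?Q = "bil G G"
  have "bil G (F_map k G) = (\<Sum>i\<in>UNIV. G $ i * (if i = k then of_real (S_map G / 2) else 0))
      - G $ k * (cnj ?Q * (\<Sum>i\<in>UNIV. G $ i * G $ i) + (\<Sum>i\<in>UNIV. G $ i * cnj (G $ i)))"
    unfolding bil_def[of G "F_map k G"] F_map_nth
    by (simp add: sum_subtractf[symmetric] sum.distrib[symmetric] sum_distrib_left algebra_simps)
  also have "(\<Sum>i\<in>UNIV. G $ i * (if i = k then of_real (S_map G / 2) else 0)) = G $ k * of_real (S_map G / 2)"
    by (simp add: if_distrib cong: if_cong)
  also have "(\<Sum>i\<in>UNIV. G $ i * G $ i) = ?Q" by (simp add: bil_def)
  also have "(\<Sum>i\<in>UNIV. G $ i * cnj (G $ i)) = of_real ((norm G)\<^sup>2)"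
    unfolding bil_cnj_self[symmetric] by (simp add: bil_def cnj_vec_def)
  finally have "2 * bil G (F_map k G) = G $ k * (of_real (S_map G) - 2 * (cnj ?Q * ?Q) - 2 * of_real ((norm G)\<^sup>2))"
    by (simp add: algebra_simps)
  also have "of_real (S_map G) = 1 + ?Q * cnj ?Q + 2 * of_real ((norm G)\<^sup>2)"
    unfolding complex_norm_square[symmetric] by (simp add: S_map_def)
  finally show ?thesis by (simp add: algebra_simps)
qed

lemma null_vector_square_sums:
  fixes G :: "complex^'p" and m :: complex
  defines "Q \<equiv> bil G G"
  shows "(m * (1 - Q))\<^sup>2 + (\<i> * (m * (1 + Q)))\<^sup>2 + (\<Sum>i\<in>UNIV. (2 * (m * G $ i))\<^sup>2) = 0"
    and "(cmod (m * (1 - Q)))\<^sup>2 + (cmod (\<i> * (m * (1 + Q))))\<^sup>2 + (\<Sum>i\<in>UNIV. (cmod (2 * (m * G $ i)))\<^sup>2)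
      = 2 * (cmod m)\<^sup>2 * S_map G"
proof -
  have "(\<Sum>i\<in>UNIV. (2 * (m * G $ i))\<^sup>2) = 4 * m\<^sup>2 * Q"
    unfolding Q_def bil_def by (simp add: sum_distrib_left power2_eq_square algebra_simps)
  then show "(m * (1 - Q))\<^sup>2 + (\<i> * (m * (1 + Q)))\<^sup>2 + (\<Sum>i\<in>UNIV. (2 * (m * G $ i))\<^sup>2) = 0"
    by (simp add: power2_eq_square algebra_simps)
  have "(\<Sum>i\<in>UNIV. (cmod (2 * (m * G $ i)))\<^sup>2) = 4 * (cmod m)\<^sup>2 * (norm G)\<^sup>2"
    unfolding norm_vec_sum by (simp add: sum_distrib_left norm_mult power_mult_distrib algebra_simps)
  moreover have "(cmod (1 - Q))\<^sup>2 + (cmod (1 + Q))\<^sup>2 = 2 + 2 * (cmod Q)\<^sup>2"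
    by (simp add: cmod_power2) (simp add: power2_eq_square algebra_simps)
  then have "(cmod (m * (1 - Q)))\<^sup>2 + (cmod (\<i> * (m * (1 + Q))))\<^sup>2 = (cmod m)\<^sup>2 * (2 + 2 * (cmod Q)\<^sup>2)"
    by (simp add: norm_mult power_mult_distrib distrib_left[symmetric])
  ultimately show "(cmod (m * (1 - Q)))\<^sup>2 + (cmod (\<i> * (m * (1 + Q))))\<^sup>2 + (\<Sum>i\<in>UNIV. (cmod (2 * (m * G $ i)))\<^sup>2)
      = 2 * (cmod m)\<^sup>2 * S_map G"
    by (simp add: S_map_def Q_def algebra_simps)
qed

text \<open>Contracting with \<open>G\<close> gives \<open>|Q| = 1\<close>. The k-th component then
  says that \<open>g (g conj Q)\<close> equals \<open>1 + |G|^2 - |g|^2\<close>, which is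
  nonnegative; as its modulus is \<open>|g|^2\<close>, it equals \<open>g conj g\<close>.\<close>

lemma F_map_zero_imp:
  fixes G :: "complex^'p"
  assumes F: "F_map k G = 0" and g: "G $ k \<noteq> 0"
  shows "G $ k * cnj (bil G G) = cnj (G $ k)"
proof -
  let ?Q = "bil G G" and ?g = "G $ k"
  have "?Q * cnj ?Q = 1"
    using bil_F_map[of G k] F g by (simp add: bil_def)
  then have Q: "cmod ?Q = 1"
    by (metis complex_norm_square norm_ge_zero norm_one of_real_eq_1_iff one_power2 power2_eq_iff_nonneg zero_le_one)
  have "F_map k G $ k = 0" using F by simp
  then have "of_real (S_map G / 2) = ?g * (cnj ?Q * ?g + cnj ?g)"
    by (simp add: F_map_nth)
  then have e: "?g * (?g * cnj ?Q) = of_real (S_map G / 2 - (cmod ?g)\<^sup>2)"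
    unfolding of_real_diff complex_norm_square by (simp add: algebra_simps)
  have "(cmod ?g)\<^sup>2 \<le> (norm G)\<^sup>2"
    unfolding norm_vec_sum by (rule member_le_sum) auto
  moreover have "S_map G = 2 + 2 * (norm G)\<^sup>2" by (simp add: S_map_def Q)
  ultimately have pos: "S_map G / 2 - (cmod ?g)\<^sup>2 \<ge> 0" by linarith
  have "cmod (?g * (?g * cnj ?Q)) = (cmod ?g)\<^sup>2"
    by (simp add: norm_mult Q power2_eq_square)
  then have "S_map G / 2 - (cmod ?g)\<^sup>2 = (cmod ?g)\<^sup>2"
    unfolding e norm_of_real using pos by simp
  then have "?g * (?g * cnj ?Q) = ?g * cnj ?g"
    unfolding e complex_norm_square[symmetric] by simp
  then show ?thesis using g by simp
qed

section \<open>The Gauss map equations\<close>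

lemma smooth_on_bil:
  "open S \<Longrightarrow> smooth_on S G \<Longrightarrow> smooth_on S H \<Longrightarrow> smooth_on S (\<lambda>u. bil (G u) (H u))"
  unfolding bil_def by (intro smooth_on_sum smooth_on_mult smooth_on_vec_nth)

lemma smooth_on_F_map:
  assumes S: "open S" "smooth_on S G"
  shows "smooth_on S (\<lambda>u. F_map k (G u))"
proof -
  \<comment> \<open>Norms are rewritten as polynomials in the entries and their conjugates, to which
    the closure rules for smoothness apply directly.\<close>
  have S_eq: "complex_of_real (S_map X / 2)
      = (1 + bil X X * cnj (bil X X) + 2 * (\<Sum>i\<in>UNIV. X $ i * cnj (X $ i))) / 2" for X :: "complex^'p"
  proof -
    have "(\<Sum>i\<in>UNIV. X $ i * cnj (X $ i)) = of_real ((norm X)\<^sup>2)"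
      unfolding bil_cnj_self[symmetric] by (simp add: bil_def cnj_vec_def)
    then show ?thesis
      unfolding complex_norm_square[symmetric] by (simp add: S_map_def)
  qed
  have "smooth_on S (\<lambda>u. (if i = k then complex_of_real (S_map (G u) / 2) else 0))" for i
  proof (cases "i = k")
    case True
    then show ?thesis unfolding S_eq
      by simp (intro smooth_on_divide smooth_on_add smooth_on_mult smooth_on_sum smooth_on_const
          smooth_on_cnj smooth_on_bil smooth_on_vec_nth S; simp)
  qed (simp add: smooth_on_const)
  then have "smooth_on S (\<lambda>u. F_map k (G u) $ i)" for i
    unfolding F_map_nth
    by (intro smooth_on_diff smooth_on_mult smooth_on_add smooth_on_cnj smooth_on_bil smooth_on_vec_nth S)
  then have "smooth_on S (\<lambda>u. \<chi> i. F_map k (G u) $ i)"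
    by (rule smooth_on_vec_lambda[OF S(1)])
  then show ?thesis by simp
qed

section \<open>Derivatives of \<open>G\<close> and the weight\<close>

lemma differentiable_vec_nth:
  fixes G :: "complex \<Rightarrow> complex^'p"
  shows "G differentiable (at w) \<Longrightarrow> (\<lambda>u. G u $ i) differentiable (at w)"
  unfolding differentiable_def using bounded_linear.has_derivative[OF bounded_linear_vec_nth] by blast

lemma has_wirtinger_vec_nth:
  assumes "G differentiable (at w)"
  shows "has_wirtinger (\<lambda>u. G u $ i) (D_z G w $ i) (D_zbar G w $ i) w"
  using has_wirtinger_works[OF differentiable_vec_nth[OF assms]] by (simp add: D_z_def D_zbar_def)

lemma has_wirtinger_bil_self:
  assumes "G differentiable (at w)"
  shows "has_wirtinger (\<lambda>u. bil (G u) (G u)) (2 * bil (G w) (D_z G w)) (2 * bil (G w) (D_zbar G w)) w"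
proof -
  have "has_wirtinger (\<lambda>u. bil (G u) (G u)) (\<Sum>i\<in>UNIV. D_z G w $ i * G w $ i + G w $ i * D_z G w $ i)
      (\<Sum>i\<in>UNIV. D_zbar G w $ i * G w $ i + G w $ i * D_zbar G w $ i) w"
    unfolding bil_def by (intro has_wirtinger_sum has_wirtinger_mult has_wirtinger_vec_nth assms)
  then show ?thesis
    unfolding bil_def sum_distrib_left by (simp add: algebra_simps)
qed

lemma norm_scale_vec: "norm (c *s (X :: complex^'p)) = cmod c * norm X"
proof -
  have "(norm (c *s X))\<^sup>2 = (cmod c * norm X)\<^sup>2"
    unfolding power_mult_distrib norm_vec_sum by (simp add: norm_mult power_mult_distrib sum_distrib_left)
  then show ?thesis by (simp add: power2_eq_iff_nonneg)
qed

lemma bil_scale_left: "bil (c *s X) Y = c * bil X Y"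
  by (simp add: bil_def sum_distrib_left mult.assoc)

lemma bil_scale_right: "bil X (c *s Y) = c * bil X Y"
  by (simp add: bil_def sum_distrib_left algebra_simps)

lemma bil_commute: "bil X Y = bil Y X"
  by (simp add: bil_def mult.commute)

lemma weight_altdef:
  assumes "G differentiable (at w)"
  shows "weight k G w = bil (cnj_vec (D_zbar G w)) (F_map k (G w)) / of_real ((norm (F_map k (G w)))\<^sup>2)"
proof -
  have "d_z (\<lambda>u. cnj (G u $ i)) w = cnj (D_zbar G w $ i)" for i
    using has_wirtinger_imp(1)[OF has_wirtinger_cnj[OF has_wirtinger_vec_nth[OF assms]]] .
  then have "D_z (\<lambda>u. cnj_vec (G u)) w = cnj_vec (D_zbar G w)"
    by (simp add: D_z_def cnj_vec_def)
  then show ?thesis by (simp add: weight_def)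
qed

lemma weight_eqI:
  assumes "G differentiable (at w)" "D_zbar G w = cnj \<omega> *s F_map k (G w)" "F_map k (G w) \<noteq> 0"
  shows "weight k G w = \<omega>"
proof -
  let ?F = "F_map k (G w)"
  have "cnj_vec (cnj \<omega> *s ?F) = \<omega> *s cnj_vec ?F" by (simp add: cnj_vec_def vec_eq_iff)
  then have "weight k G w = \<omega> * bil ?F (cnj_vec ?F) / of_real ((norm ?F)\<^sup>2)"
    unfolding weight_altdef[OF assms(1)] assms(2) by (simp add: bil_scale_left bil_scale_right bil_commute)
  then show ?thesis using assms(3) by (simp add: bil_cnj_self)
qed

text \<open>By \<open>eq2\<close> the vector \<open>D_zbar G w\<close> is parallel to the nonzero
  vector \<open>F\<close>, so it equals its own Hermitian projection onto \<open>F\<close>; the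
  conjugate of the coefficient of that projection is the weight.\<close>

lemma D_zbar_eq_weight:
  assumes "G differentiable (at w)" "eq2 k G w" "F_map k (G w) \<noteq> 0"
  shows "D_zbar G w = cnj (weight k G w) *s F_map k (G w)"
proof -
  let ?F = "F_map k (G w)" and ?V = "D_zbar G w"
  have "?V $ i = cnj (weight k G w) * ?F $ i" for i
  proof -
    have "?V $ i * of_real ((norm ?F)\<^sup>2) = (\<Sum>j\<in>UNIV. ?V $ i * ?F $ j * cnj (?F $ j))"
      unfolding bil_cnj_self[symmetric] by (simp add: bil_def cnj_vec_def sum_distrib_left mult.assoc)
    also have "\<dots> = (\<Sum>j\<in>UNIV. ?V $ j * ?F $ i * cnj (?F $ j))"
      using assms(2) by (intro sum.cong) (auto simp: eq2_def wedge_zero_def)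
    also have "\<dots> = bil ?V (cnj_vec ?F) * ?F $ i"
      by (simp add: bil_def cnj_vec_def sum_distrib_left sum_distrib_right mult_ac)
    also have "bil ?V (cnj_vec ?F) = cnj (bil (cnj_vec ?V) ?F)"
      by (simp add: bil_def cnj_vec_def)
    finally show ?thesis using assms(3) by (simp add: weight_altdef[OF assms(1)] field_simps)
  qed
  then show ?thesis by (simp add: vec_eq_iff)
qed

lemma eq2I: "D_zbar G w = c *s F_map k (G w) \<Longrightarrow> eq2 k G w"
  by (simp add: eq2_def wedge_zero_def)

text \<open>Differentiating \<open>D_zbar G = conj \<omega> F(G)\<close> by z gives one multiple of
  \<open>F\<close> and the term \<open>conj \<omega> (F(G))\<^sub>z\<close>. The latter is precisely
  the last term of \<open>eq1\<close>, so it cancels, and comparing the coefficients of the nonzero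
  vector \<open>F\<close> leaves the conjugate of a scalar equation for
  \<open>\<omega>\<close>.\<close>

lemma eq1_iff:
  fixes G :: "complex \<Rightarrow> complex^'p"
  assumes S: "open S" "smooth_on S G" "w \<in> S" and om: "\<omega> differentiable (at w)"
    and V: "\<And>u. u \<in> S \<Longrightarrow> D_zbar G u = cnj (\<omega> u) *s F_map k (G u)" and F: "F_map k (G w) \<noteq> 0"
  shows "eq1 n k G w \<longleftrightarrow> d_zbar \<omega> w = of_real ((cmod (\<omega> w))\<^sup>2) *
    (cnj (bil (G w) (G w)) * G w $ k - of_nat n / (of_nat n - 2) * cnj (G w $ k))"
    (is "_ \<longleftrightarrow> _ = ?R")
proof -
  let ?F = "F_map k (G w)"
  have dF: "(\<lambda>u. F_map k (G u)) differentiable (at w)"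
    using smooth_on_F_map S smooth_on_differentiable by blast
  have DD: "D_z (D_zbar G) w = cnj (d_zbar \<omega> w) *s ?F + cnj (\<omega> w) *s D_z (\<lambda>u. F_map k (G u)) w"
  proof -
    have "d_z (\<lambda>u. D_zbar G u $ i) w = cnj (d_zbar \<omega> w) * ?F $ i + cnj (\<omega> w) * D_z (\<lambda>u. F_map k (G u)) w $ i" for i
    proof -
      have "has_wirtinger (\<lambda>u. cnj (\<omega> u) * F_map k (G u) $ i)
        (cnj (d_zbar \<omega> w) * ?F $ i + cnj (\<omega> w) * D_z (\<lambda>u. F_map k (G u)) w $ i)
        (cnj (d_z \<omega> w) * ?F $ i + cnj (\<omega> w) * D_zbar (\<lambda>u. F_map k (G u)) w $ i) w"
        by (intro has_wirtinger_mult has_wirtinger_cnj has_wirtinger_works om has_wirtinger_vec_nth dF)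
      then have "has_wirtinger (\<lambda>u. D_zbar G u $ i)
        (cnj (d_zbar \<omega> w) * ?F $ i + cnj (\<omega> w) * D_z (\<lambda>u. F_map k (G u)) w $ i)
        (cnj (d_z \<omega> w) * ?F $ i + cnj (\<omega> w) * D_zbar (\<lambda>u. F_map k (G u)) w $ i) w"
        by (rule has_wirtinger_transform[OF _ S(1,3)]) (simp add: V)
      then show ?thesis by (rule has_wirtinger_imp(1))
    qed
    then show ?thesis by (simp add: D_z_def vec_eq_iff)
  qed
  have nF: "norm ?F \<noteq> 0" using F by simp
  have r: "(norm (D_zbar G w))\<^sup>2 / (norm ?F)\<^sup>2 = (cmod (\<omega> w))\<^sup>2"
    using nF by (simp add: V[OF S(3)] norm_scale_vec power_mult_distrib)
  have c: "bil (D_zbar G w) (cnj_vec ?F) / of_real ((norm ?F)\<^sup>2) = cnj (\<omega> w)"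
    using nF by (simp add: V[OF S(3)] bil_scale_left bil_cnj_self)
  have "eq1 n k G w \<longleftrightarrow> cnj (d_zbar \<omega> w) *s ?F = cnj ?R *s ?F"
    unfolding eq1_def Let_def r c DD by (simp add: vec_eq_iff algebra_simps)
  also have "\<dots> \<longleftrightarrow> cnj (d_zbar \<omega> w) = cnj ?R"
    using F by (auto simp: vec_eq_iff)
  finally show ?thesis by (simp only: complex_cnj_cancel_iff)
qed

lemma pde_rhs_null:
  "pde_rhs (1 / (2 * h)) (2 * (cmod m)\<^sup>2 * S) (2 * (m * g)) \<delta> (m * x)
    = of_real ((cmod m)\<^sup>2 / h) * (of_real (S * \<delta>) - g * cnj x - cnj g * x)"
proof -
  have "complex_of_real ((cmod m)\<^sup>2) = m * cnj m" by (rule complex_norm_square)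
  then show ?thesis unfolding pde_rhs_def by (simp add: algebra_simps add_divide_distrib)
qed

text \<open>\<open>M\<close> and \<open>V\<close> are the derivatives of \<open>m\<close> and \<open>G\<close> with respect to the conjugate variable. Subtracting \<open>\<i>\<close>
  times the second component from the first one eliminates the derivative of \<open>Q\<close>.\<close>

lemma gauss_map_equations:
  fixes G V :: "complex^'p" and m M :: complex and h :: real
  defines "Q \<equiv> bil G G" and "c \<equiv> (cmod m)\<^sup>2 / h"
  assumes h: "h > 0" and m: "m \<noteq> 0"
    and M: "2 * M = pde_rhs (1 / (2 * h)) (2 * (cmod m)\<^sup>2 * S_map G) (2 * (m * G $ k)) 0 (m * (1 - Q))
      - \<i> * pde_rhs (1 / (2 * h)) (2 * (cmod m)\<^sup>2 * S_map G) (2 * (m * G $ k)) 0 (m * (\<i> * (1 + Q)))"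
    and V: "\<And>i. 2 * (M * G $ i + m * V $ i)
      = pde_rhs (1 / (2 * h)) (2 * (cmod m)\<^sup>2 * S_map G) (2 * (m * G $ k)) (if i = k then 1 else 0) (m * (2 * G $ i))"
  shows "M = of_real c * (G $ k * cnj Q - cnj (G $ k))" and "V = cnj (m / of_real h) *s F_map k G"
proof -
  show M': "M = of_real c * (G $ k * cnj Q - cnj (G $ k))"
  proof -
    have "2 * M = 2 * (of_real c * (G $ k * cnj Q - cnj (G $ k)))"
      unfolding M pde_rhs_null c_def[symmetric] by (simp add: algebra_simps)
    then show ?thesis by simp
  qed
  have "V $ i = cnj (m / of_real h) * F_map k G $ i" for i
  proof -
    have "2 * (m * V $ i) = 2 * (of_real c * F_map k G $ i)"
    proof -
      \<comment> \<open>The product rule is undone: the part of the derivative that falls on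
        \<open>m\<close> is known from \<open>M'\<close> and is removed, and what remains is
        \<open>F\<close> by its component formula.\<close>
      have "2 * (m * V $ i) = 2 * (M * G $ i + m * V $ i) - 2 * (M * G $ i)"
        by (simp add: algebra_simps)
      also have "\<dots> = 2 * (of_real c * F_map k G $ i)"
        unfolding V[of i] unfolding pde_rhs_null c_def[symmetric] M' F_map_nth Q_def[symmetric]
        by (simp add: algebra_simps)
      finally show ?thesis .
    qed
    then have "m * V $ i = of_real c * F_map k G $ i" by simp
    moreover have "complex_of_real c = m * cnj (m / of_real h)"
      by (simp add: c_def complex_norm_square del: of_real_power)
    ultimately have "m * V $ i = m * (cnj (m / of_real h) * F_map k G $ i)"
      by (simp only: mult.assoc)
    then show ?thesis using m by (metis mult_left_cancel)
  qed
  then show "V = cnj (m / of_real h) *s F_map k G" by (simp add: vec_eq_iff)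
qed

section \<open>Density of the regular points\<close>

lemma comp_z_diff_scale:
  fixes f :: "complex \<Rightarrow> 'e::euclidean_space"
  assumes "f differentiable (at w)"
  shows "comp_z f (s *\<^sub>R u - t *\<^sub>R v) w = of_real s * comp_z f u w - of_real t * comp_z f v w"
  unfolding comp_z_eq[OF assms]
  by (simp add: complex_eq_iff inner_diff_right algebra_simps diff_divide_distrib)

lemma comp_z_zero_imp_constant:
  fixes f :: "complex \<Rightarrow> 'e::euclidean_space"
  assumes "f differentiable (at w)" "comp_z f v w = 0"
  shows "((\<lambda>x. f x \<bullet> v) has_derivative (\<lambda>_. 0)) (at w)"
proof -
  have "has_wirtinger (\<lambda>x. complex_of_real (f x \<bullet> v)) 0 (cnj 0) w"
    using has_wirtinger_of_real_works(1)[OF differentiable_inner_const[OF assms(1), of v]] assms(2)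
    by (simp add: comp_z_def)
  then show ?thesis using has_wirtinger_of_real[of "\<lambda>x. f x \<bullet> v" 0 w] by simp
qed

lemma open_contains_ball_nonempty:
  assumes "open S" "S \<noteq> {}"
  shows "\<exists>w r. 0 < r \<and> ball w r \<subseteq> S"
  using assms openE by blast

text \<open>Otherwise a height function is locally constant, and a piece of the surface lies in a hyperplane.\<close>

lemma comp_z_nonzero_somewhere:
  fixes f :: "complex \<Rightarrow> 'e::euclidean_space"
  assumes full: "\<And>W. open W \<Longrightarrow> W \<noteq> {} \<Longrightarrow> W \<subseteq> T \<Longrightarrow> affine hull (f ` W) = UNIV"
    and S: "open S" "S \<noteq> {}" "S \<subseteq> T" and d: "\<And>w. w \<in> S \<Longrightarrow> f differentiable (at w)" and v: "v \<noteq> 0"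
  shows "\<exists>w\<in>S. comp_z f v w \<noteq> 0"
proof (rule ccontr)
  assume "\<not> ?thesis"
  then have z: "comp_z f v w = 0" if "w \<in> S" for w using that by blast
  obtain w r where B: "0 < r" "ball w r \<subseteq> S" using open_contains_ball_nonempty[OF S(1,2)] by blast
  have "((\<lambda>x. f x \<bullet> v) has_derivative (\<lambda>_. 0)) (at x within ball w r)" if "x \<in> ball w r" for x
    by (rule has_derivative_at_withinI[OF comp_z_zero_imp_constant[OF d z]])
      (use that B(2) in auto)
  then obtain c where c: "\<And>x. x \<in> ball w r \<Longrightarrow> f x \<bullet> v = c"
    using has_derivative_zero_constant[OF convex_ball, of w r "\<lambda>x. f x \<bullet> v"] by blast
  have "affine hull (f ` ball w r) \<subseteq> {x. v \<bullet> x = c}"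
    using c by (intro hull_minimal affine_hyperplane) (auto simp: inner_commute)
  moreover have "affine hull (f ` ball w r) = UNIV"
    using B S(3) by (intro full) auto
  ultimately have "UNIV \<subseteq> {x. v \<bullet> x = c}" by simp
  then have "v \<in> {x. v \<bullet> x = c}" "0 \<in> {x. v \<bullet> x = c}" by blast+
  then have "v \<bullet> v = 0" by simp
  then show False using v by simp
qed

text \<open>The right-hand side of the equation tests the normal part of \<open>e\<close> against
  \<open>v\<close>. So it vanishes for every \<open>v\<close> where \<open>e\<close> is tangent, and
  for nonzero \<open>a\<close> its vanishing on a basis forces tangency.\<close>

lemma pde_rhs_normal_part:
  fixes f :: "complex \<Rightarrow> 'e::euclidean_space"
  assumes d: "f differentiable (at w)" and c: "conformal_on {w} f"
  shows "pde_rhs a (first_form f w 1 1 / 2) (comp_z f e w) (e \<bullet> v) (comp_z f v w)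
    = of_real (a * (first_form f w 1 1 / 2) * (normal_part f w e \<bullet> v))"
proof -
  have r: "first_form f w 1 1 \<noteq> 0" using c by (auto simp: conformal_on_def)
  have N: "first_form f w 1 1 * (normal_part f w e \<bullet> v) = first_form f w 1 1 * (e \<bullet> v)
      - (dir_deriv 1 f w \<bullet> e) * (dir_deriv 1 f w \<bullet> v) - (dir_deriv \<i> f w \<bullet> e) * (dir_deriv \<i> f w \<bullet> v)"
    unfolding normal_part_conformal[OF d c] using r
    by (simp add: inner_diff_left inner_add_left inner_commute algebra_simps)
  have "pde_rhs a (first_form f w 1 1 / 2) (comp_z f e w) (e \<bullet> v) (comp_z f v w)
    = of_real (a / 2 * (first_form f w 1 1 * (normal_part f w e \<bullet> v)))"
    unfolding N pde_rhs_def comp_z_eq[OF d]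
    by (simp add: complex_eq_iff algebra_simps add_divide_distrib diff_divide_distrib)
  then show ?thesis by simp
qed

lemma open_nonzero:
  fixes g :: "complex \<Rightarrow> 'b::real_normed_vector"
  assumes "open S" "continuous_on S g"
  shows "open {w \<in> S. g w \<noteq> 0}"
proof -
  have "{w \<in> S. g w \<noteq> 0} = S \<inter> g -` (- {0})" by auto
  then show ?thesis using continuous_open_preimage[OF assms(2,1), of "- {0}"] by auto
qed

lemma continuous_on_normal_part:
  fixes f :: "complex \<Rightarrow> 'e::euclidean_space"
  assumes S: "open S" "smooth_on S f" and c: "conformal_on S f"
  shows "continuous_on S (\<lambda>w. normal_part f w e)"
proof -
  note sm = smooth_on_continuous_on[OF smooth_on_dir_deriv[OF S(2)]]
  have "continuous_on S (\<lambda>w. e - (1 / first_form f w 1 1) *\<^sub>R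
    ((e \<bullet> dir_deriv 1 f w) *\<^sub>R dir_deriv 1 f w + (e \<bullet> dir_deriv \<i> f w) *\<^sub>R dir_deriv \<i> f w))"
    using c unfolding first_form_def conformal_on_def
    by (intro continuous_intros sm) auto
  moreover have "normal_part f w e = e - (1 / first_form f w 1 1) *\<^sub>R
    ((e \<bullet> dir_deriv 1 f w) *\<^sub>R dir_deriv 1 f w + (e \<bullet> dir_deriv \<i> f w) *\<^sub>R dir_deriv \<i> f w)" if "w \<in> S" for w
    using c that by (intro normal_part_conformal smooth_on_differentiable[OF S(2)]) (auto simp: conformal_on_def)
  ultimately show ?thesis by (simp cong: continuous_on_cong)
qed

text \<open>A purely imaginary function equals minus its conjugate; if it is holomorphic it is
  therefore also antiholomorphic, and its whole differential vanishes.\<close>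

lemma imaginary_holomorphic_constant:
  assumes B: "\<And>w. w \<in> ball c r \<Longrightarrow> r' differentiable (at w)"
    "\<And>w. w \<in> ball c r \<Longrightarrow> d_zbar r' w = 0" "\<And>w. w \<in> ball c r \<Longrightarrow> Re (r' w) = 0"
  shows "\<exists>k. \<forall>w\<in>ball c r. r' w = k"
proof -
  have "(r' has_derivative (\<lambda>_. 0)) (at w)" if w: "w \<in> ball c r" for w
  proof -
    have h: "has_wirtinger r' (d_z r' w) 0 w"
      using has_wirtinger_works[OF B(1)[OF w]] B(2)[OF w] by simp
    have "has_wirtinger (\<lambda>x. - cnj (r' x)) (- cnj 0) (- cnj (d_z r' w)) w"
      by (intro has_wirtinger_minus has_wirtinger_cnj h)
    then have "has_wirtinger r' (- cnj 0) (- cnj (d_z r' w)) w"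
      by (rule has_wirtinger_transform[OF _ open_ball w]) (simp add: complex_eq_iff B(3))
    then have "d_z r' w = 0" using has_wirtinger_imp(1) by force
    then show ?thesis using h by (simp add: has_wirtinger_def)
  qed
  then have "(r' has_derivative (\<lambda>_. 0)) (at w within ball c r)" if "w \<in> ball c r" for w
    using that has_derivative_at_withinI by blast
  then show ?thesis
    using has_derivative_zero_constant[OF convex_ball, of c r r'] by blast
qed

text \<open>If \<open>e\<close> is tangent to the surface, the equation says that the surface is minimal, and the
  quotients \<open>v\<^sub>z / h\<^sub>z\<close> for heights \<open>v\<close> orthogonal to \<open>e\<close> are holomorphic and purely imaginary, hence
  constant. Two such heights are then affinely dependent.\<close>

lemma regular_points_dense:
  fixes f :: "complex \<Rightarrow> 'e::euclidean_space" and b :: "'p::finite \<Rightarrow> 'e"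
  assumes o: "orthonormal_basis b1 b2 b" and e: "b k = e"
    and T: "open T" "smooth_on T f" "conformal_on T f"
    and pde: "\<And>w v. w \<in> T \<Longrightarrow> d_zbar (comp_z f v) w
      = pde_rhs (a w) (first_form f w 1 1 / 2) (comp_z f e w) (e \<bullet> v) (comp_z f v w)"
    and a: "\<And>w. w \<in> T \<Longrightarrow> a w \<noteq> 0"
    and full: "\<And>W. open W \<Longrightarrow> W \<noteq> {} \<Longrightarrow> W \<subseteq> T \<Longrightarrow> affine hull (f ` W) = UNIV"
  shows "T \<subseteq> closure (regular_points b1 b2 e T f)"
proof (rule ccontr)
  let ?R = "regular_points b1 b2 e T f"
  have R: "?R = {w \<in> T. comp_z f b1 w - \<i> * comp_z f b2 w \<noteq> 0 \<and> comp_z f e w \<noteq> 0 \<and> normal_part f w e \<noteq> 0}"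
    by (simp add: regular_points_def comp_z_def)
  have "b k \<bullet> b k = 1" using o by (simp add: orthonormal_basis_def)
  then have o1: "b1 \<noteq> 0" "b2 \<noteq> 0" "e \<noteq> 0" "e \<bullet> b1 = 0" "e \<bullet> b2 = 0" "b1 \<bullet> b2 = 0"
    using o e unfolding orthonormal_basis_def by (auto simp: inner_commute)
  note d = smooth_on_differentiable[OF T(2)]
  note cont = smooth_on_continuous_on[OF smooth_on_comp_z[OF T(1,2)]]
  have nz: "\<exists>w\<in>S. comp_z f v w \<noteq> 0" if "open S" "S \<noteq> {}" "S \<subseteq> T" "v \<noteq> 0" for S v
    by (rule comp_z_nonzero_somewhere[OF full that(1-3) d that(4)]) (use that(3) in auto)
  assume "\<not> T \<subseteq> closure ?R"
  define W where "W = T - closure ?R"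
  have W: "open W" "W \<noteq> {}" "W \<subseteq> T" "W \<inter> ?R = {}"
    using \<open>\<not> T \<subseteq> closure ?R\<close> T(1) closure_subset[of ?R] by (auto simp: W_def)
  \<comment> \<open>\<open>W\<close> misses the regular points. It is shrunk to open sets where the
    conditions on \<open>e\<close> and then on \<open>b1\<close>, \<open>b2\<close> hold, so that on
    \<open>W2\<close> only the third condition can fail and \<open>e\<close> must be
    tangent.\<close>
  define W1 where "W1 = {w \<in> W. comp_z f e w \<noteq> 0}"
  have W1: "open W1" "W1 \<noteq> {}" "W1 \<subseteq> W"
    using nz[OF W(1-3) o1(3)] open_nonzero[OF W(1) continuous_on_subset[OF cont W(3)], of e]
    by (auto simp: W1_def)
  define W2 where "W2 = {w \<in> W1. comp_z f b1 w - \<i> * comp_z f b2 w \<noteq> 0}"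
  have "continuous_on W1 (\<lambda>w. comp_z f b1 w - \<i> * comp_z f b2 w)"
    using W1(3) W(3) by (intro continuous_intros continuous_on_subset[OF cont]) auto
  then have "open W2"
    unfolding W2_def by (rule open_nonzero[OF W1(1)])
  then have W2: "open W2" "W2 \<subseteq> W1" by (auto simp: W2_def)
  have "W2 \<noteq> {}"
  proof
    assume "W2 = {}"
    \<comment> \<open>If \<open>P1 = \<i> P2\<close> on an open set, with \<open>P1\<close>,
      \<open>P2\<close> the components along \<open>b1\<close>, \<open>b2\<close>, then comparing
      conjugate derivatives through the equation and cancelling \<open>\<phi>\<^sub>z\<close> gives
      \<open>conj P1 = \<i> conj P2\<close>, that is, \<open>P1 = - \<i> P2\<close>. Both components
      vanish, although the height along \<open>b1\<close> is not locally constant.\<close>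
    then have eq: "comp_z f b1 w = \<i> * comp_z f b2 w" if "w \<in> W1" for w
      using that by (auto simp: W2_def)
    have "comp_z f b1 w = 0" if w: "w \<in> W1" for w
    proof -
      have wT: "w \<in> T" using w W W1 by blast
      have "has_wirtinger (\<lambda>w. \<i> * comp_z f b2 w) (0 * comp_z f b2 w + \<i> * d_z (comp_z f b2) w)
          (0 * comp_z f b2 w + \<i> * d_zbar (comp_z f b2) w) w"
        using smooth_on_differentiable[OF smooth_on_comp_z[OF T(1,2)] wT]
        by (intro has_wirtinger_mult has_wirtinger_const has_wirtinger_works)
      then have "has_wirtinger (comp_z f b1) (0 * comp_z f b2 w + \<i> * d_z (comp_z f b2) w)
          (0 * comp_z f b2 w + \<i> * d_zbar (comp_z f b2) w) w"
        by (rule has_wirtinger_transform[OF _ W1(1) w]) (simp add: eq)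
      then have "d_zbar (comp_z f b1) w = \<i> * d_zbar (comp_z f b2) w"
        using has_wirtinger_imp(2) by fastforce
      then have "- (complex_of_real (a w) * comp_z f e w) * (cnj (comp_z f b1 w) - \<i> * cnj (comp_z f b2 w)) = 0"
        unfolding pde[OF wT] pde_rhs_def eq[OF w] using o1 by (simp add: algebra_simps)
      then have "cnj (comp_z f b1 w) = \<i> * cnj (comp_z f b2 w)"
        using a[OF wT] w by (simp add: W1_def)
      then have "comp_z f b1 w = - (\<i> * comp_z f b2 w)"
        by (metis complex_cnj_cnj complex_cnj_i complex_cnj_mult mult_minus_left)
      then show ?thesis using eq[OF w] by simp
    qed
    then show False using nz[OF W1(1,2) _ o1(1)] W1(3) W(3) by blast
  qed
  then obtain c r where B: "0 < r" "ball c r \<subseteq> W2"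
    using open_contains_ball_nonempty[OF W2(1)] by blast
  have BT: "w \<in> T" "comp_z f e w \<noteq> 0" if "w \<in> ball c r" for w
    using that B(2) W(3) W1(3) W2(2) unfolding W1_def by blast+
  have N: "normal_part f w e = 0" if "w \<in> ball c r" for w
  proof -
    have "w \<in> W2" "w \<in> W1" "w \<in> W" using that B(2) W2(2) W1(3) by blast+
    then show ?thesis using W(3,4) by (auto simp: R W2_def W1_def)
  qed
  have zero: "pde_rhs x (first_form f w 1 1 / 2) (comp_z f e w) (e \<bullet> v) (comp_z f v w) = 0"
    if "w \<in> ball c r" for w v x
    using T(3) BT(1)[OF that]
    by (subst pde_rhs_normal_part[OF d[OF BT(1)[OF that]]]) (auto simp: conformal_on_def N[OF that])
  have q: "\<exists>t. \<forall>w\<in>ball c r. comp_z f v w = \<i> * of_real t * comp_z f e w" if v: "e \<bullet> v = 0" for v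
  proof -
    have imag: "comp_z f e w * cnj (comp_z f v w) + cnj (comp_z f e w) * comp_z f v w = 0"
      if "w \<in> ball c r" for w
    proof -
      have "comp_z f e w * cnj (comp_z f v w) + cnj (comp_z f e w) * comp_z f v w
          = - pde_rhs 1 (first_form f w 1 1 / 2) (comp_z f e w) (e \<bullet> v) (comp_z f v w)"
        by (simp add: pde_rhs_def v)
      then show ?thesis by (simp add: zero[OF that])
    qed
    have "\<exists>s. \<forall>w\<in>ball c r. comp_z f v w / comp_z f e w = s"
    proof (rule imaginary_holomorphic_constant)
      fix w assume w: "w \<in> ball c r"
      \<comment> \<open>Tangency of \<open>e\<close> kills the right-hand side for all directions,
        so numerator and denominator of the quotient are both holomorphic.\<close>
      have dz: "d_zbar (comp_z f u) w = 0" for u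
        unfolding pde[OF BT(1)[OF w]] by (rule zero[OF w])
      note h = has_wirtinger_works[OF smooth_on_differentiable[OF smooth_on_comp_z[OF T(1,2)] BT(1)[OF w]]]
      note hq = has_wirtinger_divide[OF h[of v] h[of e] BT(2)[OF w]]
      show "(\<lambda>w. comp_z f v w / comp_z f e w) differentiable (at w)"
        using has_wirtinger_imp(3)[OF hq] .
      show "d_zbar (\<lambda>w. comp_z f v w / comp_z f e w) w = 0"
        using has_wirtinger_imp(2)[OF hq] by (simp add: dz)
      have "comp_z f e w * cnj (comp_z f v w) + cnj (comp_z f e w) * comp_z f v w = 0"
        by (rule imag[OF w])
      then have "Re (comp_z f v w * cnj (comp_z f e w)) = 0"
        by (simp add: complex_eq_iff algebra_simps)
      then show "Re (comp_z f v w / comp_z f e w) = 0"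
        by (simp add: Re_divide algebra_simps)
    qed
    then obtain s where s: "\<And>w. w \<in> ball c r \<Longrightarrow> comp_z f v w = s * comp_z f e w"
      using BT(2) by (metis nonzero_divide_eq_eq)
    have "comp_z f e c * cnj (comp_z f v c) + cnj (comp_z f e c) * comp_z f v c = 0"
      by (rule imag) (simp add: B(1))
    then have "(cnj s + s) * (comp_z f e c * cnj (comp_z f e c)) = 0"
      using s[of c] B(1) by (simp add: algebra_simps)
    then have "cnj s + s = 0" using BT(2)[of c] B(1) by simp
    then have "s = \<i> * of_real (Im s)" by (simp add: complex_eq_iff)
    then show ?thesis using s by metis
  qed
  obtain s t where s: "\<And>w. w \<in> ball c r \<Longrightarrow> comp_z f b1 w = \<i> * of_real s * comp_z f e w"
    and t: "\<And>w. w \<in> ball c r \<Longrightarrow> comp_z f b2 w = \<i> * of_real t * comp_z f e w"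
    using q[OF o1(4)] q[OF o1(5)] by metis
  have BTs: "ball c r \<subseteq> T" "ball c r \<noteq> {}" using BT B by auto
  have "s \<noteq> 0" using nz[OF open_ball BTs(2,1) o1(1)] s by auto
  \<comment> \<open>The combination for which the constants cancel,
    \<open>t (\<i> s) - s (\<i> t) = 0\<close>. Its height would be constant on the ball, yet
    \<open>v\<close> is nonzero because \<open>s\<close> is.\<close>
  define v where "v = t *\<^sub>R b1 - s *\<^sub>R b2"
  have "v \<bullet> b2 \<noteq> 0" using \<open>s \<noteq> 0\<close> o1 by (simp add: v_def inner_diff_left)
  then have "v \<noteq> 0" by auto
  then obtain w where "w \<in> ball c r" "comp_z f v w \<noteq> 0"
    using nz[OF open_ball BTs(2,1)] by blast
  then show False
    using comp_z_diff_scale[OF d[OF BT(1)], of w t b1 s b2] s t by (simp add: v_def)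
qed

section \<open>From the surface to the Gauss map\<close>

lemma comp_z_has_derivative:
  fixes f :: "complex \<Rightarrow> 'e::euclidean_space"
  assumes "f differentiable (at w)"
  shows "((\<lambda>x. f x \<bullet> v) has_derivative (\<lambda>d. 2 * Re (comp_z f v w * d))) (at w)"
  unfolding has_wirtinger_of_real comp_z_def
  by (rule has_wirtinger_of_real_works(1)[OF differentiable_inner_const[OF assms]])

lemma Re_integral_comp_z:
  fixes f :: "complex \<Rightarrow> 'e::euclidean_space"
  assumes "\<And>w. w \<in> \<Omega> \<Longrightarrow> f differentiable (at w)" "\<And>w. w \<in> \<Omega> \<Longrightarrow> comp_z f v w = \<psi> w"
  shows "Re_integral \<Omega> \<psi> (\<lambda>w. f w \<bullet> v)"
  unfolding Re_integral_iff using comp_z_has_derivative[OF assms(1)] assms(2) by metis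

lemma has_derivative_ln_scaled:
  fixes h :: "'a::real_normed_vector \<Rightarrow> real"
  assumes "(h has_derivative D) (at w)" "h w > 0" "C > 0"
  shows "((\<lambda>x. c * ln (h x / C)) has_derivative (\<lambda>d. c * (D d / h w))) (at w)"
  using assms by (auto intro!: derivative_eq_intros simp: fun_eq_iff)

text \<open>All components of the equation's right-hand side vanish, which by
  \<open>pde_rhs_normal_part\<close> means that \<open>e\<close> is tangent. Beyond
  \<open>F = 0\<close> the reason is the relation \<open>G\<^sub>p conj Q = conj G\<^sub>p\<close>
  of \<open>F_map_zero_imp\<close>. Hence \<open>F(G)\<close> is nonzero at regular points.\<close>

lemma F_map_zero_imp_tangent:
  fixes G :: "complex^'p"
  assumes F: "F_map k G = 0" and g: "G $ k \<noteq> 0"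
  shows "pde_rhs (1 / (2 * h)) (2 * (cmod m)\<^sup>2 * S_map G) (2 * (m * G $ k)) 0 (m * (1 - bil G G)) = 0"
    "pde_rhs (1 / (2 * h)) (2 * (cmod m)\<^sup>2 * S_map G) (2 * (m * G $ k)) 0 (m * (\<i> * (1 + bil G G))) = 0"
    "pde_rhs (1 / (2 * h)) (2 * (cmod m)\<^sup>2 * S_map G) (2 * (m * G $ k)) (if i = k then 1 else 0) (m * (2 * G $ i)) = 0"
proof -
  note t = F_map_zero_imp[OF F g]
  have t': "bil G G * cnj (G $ k) = G $ k" using arg_cong[OF t, of cnj] by (simp add: mult.commute)
  show "pde_rhs (1 / (2 * h)) (2 * (cmod m)\<^sup>2 * S_map G) (2 * (m * G $ k)) 0 (m * (1 - bil G G)) = 0"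
    "pde_rhs (1 / (2 * h)) (2 * (cmod m)\<^sup>2 * S_map G) (2 * (m * G $ k)) 0 (m * (\<i> * (1 + bil G G))) = 0"
    unfolding pde_rhs_null by (simp_all add: algebra_simps t t')
  have "of_real (S_map G * (if i = k then 1 else 0)) - G $ k * cnj (2 * G $ i) - cnj (G $ k) * (2 * G $ i)
      = 2 * F_map k G $ i + 2 * (G $ k * cnj (bil G G) - cnj (G $ k)) * G $ i"
    unfolding F_map_nth by (simp add: algebra_simps)
  then show "pde_rhs (1 / (2 * h)) (2 * (cmod m)\<^sup>2 * S_map G) (2 * (m * G $ k)) (if i = k then 1 else 0) (m * (2 * G $ i)) = 0"
    unfolding pde_rhs_null by (simp add: F t)
qed

text \<open>All primitives are at hand: the coordinates of \<open>f\<close> are their own integrals,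
  and \<open>q\<close> is a rescaled logarithm of the height. The work lies in reading
  \<open>G\<close> and \<open>\<omega>\<close> off \<open>f\<^sub>z\<close> and in translating the
  surface equation into equations for them.\<close>

lemma singular_minimal_representation:
  fixes f :: "complex \<Rightarrow> 'e::euclidean_space" and b :: "'p::finite \<Rightarrow> 'e"
  assumes n: "n \<ge> 3" and o: "orthonormal_basis b1 b2 b" and e: "b k = e"
    and T: "open T" "smooth_on T f" "conformal_on T f"
    and smin: "singular_minimal_on (real n - 2) e T f"
  defines "\<Omega> \<equiv> regular_points b1 b2 e T f"
  shows "\<exists>G :: complex \<Rightarrow> complex^'p. (\<forall>w\<in>\<Omega>. D_zbar G w \<noteq> 0) \<and> solution_on n k \<Omega> G \<and>
      represented_on n k b1 b2 b \<Omega> G f"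
    and "open \<Omega>"
    and "(\<And>W. open W \<Longrightarrow> W \<noteq> {} \<Longrightarrow> W \<subseteq> T \<Longrightarrow> affine hull (f ` W) = UNIV) \<Longrightarrow> T \<subseteq> closure \<Omega>"
proof -
  define P where "P v = comp_z f v" for v
  define h where "h w = (f w \<bullet> e) / (real n - 2)" for w
  \<comment> \<open>This is the factor \<open>m\<close> of the null vector, since
    \<open>(1 - Q) - \<i> (\<i> (1 + Q)) = 2\<close>. The definition of \<open>G\<close> then
    divides the remaining components by \<open>2 m\<close>.\<close>
  define \<mu> where "\<mu> w = (P b1 w - \<i> * P b2 w) / 2" for w
  define G where "G w = (\<chi> i. P (b i) w / (2 * \<mu> w))" for w
  define \<omega> where "\<omega> w = \<mu> w / of_real (h w)" for w
  have n2: "real n - 2 > 0" using n by simp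
  have oe: "b1 \<bullet> e = 0" "b2 \<bullet> e = 0" "e \<bullet> b1 = 0" "e \<bullet> b2 = 0" "\<And>i. e \<bullet> b i = (if i = k then 1 else 0)"
    using o e unfolding orthonormal_basis_def by (auto simp: inner_commute)
  have sm: "\<And>w. w \<in> T \<Longrightarrow> f w \<bullet> e > 0"
    using smin by (simp add: singular_minimal_on_def)
  have h: "h w > 0" "f w \<bullet> e = (real n - 2) * h w" if "w \<in> T" for w
    using sm[OF that] n2 by (simp_all add: h_def)
  note d = smooth_on_differentiable[OF T(2)]
  have sP: "smooth_on T (P v)" for v
    unfolding P_def by (rule smooth_on_comp_z[OF T(1,2)])
  have pde: "d_zbar (P v) w
      = pde_rhs (1 / (2 * h w)) (first_form f w 1 1 / 2) (P e w) (e \<bullet> v) (P v w)" if w: "w \<in> T" for w v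
  proof -
    have "laplacian f w = ((real n - 2) / (f w \<bullet> e)) *\<^sub>R (first_form f w 1 1 *\<^sub>R e
      - (e \<bullet> dir_deriv 1 f w) *\<^sub>R dir_deriv 1 f w - (e \<bullet> dir_deriv \<i> f w) *\<^sub>R dir_deriv \<i> f w)"
      using smin w unfolding singular_minimal_on_conformal_iff[OF T] by blast
    then have "d_zbar (P v) w
      = pde_rhs ((real n - 2) / (2 * (f w \<bullet> e))) (first_form f w 1 1 / 2) (P e w) (e \<bullet> v) (P v w)"
      unfolding P_def laplacian_component_iff[OF T(1,2) w, symmetric] by simp
    moreover have "(real n - 2) / (2 * (f w \<bullet> e)) = 1 / (2 * h w)"
      unfolding h(2)[OF w] using n2 by simp
    ultimately show ?thesis by simp
  qed
  have \<Omega>_eq: "\<Omega> = {w \<in> T. 2 * \<mu> w \<noteq> 0} \<inter> {w \<in> T. P e w \<noteq> 0} \<inter> {w \<in> T. normal_part f w e \<noteq> 0}"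
    by (auto simp: \<Omega>_def regular_points_def P_def comp_z_def \<mu>_def)
  have s\<mu>: "smooth_on T \<mu>"
    unfolding \<mu>_def by (intro smooth_on_divide smooth_on_diff smooth_on_mult smooth_on_const sP T) simp
  show op: "open \<Omega>"
    unfolding \<Omega>_eq
    by (intro open_Int open_nonzero T(1) continuous_on_normal_part T continuous_on_mult_left
        smooth_on_continuous_on[OF s\<mu>] smooth_on_continuous_on[OF sP])
  have sub: "\<Omega> \<subseteq> T" unfolding \<Omega>_eq by blast
  have \<mu>: "\<mu> w \<noteq> 0" "P e w \<noteq> 0" "normal_part f w e \<noteq> 0" if "w \<in> \<Omega>" for w
    using that by (auto simp: \<Omega>_eq)
  show "T \<subseteq> closure \<Omega>"
    if full: "\<And>W. open W \<Longrightarrow> W \<noteq> {} \<Longrightarrow> W \<subseteq> T \<Longrightarrow> affine hull (f ` W) = UNIV"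
    unfolding \<Omega>_def
  proof (rule regular_points_dense[OF o e T _ _ full])
    show "d_zbar (comp_z f v) w = pde_rhs (1 / (2 * h w)) (first_form f w 1 1 / 2) (comp_z f e w) (e \<bullet> v) (comp_z f v w)"
      if "w \<in> T" for w v using pde[OF that] unfolding P_def .
    show "1 / (2 * h w) \<noteq> 0" if "w \<in> T" for w using h(1)[OF that] by simp
  qed
  have Pi: "P (b i) w = \<mu> w * (2 * G w $ i)" if "w \<in> \<Omega>" for i w
    using \<mu>(1)[OF that] by (simp add: G_def)
  have sums: "(P b1 w)\<^sup>2 + (P b2 w)\<^sup>2 + (\<Sum>i\<in>UNIV. (P (b i) w)\<^sup>2) = 0"
    "(cmod (P b1 w))\<^sup>2 + (cmod (P b2 w))\<^sup>2 + (\<Sum>i\<in>UNIV. (cmod (P (b i) w))\<^sup>2) = first_form f w 1 1 / 2"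
    if "w \<in> T" for w
    using T(3) that unfolding P_def comp_z_square_sums[OF o d[OF that]]
    by (auto simp: conformal_on_def complex_eq_iff)
  have P12: "P b1 w = \<mu> w * (1 - bil (G w) (G w))" "P b2 w = \<mu> w * (\<i> * (1 + bil (G w) (G w)))"
    if w: "w \<in> \<Omega>" for w
  proof -
    let ?Q = "bil (G w) (G w)"
    have "(\<Sum>i\<in>UNIV. (P (b i) w)\<^sup>2) = 4 * (\<mu> w)\<^sup>2 * ?Q"
      unfolding Pi[OF w] bil_def by (simp add: sum_distrib_left power2_eq_square algebra_simps)
    \<comment> \<open>The null condition factors as
      \<open>(P1 - \<i> P2) (P1 + \<i> P2) = - 4 m^2 Q\<close>. The first factor is
      \<open>2 m\<close>, so the second one is determined, and both components follow.\<close>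
    moreover have "(P b1 w)\<^sup>2 + (P b2 w)\<^sup>2 = (2 * \<mu> w) * (P b1 w + \<i> * P b2 w)"
      by (simp add: \<mu>_def power2_eq_square algebra_simps)
    ultimately have "(2 * \<mu> w) * (P b1 w + \<i> * P b2 w + 2 * \<mu> w * ?Q) = 0"
      using sums(1)[of w] w sub by (auto simp: power2_eq_square algebra_simps)
    then have A: "P b1 w + \<i> * P b2 w = - 2 * \<mu> w * ?Q"
      using \<mu>(1)[OF w] by (simp add: eq_neg_iff_add_eq_0)
    have B: "P b1 w - \<i> * P b2 w = 2 * \<mu> w" by (simp add: \<mu>_def)
    have E: "2 * P b1 w = (P b1 w + \<i> * P b2 w) + (P b1 w - \<i> * P b2 w)"
      "2 * P b2 w = \<i> * ((P b1 w - \<i> * P b2 w) - (P b1 w + \<i> * P b2 w))"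
      by (simp_all add: algebra_simps)
    have "2 * P b1 w = 2 * (\<mu> w * (1 - ?Q))"
      by (rule trans[OF E(1)[unfolded A B]]) (simp add: algebra_simps)
    moreover have "2 * P b2 w = 2 * (\<mu> w * (\<i> * (1 + ?Q)))"
      by (rule trans[OF E(2)[unfolded A B]]) (simp add: algebra_simps)
    ultimately show "P b1 w = \<mu> w * (1 - ?Q)" "P b2 w = \<mu> w * (\<i> * (1 + ?Q))"
      by simp_all
  qed
  have rho: "first_form f w 1 1 / 2 = 2 * (cmod (\<mu> w))\<^sup>2 * S_map (G w)" if w: "w \<in> \<Omega>" for w
  proof -
    have "w \<in> T" using w sub by blast
    have "2 * (cmod (\<mu> w))\<^sup>2 * S_map (G w) = first_form f w 1 1 / 2"
      unfolding sums(2)[OF \<open>w \<in> T\<close>, symmetric] P12[OF w] Pi[OF w] null_vector_square_sums(2)[symmetric]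
      by (simp add: mult_ac)
    then show ?thesis by simp
  qed
  have Pe: "P e w = 2 * (\<mu> w * G w $ k)" if "w \<in> \<Omega>" for w
    using Pi[OF that, of k] e by simp
  have pde': "d_zbar (P v) w = pde_rhs (1 / (2 * h w)) (2 * (cmod (\<mu> w))\<^sup>2 * S_map (G w))
      (2 * (\<mu> w * G w $ k)) (e \<bullet> v) (P v w)" if "w \<in> \<Omega>" for w v
    using pde[of w v] that sub unfolding rho[OF that] Pe[OF that] by blast
  have sG: "smooth_on \<Omega> G"
    unfolding G_def using \<mu>(1)
    by (intro smooth_on_vec_lambda op smooth_on_divide smooth_on_mult smooth_on_const
        smooth_on_subset[OF sP sub] smooth_on_subset[OF s\<mu> sub]) auto
  have g: "G w $ k \<noteq> 0" if "w \<in> \<Omega>" for w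
    using \<mu>(2)[OF that] Pe[OF that] by auto
  have F: "F_map k (G w) \<noteq> 0" if w: "w \<in> \<Omega>" for w
  proof
    assume F0: "F_map k (G w) = 0"
    have wT: "w \<in> T" using w sub by blast
    have cw: "conformal_on {w} f" using T(3) wT by (simp add: conformal_on_def)
    have N0: "normal_part f w e \<bullet> v = 0" if v: "pde_rhs (1 / (2 * h w)) (2 * (cmod (\<mu> w))\<^sup>2 * S_map (G w))
      (2 * (\<mu> w * G w $ k)) (e \<bullet> v) (P v w) = 0" for v
    proof -
      have "complex_of_real (1 / (2 * h w) * (first_form f w 1 1 / 2) * (normal_part f w e \<bullet> v)) = 0"
        using v unfolding pde_rhs_normal_part[OF d[OF wT] cw, symmetric] rho[OF w, symmetric] Pe[OF w, symmetric] P_def .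
      then show ?thesis using h(1)[OF wT] cw by (simp add: conformal_on_def)
    qed
    have "normal_part f w e \<bullet> b1 = 0" "normal_part f w e \<bullet> b2 = 0" "normal_part f w e \<bullet> b i = 0" for i
      by (rule N0, simp only: P12[OF w] Pi[OF w] oe F_map_zero_imp_tangent[OF F0 g[OF w]])+
    then have "normal_part f w e = 0"
      by (intro orthonormal_basis_eqI[OF o]) simp_all
    then show False using \<mu>(3)[OF w] by simp
  qed
  have eqs: "d_zbar \<mu> w = of_real ((cmod (\<mu> w))\<^sup>2 / h w) * (G w $ k * cnj (bil (G w) (G w)) - cnj (G w $ k))"
    "D_zbar G w = cnj (\<omega> w) *s F_map k (G w)" if w: "w \<in> \<Omega>" for w
  proof -
    have wT: "w \<in> T" using w sub by blast
    have dP: "has_wirtinger (P v) (d_z (P v) w) (d_zbar (P v) w) w" for v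
      using has_wirtinger_works smooth_on_differentiable[OF sP wT] by blast
    have d\<mu>: "has_wirtinger \<mu> (d_z \<mu> w) (d_zbar \<mu> w) w"
      using has_wirtinger_works smooth_on_differentiable[OF s\<mu> wT] by blast
    have "has_wirtinger (\<lambda>w. 1/2 * (P b1 w - \<i> * P b2 w))
        (0 * (P b1 w - \<i> * P b2 w) + 1/2 * (d_z (P b1) w - (0 * P b2 w + \<i> * d_z (P b2) w)))
        (0 * (P b1 w - \<i> * P b2 w) + 1/2 * (d_zbar (P b1) w - (0 * P b2 w + \<i> * d_zbar (P b2) w))) w"
      by (intro has_wirtinger_mult has_wirtinger_diff has_wirtinger_const dP)
    moreover have "\<mu> = (\<lambda>w. 1/2 * (P b1 w - \<i> * P b2 w))" by (simp add: \<mu>_def fun_eq_iff)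
    ultimately have M: "2 * d_zbar \<mu> w = d_zbar (P b1) w - \<i> * d_zbar (P b2) w"
      using has_wirtinger_imp(2) by fastforce
    have V: "2 * (d_zbar \<mu> w * G w $ i + \<mu> w * D_zbar G w $ i) = d_zbar (P (b i)) w" for i
    proof -
      have "has_wirtinger (\<lambda>w. 2 * (\<mu> w * G w $ i))
        (0 * (\<mu> w * G w $ i) + 2 * (d_z \<mu> w * G w $ i + \<mu> w * D_z G w $ i))
        (0 * (\<mu> w * G w $ i) + 2 * (d_zbar \<mu> w * G w $ i + \<mu> w * D_zbar G w $ i)) w"
        by (intro has_wirtinger_mult has_wirtinger_const d\<mu> has_wirtinger_vec_nth
            smooth_on_differentiable[OF sG w])
      then have "has_wirtinger (P (b i))
        (0 * (\<mu> w * G w $ i) + 2 * (d_z \<mu> w * G w $ i + \<mu> w * D_z G w $ i))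
        (0 * (\<mu> w * G w $ i) + 2 * (d_zbar \<mu> w * G w $ i + \<mu> w * D_zbar G w $ i)) w"
        by (rule has_wirtinger_transform[OF _ op w]) (simp add: Pi)
      then show ?thesis using has_wirtinger_imp(2) by fastforce
    qed
    let ?rhs = "pde_rhs (1 / (2 * h w)) (2 * (cmod (\<mu> w))\<^sup>2 * S_map (G w)) (2 * (\<mu> w * G w $ k))"
    have M': "2 * d_zbar \<mu> w = ?rhs 0 (\<mu> w * (1 - bil (G w) (G w)))
        - \<i> * ?rhs 0 (\<mu> w * (\<i> * (1 + bil (G w) (G w))))"
      by (simp only: M pde'[OF w] oe P12[OF w])
    have V': "2 * (d_zbar \<mu> w * G w $ i + \<mu> w * D_zbar G w $ i)
        = ?rhs (if i = k then 1 else 0) (\<mu> w * (2 * G w $ i))" for i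
      by (simp only: V pde'[OF w] oe Pi[OF w])
    show "d_zbar \<mu> w = of_real ((cmod (\<mu> w))\<^sup>2 / h w) * (G w $ k * cnj (bil (G w) (G w)) - cnj (G w $ k))"
      by (rule gauss_map_equations(1)[OF h(1)[OF wT] \<mu>(1)[OF w] M' V'])
    show "D_zbar G w = cnj (\<omega> w) *s F_map k (G w)"
      unfolding \<omega>_def by (rule gauss_map_equations(2)[OF h(1)[OF wT] \<mu>(1)[OF w] M' V'])
  qed
  have \<omega>0: "\<omega> w \<noteq> 0" if "w \<in> \<Omega>" for w
    using \<mu>(1)[OF that] h(1)[of w] sub that by (auto simp: \<omega>_def)
  have dh: "(h has_derivative (\<lambda>d. 2 * Re (P e w / (of_nat n - 2) * d))) (at w)" if "w \<in> T" for w
  proof -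
    have "((\<lambda>x. (f x \<bullet> e) / (real n - 2)) has_derivative (\<lambda>d. 2 * Re (P e w * d) / (real n - 2))) (at w)"
      using bounded_linear.has_derivative[OF bounded_linear_divide comp_z_has_derivative[OF d[OF that]]]
      unfolding P_def .
    moreover have "2 * Re (P e w * d) / (real n - 2) = 2 * Re (P e w / (of_nat n - 2) * d)" for d
    proof -
      have "P e w / (of_nat n - 2) * d = P e w * d / of_real (real n - 2)" by simp
      then show ?thesis by (simp add: Re_divide_of_real)
    qed
    ultimately show ?thesis unfolding h_def by simp
  qed
  have sh: "smooth_on T (\<lambda>w. complex_of_real (h w))"
    unfolding h_def using n2
    by (intro smooth_on_of_real smooth_on_divide smooth_on_inner_const smooth_on_const T) auto
  have s\<omega>: "smooth_on \<Omega> \<omega>"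
    unfolding \<omega>_def using h(1) sub
    by (intro smooth_on_divide smooth_on_subset[OF s\<mu> sub] smooth_on_subset[OF sh sub] op) force
  have d\<omega>: "d_zbar \<omega> w = of_real ((cmod (\<omega> w))\<^sup>2) *
    (cnj (bil (G w) (G w)) * G w $ k - of_nat n / (of_nat n - 2) * cnj (G w $ k))" if w: "w \<in> \<Omega>" for w
  proof -
    have wT: "w \<in> T" using w sub by blast
    have h0: "complex_of_real (h w) \<noteq> 0" using h(1)[OF wT] by simp
    have nn: "complex_of_nat n - 2 \<noteq> 0"
      using n2 by (metis of_nat_numeral of_real_eq_0_iff of_real_diff of_real_numeral of_real_of_nat_eq order_less_irrefl)
    let ?a = "P e w / (of_nat n - 2)"
    have A: "has_wirtinger (\<lambda>x. of_real (h x)) ?a (cnj ?a) w"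
      using dh[OF wT] unfolding has_wirtinger_of_real .
    have B: "has_wirtinger \<mu> (d_z \<mu> w) (d_zbar \<mu> w) w"
      using has_wirtinger_works smooth_on_differentiable[OF s\<mu> wT] by blast
    have "d_zbar \<omega> w = (d_zbar \<mu> w * of_real (h w) - \<mu> w * cnj ?a) / (of_real (h w))\<^sup>2"
      unfolding \<omega>_def by (rule has_wirtinger_imp(2)[OF has_wirtinger_divide[OF B A h0]])
    also have "\<dots> = (\<mu> w * cnj (\<mu> w) / of_real (h w) * (G w $ k * cnj (bil (G w) (G w)) - cnj (G w $ k)) * of_real (h w)
        - \<mu> w * (2 * (cnj (\<mu> w) * cnj (G w $ k)) / (of_nat n - 2))) / (of_real (h w))\<^sup>2"
      unfolding eqs(1)[OF w] Pe[OF w] of_real_divide complex_norm_square by simp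
    also have "\<dots> = \<mu> w * cnj (\<mu> w) / (of_real (h w))\<^sup>2 *
        (G w $ k * cnj (bil (G w) (G w)) - of_nat n / (of_nat n - 2) * cnj (G w $ k))"
    proof -
      have "(u * v / t * (x - y) * t - u * (2 * (v * y) / (N - 2))) / t\<^sup>2 = u * v / t\<^sup>2 * (x - N / (N - 2) * y)"
        if "t \<noteq> 0" "N - 2 \<noteq> 0" for u v t x y N :: complex
      proof -
        \<comment> \<open>Splitting \<open>N / (N - 2)\<close> as \<open>1 + K\<close> separates the
          term of the equation for \<open>m\<close> from the term that the quotient rule takes from
          the derivative of \<open>h\<close>.\<close>
        define K where "K = 2 / (N - 2)"
        have K: "N / (N - 2) = 1 + K" "2 * (v * y) / (N - 2) = K * (v * y)"
          using that(2) by (simp_all add: K_def field_simps)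
        show ?thesis unfolding K using that(1)
          by (simp add: algebra_simps diff_divide_distrib add_divide_distrib)
      qed
      from this[OF h0 nn] show ?thesis .
    qed
    also have "\<mu> w * cnj (\<mu> w) / (of_real (h w))\<^sup>2 = complex_of_real ((cmod (\<omega> w))\<^sup>2)"
      unfolding complex_norm_square \<omega>_def by (simp add: power2_eq_square)
    finally show ?thesis by (simp only: mult.commute[of "G w $ k"])
  qed
  have sol: "solution_on n k \<Omega> G"
    unfolding solution_on_def
    using sG g F eq2I[OF eqs(2)] eq1_iff[OF op sG _ smooth_on_differentiable[OF s\<omega>] eqs(2) F] d\<omega> by blast
  have wt: "weight k G w = \<omega> w" if "w \<in> \<Omega>" for w
    using weight_eqI[OF smooth_on_differentiable[OF sG that] eqs(2)[OF that] F[OF that]] .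
  have wh: "weight k G w * of_real (h w) = \<mu> w" if "w \<in> \<Omega>" for w
    using h(1)[of w] that sub unfolding wt[OF that] by (auto simp: \<omega>_def)
  define C where "C = 1 / (real n - 2) * (real n / 2) powr (2 / real n)"
  have C: "C > 0" using n2 n by (simp add: C_def)
  \<comment> \<open>Obtained by solving \<open>h = C exp (2 q / (n - 2))\<close> for
    \<open>q\<close>; its z-derivative is \<open>(n - 2) h\<^sub>z / (2 h)\<close>, which is
    \<open>\<omega> G\<^sub>p\<close>.\<close>
  define q where "q w = (real n - 2) / 2 * ln (h w / C)" for w
  define h' where "h' w = C * exp (2 / (real n - 2) * q w)" for w
  have hh: "h' w = h w" if "w \<in> T" for w
    using h(1)[OF that] C n2 by (simp add: h'_def q_def)
  have Rq: "Re_integral \<Omega> (\<lambda>w. weight k G w * (G w $ k)) q"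
    unfolding Re_integral_iff
  proof
    fix w assume w: "w \<in> \<Omega>"
    have wT: "w \<in> T" using w sub by blast
    have "(q has_derivative (\<lambda>d. (real n - 2) / 2 * (2 * Re (P e w / (of_nat n - 2) * d) / h w))) (at w)"
      unfolding q_def by (rule has_derivative_ln_scaled[OF dh[OF wT] h(1)[OF wT] C])
    moreover have "(real n - 2) / 2 * (2 * Re (P e w / (of_nat n - 2) * d) / h w) = 2 * Re (weight k G w * (G w $ k) * d)" for d
    proof -
      have "P e w / (of_nat n - 2) * d = (2 / (real n - 2)) *\<^sub>R (\<mu> w * G w $ k * d)"
        by (simp add: Pe[OF w] scaleR_conv_of_real)
      then have "Re (P e w / (of_nat n - 2) * d) = 2 / (real n - 2) * Re (\<mu> w * G w $ k * d)"
        by (simp only: scaleR_complex.simps(1))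
      moreover have "weight k G w * (G w $ k) * d = (\<mu> w * G w $ k * d) / of_real (h w)"
        unfolding wt[OF w] by (simp add: \<omega>_def)
      then have "Re (weight k G w * (G w $ k) * d) = Re (\<mu> w * G w $ k * d) / h w"
        by (simp only: Re_divide_of_real)
      ultimately have "(real n - 2) / 2 * (2 * Re (P e w / (of_nat n - 2) * d) / h w)
          = (real n - 2) / 2 * (2 * (2 / (real n - 2) * Re (\<mu> w * G w $ k * d)) / h w)"
        "2 * Re (weight k G w * (G w $ k) * d) = 2 * (Re (\<mu> w * G w $ k * d) / h w)"
        by (simp_all only:)
      then show ?thesis using n2 by (simp del: times_complex.sel)
    qed
    ultimately show "(q has_derivative (\<lambda>v. 2 * Re (weight k G w * (G w $ k) * v))) (at w)" by simp
  qed
  have rep: "represented_on n k b1 b2 b \<Omega> G f"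
    unfolding represented_on_def
  proof (intro exI conjI allI impI ballI)
    show "Re_integral \<Omega> (\<lambda>w. weight k G w * (G w $ k)) q" by (rule Rq)
    show "h' = (\<lambda>w. 1 / (real n - 2) * (real n / 2) powr (2 / real n) * exp (2 / (real n - 2) * q w))"
      by (simp add: h'_def C_def fun_eq_iff)
    have x: "weight k G w * c * of_real (h' w) = \<mu> w * c" if "w \<in> \<Omega>" for w c
      unfolding wh[OF that, symmetric] using hh[of w] that sub by auto
    show "Re_integral \<Omega> (\<lambda>w. weight k G w * (1 - bil (G w) (G w)) * of_real (h' w)) (\<lambda>w. f w \<bullet> b1)"
      using sub by (intro Re_integral_comp_z d) (auto simp: x P12[unfolded P_def])
    show "Re_integral \<Omega> (\<lambda>w. \<i> * (weight k G w * (1 + bil (G w) (G w)) * of_real (h' w))) (\<lambda>w. f w \<bullet> b2)"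
      using sub by (intro Re_integral_comp_z d) (auto simp: x P12[unfolded P_def])
    show "Re_integral \<Omega> (\<lambda>w. 2 * (weight k G w * (G w $ i) * of_real (h' w))) (\<lambda>w. f w \<bullet> b i)" for i
      using sub by (intro Re_integral_comp_z d) (auto simp: x Pi[unfolded P_def])
    show "f w \<bullet> b k = (real n - 2) * h' w" if "w \<in> \<Omega>" for w
      using h(2)[of w] hh[of w] that sub e by auto
  qed
  have "D_zbar G w \<noteq> 0" if "w \<in> \<Omega>" for w
    using eqs(2)[OF that] F[OF that] \<omega>0[OF that] by (auto simp: vec_eq_iff)
  then show "\<exists>G :: complex \<Rightarrow> complex^'p. (\<forall>w\<in>\<Omega>. D_zbar G w \<noteq> 0) \<and> solution_on n k \<Omega> G \<and>
      represented_on n k b1 b2 b \<Omega> G f"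
    using sol rep by blast
qed

section \<open>From the Gauss map to the surface\<close>

text \<open>The converse of \<open>gauss_map_equations\<close>. For the first two components the
  derivative of \<open>Q\<close> is needed, and \<open>bil_F_map\<close> supplies it as
  \<open>m\<close> times the conjugate derivative of \<open>Q\<close> equals
  \<open>c G\<^sub>p (1 - |Q|^2)\<close>.\<close>

lemma has_wirtinger_null_curve:
  fixes G :: "complex \<Rightarrow> complex^'p" and m :: "complex \<Rightarrow> complex" and h :: "complex \<Rightarrow> real"
  defines "c \<equiv> \<lambda>w. of_real ((cmod (m w))\<^sup>2 / h w)" and "Q \<equiv> \<lambda>w. bil (G w) (G w)"
  assumes m: "has_wirtinger m m' (c w * (G w $ k * cnj (Q w) - cnj (G w $ k))) w"
    and G: "G differentiable (at w)" and V: "m w *s D_zbar G w = c w *s F_map k (G w)"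
  shows "d_zbar (\<lambda>w. m w * (1 - Q w)) w
      = pde_rhs (1 / (2 * h w)) (2 * (cmod (m w))\<^sup>2 * S_map (G w)) (2 * (m w * G w $ k)) 0 (m w * (1 - Q w))"
    "d_zbar (\<lambda>w. m w * (\<i> * (1 + Q w))) w
      = pde_rhs (1 / (2 * h w)) (2 * (cmod (m w))\<^sup>2 * S_map (G w)) (2 * (m w * G w $ k)) 0 (m w * (\<i> * (1 + Q w)))"
    "d_zbar (\<lambda>w. m w * (2 * G w $ i)) w
      = pde_rhs (1 / (2 * h w)) (2 * (cmod (m w))\<^sup>2 * S_map (G w)) (2 * (m w * G w $ k)) (if i = k then 1 else 0)
          (m w * (2 * G w $ i))"
proof -
  let ?M = "c w * (G w $ k * cnj (Q w) - cnj (G w $ k))"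
  let ?F = "F_map k (G w)"
  have cw: "of_real ((cmod (m w))\<^sup>2 / h w) = c w" and Qw: "bil (G w) (G w) = Q w"
    by (simp_all add: c_def Q_def)
  have Vi: "m w * D_zbar G w $ i = c w * ?F $ i" for i
    using arg_cong[OF V, of "\<lambda>x. x $ i"] by simp
  have "m w * (2 * bil (G w) (D_zbar G w)) = 2 * bil (G w) (m w *s D_zbar G w)"
    by (simp add: bil_scale_right)
  also have "\<dots> = c w * (2 * bil (G w) ?F)"
    by (simp add: V bil_scale_right)
  finally have mQ: "m w * (2 * bil (G w) (D_zbar G w)) = c w * (G w $ k * (1 - Q w * cnj (Q w)))"
    by (simp only: bil_F_map Q_def)
  have hQ: "has_wirtinger Q (2 * bil (G w) (D_z G w)) (2 * bil (G w) (D_zbar G w)) w"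
    unfolding Q_def by (rule has_wirtinger_bil_self[OF G])
  have 1: "d_zbar (\<lambda>w. m w * (1 - Q w)) w = ?M * (1 - Q w) + m w * (0 - 2 * bil (G w) (D_zbar G w))"
    by (rule has_wirtinger_imp(2)) (rule has_wirtinger_mult has_wirtinger_diff has_wirtinger_const m hQ)+
  have 2: "d_zbar (\<lambda>w. m w * (\<i> * (1 + Q w))) w
      = ?M * (\<i> * (1 + Q w)) + m w * (0 * (1 + Q w) + \<i> * (0 + 2 * bil (G w) (D_zbar G w)))"
    by (rule has_wirtinger_imp(2)) (rule has_wirtinger_mult has_wirtinger_add has_wirtinger_const m hQ)+
  have 3: "d_zbar (\<lambda>w. m w * (2 * G w $ i)) w
      = ?M * (2 * G w $ i) + m w * (0 * G w $ i + 2 * D_zbar G w $ i)"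
    by (rule has_wirtinger_imp(2)) (rule has_wirtinger_mult has_wirtinger_const m has_wirtinger_vec_nth[OF G])+
  have "?M * (1 - Q w) + m w * (0 - 2 * bil (G w) (D_zbar G w)) = ?M * (1 - Q w) - m w * (2 * bil (G w) (D_zbar G w))"
    by (simp add: algebra_simps)
  then show "d_zbar (\<lambda>w. m w * (1 - Q w)) w
      = pde_rhs (1 / (2 * h w)) (2 * (cmod (m w))\<^sup>2 * S_map (G w)) (2 * (m w * G w $ k)) 0 (m w * (1 - Q w))"
    unfolding 1 mQ pde_rhs_null cw by (simp add: algebra_simps)
  have "?M * (\<i> * (1 + Q w)) + m w * (0 * (1 + Q w) + \<i> * (0 + 2 * bil (G w) (D_zbar G w)))
      = ?M * (\<i> * (1 + Q w)) + \<i> * (m w * (2 * bil (G w) (D_zbar G w)))"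
    by (simp add: algebra_simps)
  then show "d_zbar (\<lambda>w. m w * (\<i> * (1 + Q w))) w
      = pde_rhs (1 / (2 * h w)) (2 * (cmod (m w))\<^sup>2 * S_map (G w)) (2 * (m w * G w $ k)) 0 (m w * (\<i> * (1 + Q w)))"
    unfolding 2 mQ pde_rhs_null cw by (simp add: algebra_simps)
  have "?M * (2 * G w $ i) + m w * (0 * G w $ i + 2 * D_zbar G w $ i)
      = ?M * (2 * G w $ i) + 2 * (m w * D_zbar G w $ i)"
    by (simp add: algebra_simps)
  then show "d_zbar (\<lambda>w. m w * (2 * G w $ i)) w
      = pde_rhs (1 / (2 * h w)) (2 * (cmod (m w))\<^sup>2 * S_map (G w)) (2 * (m w * G w $ k)) (if i = k then 1 else 0)
          (m w * (2 * G w $ i))"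
    unfolding 3 Vi pde_rhs_null cw F_map_nth Qw by (simp add: algebra_simps)
qed

lemma smooth_on_weight:
  fixes G :: "complex \<Rightarrow> complex^'p"
  assumes U: "open U" "smooth_on U G" and F: "\<And>w. w \<in> U \<Longrightarrow> F_map k (G w) \<noteq> 0"
  shows "smooth_on U (weight k G)"
proof -
  have sc: "smooth_on U (\<lambda>w. cnj_vec (X w))" if "smooth_on U X" for X :: "complex \<Rightarrow> complex^'p"
    unfolding cnj_vec_def by (intro smooth_on_vec_lambda smooth_on_cnj smooth_on_vec_nth U that)
  have sD: "smooth_on U (D_zbar G)"
    unfolding D_zbar_def[abs_def] by (intro smooth_on_vec_lambda smooth_on_d_zbar smooth_on_vec_nth U)
  have "smooth_on U (\<lambda>w. bil (cnj_vec (D_zbar G w)) (F_map k (G w)) / bil (F_map k (G w)) (cnj_vec (F_map k (G w))))"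
    using F by (intro smooth_on_divide smooth_on_bil sc sD smooth_on_F_map U) (simp add: bil_cnj_self)
  then show ?thesis
    using weight_altdef[OF smooth_on_differentiable[OF U(2)]]
    by (subst smooth_on_cong[OF U(1)]) (auto simp: bil_cnj_self)
qed

lemma smooth_on_Re_integral:
  assumes "open U" "Re_integral U \<psi> u" "smooth_on U \<psi>"
  shows "smooth_on U u"
proof (rule smooth_onI_dir_deriv[OF assms(1)])
  show "(u has_derivative (\<lambda>v. 2 * Re (\<psi> w * v))) (at w)" if "w \<in> U" for w
    using assms(2) that by (simp add: Re_integral_iff)
  have "smooth_on U (\<lambda>w. 2 * Re (\<psi> w * v))" for v
    by (intro smooth_on_linear[OF bounded_linear_mult_right] smooth_on_linear[OF bounded_linear_Re]
        smooth_on_mult smooth_on_const assms)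
  then show "Ck_on k U (\<lambda>w. 2 * Re (\<psi> w * v))" for v k
    by (simp add: smooth_on_def)
qed

lemma has_derivative_exp_compose:
  fixes q :: "'a::real_normed_vector \<Rightarrow> real"
  assumes "(q has_derivative D) (at w)"
  shows "((\<lambda>x. exp (c * q x)) has_derivative (\<lambda>v. exp (c * q w) * (c * D v))) (at w)"
  using assms by (auto intro!: derivative_eq_intros)

text \<open>Integrability comes in two stages: for the exponent \<open>q\<close> the conjugate
  derivative of the integrand is computed to be real, and once \<open>h\<close> exists the
  integrands of the coordinates satisfy the surface equation, whose right-hand side is real. The
  same equation then yields the mean curvature.\<close>

lemma representation_singular_minimal:
  fixes G :: "complex \<Rightarrow> complex^'p::finite" and b :: "'p \<Rightarrow> 'e::euclidean_space"
  assumes n: "n \<ge> 3" and o: "orthonormal_basis b1 b2 b" and e: "b k = e"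
    and U: "open U" and sol: "solution_on n k U G"
  shows "simply_connected U \<Longrightarrow> \<exists>f :: complex \<Rightarrow> 'e. represented_on n k b1 b2 b U G f"
    and "represented_on n k b1 b2 b U G f \<Longrightarrow>
      singular_minimal_on (real n - 2) e {w \<in> U. D_zbar G w \<noteq> 0} f"
proof -
  define \<omega> where "\<omega> = weight k G"
  define C where "C = 1 / (real n - 2) * (real n / 2) powr (2 / real n)"
  have n2: "real n - 2 > 0" using n by simp
  have C: "C > 0" using n2 n by (simp add: C_def)
  have on: "b1 \<bullet> b1 = 1" "b2 \<bullet> b2 = 1" "b1 \<bullet> b2 = 0" "b2 \<bullet> b1 = 0"
    "\<And>i. b1 \<bullet> b i = 0" "\<And>i. b2 \<bullet> b i = 0" "\<And>i. b i \<bullet> b1 = 0" "\<And>i. b i \<bullet> b2 = 0"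
    "\<And>i j. b i \<bullet> b j = (if i = j then 1 else 0)"
    using o unfolding orthonormal_basis_def by (auto simp: norm_eq_1 inner_commute)
  have sG: "smooth_on U G" and g: "\<And>w. w \<in> U \<Longrightarrow> G w $ k \<noteq> 0" and F: "\<And>w. w \<in> U \<Longrightarrow> F_map k (G w) \<noteq> 0"
    and eq1: "\<And>w. w \<in> U \<Longrightarrow> eq1 n k G w" and eq2: "\<And>w. w \<in> U \<Longrightarrow> eq2 k G w"
    using sol by (auto simp: solution_on_def)
  note dG = smooth_on_differentiable[OF sG]
  have s\<omega>: "smooth_on U \<omega>" unfolding \<omega>_def by (rule smooth_on_weight[OF U sG F])
  note d\<omega> = has_wirtinger_works[OF smooth_on_differentiable[OF s\<omega>]]
  have V: "D_zbar G w = cnj (\<omega> w) *s F_map k (G w)" if "w \<in> U" for w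
    unfolding \<omega>_def by (rule D_zbar_eq_weight[OF dG[OF that] eq2[OF that] F[OF that]])
  have \<omega>': "d_zbar \<omega> w = of_real ((cmod (\<omega> w))\<^sup>2) *
    (cnj (bil (G w) (G w)) * G w $ k - of_nat n / (of_nat n - 2) * cnj (G w $ k))" if "w \<in> U" for w
    using eq1_iff[OF U sG that smooth_on_differentiable[OF s\<omega> that] V F[OF that]] eq1[OF that] by blast
  have closed_q: "Im (d_zbar (\<lambda>w. \<omega> w * G w $ k) w) = 0" if w: "w \<in> U" for w
  proof -
    have "d_zbar (\<lambda>w. \<omega> w * G w $ k) w = d_zbar \<omega> w * G w $ k + \<omega> w * D_zbar G w $ k"
      by (rule has_wirtinger_imp(2)) (rule has_wirtinger_mult has_wirtinger_vec_nth[OF dG[OF w]] d\<omega>[OF w])+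
    \<comment> \<open>The term \<open>conj Q G\<^sub>p^2\<close>, which need not be real, occurs
      with opposite signs in the derivative of \<open>\<omega>\<close> and in the k-th component of
      \<open>F\<close>, and cancels.\<close>
    also have "\<dots> = of_real ((cmod (\<omega> w))\<^sup>2) * (of_real (S_map (G w) / 2)
        - of_real (real n / (real n - 2) + 1) * (G w $ k * cnj (G w $ k)))"
      unfolding \<omega>'[OF w] V[OF w] complex_norm_square vector_smult_component F_map_nth
      by (simp add: algebra_simps)
    also have "\<dots> = of_real ((cmod (\<omega> w))\<^sup>2 * (S_map (G w) / 2 - (real n / (real n - 2) + 1) * (cmod (G w $ k))\<^sup>2))"
      unfolding complex_norm_square[symmetric] by simp
    finally show ?thesis by (simp only: Im_complex_of_real)
  qed
  have sg: "smooth_on U (\<lambda>w. G w $ i)" for i by (intro smooth_on_vec_nth U sG)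
  have sQ: "smooth_on U (\<lambda>w. bil (G w) (G w))" by (intro smooth_on_bil U sG)
  have hq: "smooth_on U h" "\<And>w. h w > 0"
    "\<And>w. w \<in> U \<Longrightarrow> (h has_derivative (\<lambda>v. 2 * Re (of_real (2 / (real n - 2)) * (\<omega> w * of_real (h w) * G w $ k) * v))) (at w)"
    if q: "Re_integral U (\<lambda>w. \<omega> w * G w $ k) q" and h: "h = (\<lambda>w. C * exp (2 / (real n - 2) * q w))" for q h
  proof -
    show "h w > 0" for w using C by (simp add: h)
    let ?\<psi> = "\<lambda>w. of_real (2 / (real n - 2)) * (\<omega> w * of_real (h w) * G w $ k)"
    show der: "(h has_derivative (\<lambda>v. 2 * Re (?\<psi> w * v))) (at w)" if w: "w \<in> U" for w
    proof -
      have "(q has_derivative (\<lambda>v. 2 * Re (\<omega> w * G w $ k * v))) (at w)"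
        using q w by (simp add: Re_integral_iff)
      then have "(h has_derivative (\<lambda>v. C * (exp (2 / (real n - 2) * q w) * (2 / (real n - 2) * (2 * Re (\<omega> w * G w $ k * v)))))) (at w)"
        unfolding h by (intro has_derivative_mult_right has_derivative_exp_compose)
      moreover have "C * (exp (2 / (real n - 2) * q w) * (2 / (real n - 2) * (2 * Re (\<omega> w * G w $ k * v)))) = 2 * Re (?\<psi> w * v)" for v
      proof -
        have "?\<psi> w * v = (2 / (real n - 2) * h w) *\<^sub>R (\<omega> w * G w $ k * v)"
          by (simp add: scaleR_conv_of_real)
        then have R: "Re (?\<psi> w * v) = 2 / (real n - 2) * h w * Re (\<omega> w * G w $ k * v)"
          by (simp only: scaleR_complex.simps(1))
        have E: "C * (exp (2 / (real n - 2) * q w) * x) = h w * x" for x by (simp only: h mult.assoc)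
        show ?thesis unfolding E R by simp
      qed
      ultimately show ?thesis by (simp only:)
    qed
    \<comment> \<open>The derivative of \<open>h\<close> contains \<open>h\<close> as a factor, so
      smoothness is obtained by bootstrapping.\<close>
    show "smooth_on U h"
    proof (rule smooth_onI_dir_deriv[OF U der])
      fix v k'
      assume "Ck_on k' U h"
      then show "Ck_on k' U (\<lambda>w. 2 * Re (?\<psi> w * v))"
        using s\<omega> sg by (intro Ck_on_linear[OF bounded_linear_mult_right] Ck_on_linear[OF bounded_linear_Re]
            Ck_on_linear[OF bounded_linear_of_real] bounded_bilinear.Ck_on[OF bounded_bilinear_mult]
            Ck_on_const U) (simp_all add: smooth_on_def)
    qed
  qed
  have null: "has_wirtinger (\<lambda>w. \<omega> w * of_real (h w))
      (d_z \<omega> w * of_real (h w) + \<omega> w * (of_real (2 / (real n - 2)) * (\<omega> w * of_real (h w) * G w $ k)))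
      (of_real ((cmod (\<omega> w * of_real (h w)))\<^sup>2 / h w) * (G w $ k * cnj (bil (G w) (G w)) - cnj (G w $ k))) w"
    "(\<omega> w * of_real (h w)) *s D_zbar G w = of_real ((cmod (\<omega> w * of_real (h w)))\<^sup>2 / h w) *s F_map k (G w)"
    if q: "Re_integral U (\<lambda>w. \<omega> w * G w $ k) q" and h: "h = (\<lambda>w. C * exp (2 / (real n - 2) * q w))" and w: "w \<in> U"
    for q h w
  proof -
    have h0: "h w > 0" by (rule hq(2)[OF q h])
    have c: "complex_of_real ((cmod (\<omega> w * of_real (h w)))\<^sup>2 / h w) = \<omega> w * cnj (\<omega> w) * of_real (h w)"
      using h0 unfolding of_real_divide complex_norm_square by simp
    let ?a = "of_real (2 / (real n - 2)) * (\<omega> w * of_real (h w) * G w $ k)"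
    have "has_wirtinger (\<lambda>w. of_real (h w)) ?a (cnj ?a) w"
      using hq(3)[OF q h w] unfolding has_wirtinger_of_real .
    from has_wirtinger_mult[OF d\<omega>[OF w] this]
    have "has_wirtinger (\<lambda>w. \<omega> w * of_real (h w)) (d_z \<omega> w * of_real (h w) + \<omega> w * ?a)
      (d_zbar \<omega> w * of_real (h w) + \<omega> w * cnj ?a) w" .
    moreover have "d_zbar \<omega> w * of_real (h w) + \<omega> w * cnj ?a
      = \<omega> w * cnj (\<omega> w) * of_real (h w) * (G w $ k * cnj (bil (G w) (G w)) - cnj (G w $ k))"
    proof -
      \<comment> \<open>In passing from \<open>\<omega>\<close> to \<open>\<omega> h\<close>, the
        derivative of \<open>h\<close> contributes \<open>K |\<omega>|^2 h conj G\<^sub>p\<close>,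
        which reduces the coefficient \<open>n / (n - 2) = 1 + K\<close> to 1.\<close>
      define K where "K = complex_of_real (2 / (real n - 2))"
      have K: "complex_of_nat n / (of_nat n - 2) = 1 + K"
      proof -
        have "real n / (real n - 2) = 1 + 2 / (real n - 2)" using n2 by (simp add: field_simps)
        then have "complex_of_real (real n / (real n - 2)) = complex_of_real (1 + 2 / (real n - 2))" by (simp only:)
        then show ?thesis by (simp add: K_def)
      qed
      have "cnj K = K" by (simp add: K_def)
      then show ?thesis
        unfolding \<omega>'[OF w] complex_norm_square K K_def[symmetric] by (simp add: algebra_simps)
    qed
    ultimately show "has_wirtinger (\<lambda>w. \<omega> w * of_real (h w)) (d_z \<omega> w * of_real (h w) + \<omega> w * ?a)
      (of_real ((cmod (\<omega> w * of_real (h w)))\<^sup>2 / h w) * (G w $ k * cnj (bil (G w) (G w)) - cnj (G w $ k))) w"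
      unfolding c by simp
    show "(\<omega> w * of_real (h w)) *s D_zbar G w = of_real ((cmod (\<omega> w * of_real (h w)))\<^sup>2 / h w) *s F_map k (G w)"
      unfolding c V[OF w] by (simp add: vec_eq_iff)
  qed
  have curve: "d_zbar (\<lambda>w. \<omega> w * of_real (h w) * (1 - bil (G w) (G w))) w
      = pde_rhs (1 / (2 * h w)) (2 * (cmod (\<omega> w * of_real (h w)))\<^sup>2 * S_map (G w))
          (2 * (\<omega> w * of_real (h w) * G w $ k)) 0 (\<omega> w * of_real (h w) * (1 - bil (G w) (G w)))"
    "d_zbar (\<lambda>w. \<omega> w * of_real (h w) * (\<i> * (1 + bil (G w) (G w)))) w
      = pde_rhs (1 / (2 * h w)) (2 * (cmod (\<omega> w * of_real (h w)))\<^sup>2 * S_map (G w))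
          (2 * (\<omega> w * of_real (h w) * G w $ k)) 0 (\<omega> w * of_real (h w) * (\<i> * (1 + bil (G w) (G w))))"
    "d_zbar (\<lambda>w. \<omega> w * of_real (h w) * (2 * G w $ i)) w
      = pde_rhs (1 / (2 * h w)) (2 * (cmod (\<omega> w * of_real (h w)))\<^sup>2 * S_map (G w))
          (2 * (\<omega> w * of_real (h w) * G w $ k)) (if i = k then 1 else 0) (\<omega> w * of_real (h w) * (2 * G w $ i))"
    if "Re_integral U (\<lambda>w. \<omega> w * G w $ k) q" "h = (\<lambda>w. C * exp (2 / (real n - 2) * q w))" "w \<in> U" for q h w i
    by (rule has_wirtinger_null_curve[where m="\<lambda>w. \<omega> w * of_real (h w)" and h=h and G=G and k=k and w=w,
          OF null(1)[OF that] dG[OF that(3)] null(2)[OF that]])+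
  have closed: "Im (d_zbar (\<lambda>w. \<omega> w * of_real (h w) * (1 - bil (G w) (G w))) w) = 0"
    "Im (d_zbar (\<lambda>w. \<omega> w * of_real (h w) * (\<i> * (1 + bil (G w) (G w)))) w) = 0"
    "Im (d_zbar (\<lambda>w. \<omega> w * of_real (h w) * (2 * G w $ i)) w) = 0"
    if "Re_integral U (\<lambda>w. \<omega> w * G w $ k) q" "h = (\<lambda>w. C * exp (2 / (real n - 2) * q w))" "w \<in> U" for q h w i
    by (simp_all only: curve[OF that] Im_pde_rhs)
  have form: "weight k G w * (1 - bil (G w) (G w)) * of_real x = \<omega> w * of_real x * (1 - bil (G w) (G w))"
    "\<i> * (weight k G w * (1 + bil (G w) (G w)) * of_real x) = \<omega> w * of_real x * (\<i> * (1 + bil (G w) (G w)))"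
    "2 * (weight k G w * (G w $ i) * of_real x) = \<omega> w * of_real x * (2 * G w $ i)" for w x i
    by (simp_all add: \<omega>_def mult_ac)
  have sm: "smooth_on U (\<lambda>w. \<omega> w * of_real (h w) * (1 - bil (G w) (G w)))"
    "smooth_on U (\<lambda>w. \<omega> w * of_real (h w) * (\<i> * (1 + bil (G w) (G w))))"
    "smooth_on U (\<lambda>w. \<omega> w * of_real (h w) * (2 * G w $ i))" if "smooth_on U h" for h i
    by (intro smooth_on_mult smooth_on_diff smooth_on_add smooth_on_const smooth_on_of_real U that s\<omega> sg sQ)+
  show "\<exists>f :: complex \<Rightarrow> 'e. represented_on n k b1 b2 b U G f" if sc: "simply_connected U"
  proof -
    note ex = Re_integral_exists[OF U sc]
    obtain q where q: "Re_integral U (\<lambda>w. \<omega> w * G w $ k) q"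
      using ex[OF smooth_on_mult[OF U s\<omega> sg] closed_q] by blast
    define h where "h = (\<lambda>w. C * exp (2 / (real n - 2) * q w))"
    note sh = sm[OF hq(1)[OF q h_def]]
    note cl = closed[OF q h_def]
    obtain u1 where u1: "Re_integral U (\<lambda>w. \<omega> w * of_real (h w) * (1 - bil (G w) (G w))) u1"
      using ex[OF sh(1) cl(1)] by blast
    obtain u2 where u2: "Re_integral U (\<lambda>w. \<omega> w * of_real (h w) * (\<i> * (1 + bil (G w) (G w)))) u2"
      using ex[OF sh(2) cl(2)] by blast
    have "\<exists>u. Re_integral U (\<lambda>w. \<omega> w * of_real (h w) * (2 * G w $ i)) u" for i
      by (rule ex[OF sh(3) cl(3)])
    then obtain u where u: "\<And>i. Re_integral U (\<lambda>w. \<omega> w * of_real (h w) * (2 * G w $ i)) (u i)"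
      by metis
    \<comment> \<open>The height along \<open>b k\<close> is prescribed by the formula for
      \<open>h\<close> instead of being taken as a primitive.\<close>
    define v where "v i w = (if i = k then (real n - 2) * h w else u i w)" for i w
    define f where "f w = u1 w *\<^sub>R b1 + u2 w *\<^sub>R b2 + (\<Sum>i\<in>UNIV. v i w *\<^sub>R b i)" for w
    have f: "f w \<bullet> b1 = u1 w" "f w \<bullet> b2 = u2 w" "f w \<bullet> b i = v i w" for w i
      by (simp_all add: f_def inner_add_left inner_sum_left on if_distrib cong: if_cong)
    have "represented_on n k b1 b2 b U G f"
      unfolding represented_on_def form
      using q h_def u1 u2 u by (intro exI[of _ q] exI[of _ h]) (auto simp: f v_def C_def \<omega>_def)
    then show ?thesis by blast
  qed
  show "singular_minimal_on (real n - 2) e {w \<in> U. D_zbar G w \<noteq> 0} f"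
    if rep: "represented_on n k b1 b2 b U G f"
  proof -
    obtain q h where q: "Re_integral U (\<lambda>w. \<omega> w * G w $ k) q"
      and h: "h = (\<lambda>w. C * exp (2 / (real n - 2) * q w))"
      and f1: "Re_integral U (\<lambda>w. \<omega> w * of_real (h w) * (1 - bil (G w) (G w))) (\<lambda>w. f w \<bullet> b1)"
      and f2: "Re_integral U (\<lambda>w. \<omega> w * of_real (h w) * (\<i> * (1 + bil (G w) (G w)))) (\<lambda>w. f w \<bullet> b2)"
      and fi: "\<And>i. i \<noteq> k \<Longrightarrow> Re_integral U (\<lambda>w. \<omega> w * of_real (h w) * (2 * G w $ i)) (\<lambda>w. f w \<bullet> b i)"
      and fk: "\<And>w. w \<in> U \<Longrightarrow> f w \<bullet> b k = (real n - 2) * h w"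
      using rep unfolding represented_on_def form C_def[symmetric] unfolding \<omega>_def by blast
    \<comment> \<open>The prescribed height is a primitive of the same shape as the other
      coordinates, because \<open>(n - 2) h\<^sub>z = 2 \<omega> h G\<^sub>p\<close>; from here on
      all indices are treated alike.\<close>
    have fk': "Re_integral U (\<lambda>w. \<omega> w * of_real (h w) * (2 * G w $ k)) (\<lambda>w. f w \<bullet> b k)"
      unfolding Re_integral_iff
    proof
      fix w assume w: "w \<in> U"
      have "((\<lambda>w. (real n - 2) * h w) has_derivative
          (\<lambda>v. (real n - 2) * (2 * Re (of_real (2 / (real n - 2)) * (\<omega> w * of_real (h w) * G w $ k) * v)))) (at w)"
        by (rule has_derivative_mult_right[OF hq(3)[OF q h w]])
      moreover have "(real n - 2) * (2 * Re (of_real (2 / (real n - 2)) * (\<omega> w * of_real (h w) * G w $ k) * v))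
          = 2 * Re (\<omega> w * of_real (h w) * (2 * G w $ k) * v)" for v
      proof -
        have "of_real (2 / (real n - 2)) * (\<omega> w * of_real (h w) * G w $ k) * v
            = (1 / (real n - 2)) *\<^sub>R (\<omega> w * of_real (h w) * (2 * G w $ k) * v)"
          by (simp add: scaleR_conv_of_real)
        then have R: "Re (of_real (2 / (real n - 2)) * (\<omega> w * of_real (h w) * G w $ k) * v)
            = 1 / (real n - 2) * Re (\<omega> w * of_real (h w) * (2 * G w $ k) * v)"
          by (simp only: scaleR_complex.simps(1))
        show ?thesis unfolding R using n2 by (simp del: times_complex.sel)
      qed
      ultimately have "((\<lambda>w. (real n - 2) * h w) has_derivative
          (\<lambda>v. 2 * Re (\<omega> w * of_real (h w) * (2 * G w $ k) * v))) (at w)" by (simp only:)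
      then show "((\<lambda>w. f w \<bullet> b k) has_derivative (\<lambda>v. 2 * Re (\<omega> w * of_real (h w) * (2 * G w $ k) * v))) (at w)"
        by (rule has_derivative_transform_within_open[OF _ U w]) (simp add: fk)
    qed
    then have fi': "Re_integral U (\<lambda>w. \<omega> w * of_real (h w) * (2 * G w $ i)) (\<lambda>w. f w \<bullet> b i)" for i
      using fi by (cases "i = k") auto
    note sh = sm[OF hq(1)[OF q h]]
    have sf: "smooth_on U f"
    proof -
      have "smooth_on U (\<lambda>w. (f w \<bullet> b1) *\<^sub>R b1 + (f w \<bullet> b2) *\<^sub>R b2 + (\<Sum>i\<in>UNIV. (f w \<bullet> b i) *\<^sub>R b i))"
        by (intro smooth_on_add smooth_on_sum smooth_on_scaleR smooth_on_const U
            smooth_on_Re_integral[OF U f1 sh(1)] smooth_on_Re_integral[OF U f2 sh(2)] smooth_on_Re_integral[OF U fi' sh(3)])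
      moreover have "(f w \<bullet> b1) *\<^sub>R b1 + (f w \<bullet> b2) *\<^sub>R b2 + (\<Sum>i\<in>UNIV. (f w \<bullet> b i) *\<^sub>R b i) = f w" for w
        by (rule orthonormal_basis_eqI[OF o]) (simp_all add: inner_add_left inner_sum_left on if_distrib cong: if_cong)
      ultimately show ?thesis by simp
    qed
    have c: "comp_z f b1 w = \<omega> w * of_real (h w) * (1 - bil (G w) (G w))"
      "comp_z f b2 w = \<omega> w * of_real (h w) * (\<i> * (1 + bil (G w) (G w)))"
      "comp_z f (b i) w = \<omega> w * of_real (h w) * (2 * G w $ i)" if "w \<in> U" for w i
      using f1 f2 fi' that unfolding Re_integral_def comp_z_def by blast+
    define U' where "U' = {w \<in> U. D_zbar G w \<noteq> 0}"
    have "smooth_on U (D_zbar G)"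
      unfolding D_zbar_def[abs_def] by (intro smooth_on_vec_lambda smooth_on_d_zbar sg U)
    then have U': "open U'" "U' \<subseteq> U"
      unfolding U'_def using open_nonzero[OF U] smooth_on_continuous_on by blast+
    have sf': "smooth_on U' f" using smooth_on_subset[OF sf U'(2)] .
    \<comment> \<open>As \<open>D_zbar G = conj \<omega> F(G)\<close> and \<open>h > 0\<close>, the
      factor of the null vector is nonzero wherever \<open>D_zbar G\<close> is; this makes the
      metric positive on \<open>U'\<close>.\<close>
    have m0: "\<omega> w * of_real (h w) \<noteq> 0" if "w \<in> U'" for w
      using that V[of w] hq(2)[OF q h, of w] by (auto simp: U'_def vec_eq_iff)
    have ff: "first_form f w 1 1 / 2 = 2 * (cmod (\<omega> w * of_real (h w)))\<^sup>2 * S_map (G w)"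
      "first_form f w \<i> \<i> = first_form f w 1 1" "first_form f w 1 \<i> = 0" if w: "w \<in> U" for w
    proof -
      let ?m = "\<omega> w * of_real (h w)"
      have "(comp_z f b1 w)\<^sup>2 + (comp_z f b2 w)\<^sup>2 + (\<Sum>i\<in>UNIV. (comp_z f (b i) w)\<^sup>2) = 0"
        using null_vector_square_sums(1)[of ?m "G w"] unfolding c[OF w] by (simp add: mult_ac)
      then show ff': "first_form f w \<i> \<i> = first_form f w 1 1" "first_form f w 1 \<i> = 0"
        unfolding comp_z_square_sums(1)[OF o smooth_on_differentiable[OF sf w]] by (simp_all add: complex_eq_iff)
      have "(first_form f w 1 1 + first_form f w \<i> \<i>) / 4 = 2 * (cmod ?m)\<^sup>2 * S_map (G w)"
        using null_vector_square_sums(2)[of ?m "G w"]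
        unfolding c[OF w] comp_z_square_sums(2)[OF o smooth_on_differentiable[OF sf w], symmetric] by (simp add: mult_ac)
      then show "first_form f w 1 1 / 2 = 2 * (cmod ?m)\<^sup>2 * S_map (G w)" using ff' by simp
    qed
    have conf: "conformal_on U' f"
      unfolding conformal_on_def
    proof (intro ballI conjI)
      fix w assume w: "w \<in> U'"
      then have wU: "w \<in> U" using U' by blast
      have "0 < 2 * (cmod (\<omega> w * of_real (h w)))\<^sup>2 * S_map (G w)"
        using m0[OF w] S_map_pos[of "G w"] by simp
      then show "first_form f w 1 1 > 0" unfolding ff(1)[OF wU, symmetric] by simp
      show "first_form f w \<i> \<i> = first_form f w 1 1" "first_form f w 1 \<i> = 0" using ff[OF wU] by simp_all
    qed
    have "singular_minimal_on (real n - 2) e U' f"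
      unfolding singular_minimal_on_conformal_iff[OF U'(1) sf' conf]
    proof (intro ballI conjI)
      fix w assume "w \<in> U'"
      then have w: "w \<in> U" using U' by blast
      have fe: "f w \<bullet> e = (real n - 2) * h w" using fk[OF w] e by simp
      then show "f w \<bullet> e > 0" using n2 hq(2)[OF q h, of w] by simp
      have a: "(real n - 2) / (2 * (f w \<bullet> e)) = 1 / (2 * h w)" unfolding fe using n2 by simp
      have ce: "comp_z f e w = 2 * (\<omega> w * of_real (h w) * G w $ k)"
        using c(3)[OF w, of k] e by simp
      have oe: "e \<bullet> b1 = 0" "e \<bullet> b2 = 0" "\<And>i. e \<bullet> b i = (if i = k then 1 else 0)"
        using on e by auto
      have dc: "d_zbar (comp_z f v) w = d_zbar \<phi> w" if "\<And>w. w \<in> U \<Longrightarrow> comp_z f v w = \<phi> w" for v \<phi>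
        unfolding d_zbar_def using dir_deriv_cong_open[OF U w, of "comp_z f v" \<phi>] that by simp
      note cv = curve[OF q h w]
      note li = laplacian_component_iff[OF U sf w, where e=e and a="real n - 2" and H="f w \<bullet> e",
          unfolded a ff(1)[OF w] ce]
      show "laplacian f w = ((real n - 2) / (f w \<bullet> e)) *\<^sub>R (first_form f w 1 1 *\<^sub>R e
        - (e \<bullet> dir_deriv 1 f w) *\<^sub>R dir_deriv 1 f w - (e \<bullet> dir_deriv \<i> f w) *\<^sub>R dir_deriv \<i> f w)"
      proof (rule orthonormal_basis_eqI[OF o]; subst li)
        show "d_zbar (comp_z f b1) w = pde_rhs (1 / (2 * h w)) (2 * (cmod (\<omega> w * of_real (h w)))\<^sup>2 * S_map (G w))
            (2 * (\<omega> w * of_real (h w) * G w $ k)) (e \<bullet> b1) (comp_z f b1 w)"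
          unfolding c(1)[OF w] oe
          by (rule trans[OF dc[of b1 "\<lambda>w. \<omega> w * of_real (h w) * (1 - bil (G w) (G w))", OF c(1)] cv(1)])
        show "d_zbar (comp_z f b2) w = pde_rhs (1 / (2 * h w)) (2 * (cmod (\<omega> w * of_real (h w)))\<^sup>2 * S_map (G w))
            (2 * (\<omega> w * of_real (h w) * G w $ k)) (e \<bullet> b2) (comp_z f b2 w)"
          unfolding c(2)[OF w] oe
          by (rule trans[OF dc[of b2 "\<lambda>w. \<omega> w * of_real (h w) * (\<i> * (1 + bil (G w) (G w)))", OF c(2)] cv(2)])
        show "d_zbar (comp_z f (b i)) w = pde_rhs (1 / (2 * h w)) (2 * (cmod (\<omega> w * of_real (h w)))\<^sup>2 * S_map (G w))
            (2 * (\<omega> w * of_real (h w) * G w $ k)) (e \<bullet> b i) (comp_z f (b i) w)" for i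
          unfolding c(3)[OF w] oe
          by (rule trans[OF dc[of "b i" "\<lambda>w. \<omega> w * of_real (h w) * (2 * G w $ i)", OF c(3)] cv(3)])
      qed
    qed
    then show ?thesis unfolding U'_def .
  qed
qed

theorem theorem3:
  fixes n :: nat and k :: "'p::finite"
    and e b1 b2 :: "'e::euclidean_space" and b :: "'p \<Rightarrow> 'e"
  assumes "n \<ge> 3" and "orthonormal_basis b1 b2 b" and "b k = e"
  shows
    "(\<forall>(A :: 'a::{t2_space,second_countable_topology} chart set) (g :: 'a \<Rightarrow> 'e).
        oriented_surface A \<and> singular_minimal_surface (real n - 2) e A g \<and> substantial g \<longrightarrow>
        (\<forall>U z. complex_chart A g (U, z) \<and> simply_connected U \<longrightarrow>
          (let f = in_chart g (U, z); \<Omega> = regular_points b1 b2 e (z ` U) f in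
            (\<exists>G :: complex \<Rightarrow> complex^'p.
              (\<forall>w\<in>\<Omega>. D_zbar G w \<noteq> 0) \<and> solution_on n k \<Omega> G \<and>
              represented_on n k b1 b2 b \<Omega> G f) \<and>
            open \<Omega> \<and>
            ((\<forall>W. open W \<and> W \<noteq> {} \<and> W \<subseteq> z ` U \<longrightarrow> affine hull (f ` W) = UNIV) \<longrightarrow>
              z ` U \<subseteq> closure \<Omega>))))
     \<and>
     (\<forall>U (G :: complex \<Rightarrow> complex^'p).
        open U \<and> simply_connected U \<and> (\<exists>w\<in>U. D_zbar G w \<noteq> 0) \<and> solution_on n k U G \<longrightarrow>
        (\<exists>f :: complex \<Rightarrow> 'e. represented_on n k b1 b2 b U G f) \<and>
        (\<forall>f :: complex \<Rightarrow> 'e. represented_on n k b1 b2 b U G f \<longrightarrow>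
           singular_minimal_on (real n - 2) e {w \<in> U. D_zbar G w \<noteq> 0} f))"
proof (intro conjI allI impI)
  fix A :: "'a chart set" and g :: "'a \<Rightarrow> 'e" and U z
  assume "oriented_surface A \<and> singular_minimal_surface (real n - 2) e A g \<and> substantial g"
    and "complex_chart A g (U, z) \<and> simply_connected U"
  then have A: "oriented_surface A" "singular_minimal_surface (real n - 2) e A g" "(U, z) \<in> A"
    and c: "complex_chart A g (U, z)"
    by (auto simp: complex_chart_def)
  let ?f = "in_chart g (U, z)"
  have op: "open (z ` U)"
    using A(1,3) by (auto simp: oriented_surface_def is_chart_def)
  have smin: "singular_minimal_on (real n - 2) e (z ` U) ?f"
    using A(2,3) by (auto simp: singular_minimal_surface_def)
  then have sm: "smooth_on (z ` U) ?f"
    by (simp add: singular_minimal_on_def immersion_on_def)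
  have conf: "conformal_on (z ` U) ?f"
    using c by (fastforce simp: complex_chart_def conformal_on_def)
  note main = singular_minimal_representation[OF assms op sm conf smin]
  show "let f = ?f; \<Omega> = regular_points b1 b2 e (z ` U) f in
      (\<exists>G :: complex \<Rightarrow> complex^'p. (\<forall>w\<in>\<Omega>. D_zbar G w \<noteq> 0) \<and> solution_on n k \<Omega> G \<and>
        represented_on n k b1 b2 b \<Omega> G f) \<and>
      open \<Omega> \<and>
      ((\<forall>W. open W \<and> W \<noteq> {} \<and> W \<subseteq> z ` U \<longrightarrow> affine hull (f ` W) = UNIV) \<longrightarrow>
        z ` U \<subseteq> closure \<Omega>)"
    unfolding Let_def
  proof (intro conjI impI)
    assume "\<forall>W. open W \<and> W \<noteq> {} \<and> W \<subseteq> z ` U \<longrightarrow> affine hull (?f ` W) = UNIV"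
    then show "z ` U \<subseteq> closure (regular_points b1 b2 e (z ` U) ?f)"
      by (intro main(3)) simp
  qed (rule main(1,2))+
next
  fix U and G :: "complex \<Rightarrow> complex^'p"
  assume "open U \<and> simply_connected U \<and> (\<exists>w\<in>U. D_zbar G w \<noteq> 0) \<and> solution_on n k U G"
  then have U: "open U" "solution_on n k U G" and sc: "simply_connected U" by auto
  note main = representation_singular_minimal[OF assms U]
  show "\<exists>f :: complex \<Rightarrow> 'e. represented_on n k b1 b2 b U G f"
    by (rule main(1)[OF sc])
  show "singular_minimal_on (real n - 2) e {w \<in> U. D_zbar G w \<noteq> 0} f"
    if "represented_on n k b1 b2 b U G f" for f :: "complex \<Rightarrow> 'e"
    by (rule main(2)[OF that])
qed

end
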